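(* Let $\Gamma:\Lambda\to S^{2,2}$ and $\tilde\Gamma:\tilde\Lambda\to S^{2,2}$ be two biisotropic curves defined on open intervals. Let $\zeta$ and $\tilde\zeta$ be affine line elements of $\Gamma$ and $\tilde\Gamma$, respectively. If the affine lengths $\ell=\int_\Lambda\zeta$ and $\tilde\ell=\int_{\tilde\Lambda}\tilde\zeta$ are finite, then $f^{\pm}_\Gamma$ and $f^{\pm}_{\tilde\Gamma}$ are second order deformations of each other (with unfixed parameters).
   Context: Ambient spaces. $\mathbb{R}^{2,3}$ is $\mathbb{R}^5$ with $\langle X,Y\rangle=-(X^0Y^4+X^4Y^0)-X^1Y^1+X^2Y^2+X^3Y^3$. $G=\mathrm{O}^{\uparrow}_+(2,3)$ is the identity component of its isometry group. $[X]$ denotes the ray spanned by $X\neq0$; for several vectors $[X\wedge Y\wedge\cdots]$ is their linear span. $\mathcal{E}^{1,2}$ (Einstein universe) is the manifold of null rays of $\mathbb{R}^{2,3}$, on which $G$ acts by $F\cdot[X]=[FX]$. With $(E_i)$ the standard basis, $P_0=(E_0+E_4)/\sqrt2$, $P_1=E_1$, an isotropic bivector $V\wedge W\ne0$ ($\langle V,V\rangle=\langle W,W\rangle=\langle V,W\rangle=0$) is positive if $\langle P_0,V\rangle\langle P_1,W\rangle-\langle P_1,V\rangle\langle P_0,W\rangle>0$. $S^{2,2}=\{V:\langle V,V\rangle=1\}$. Biisotropic curves. Primes denote derivatives with respect to a nowhere zero 1-form $\zeta$ on the 1-manifold $\Lambda$ ($dH=H'\zeta$). An immersed curve $\Gamma:\Lambda\to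 S^{2,2}$ is biisotropic if $\langle\Gamma',\Gamma'\rangle=\langle\Gamma'',\Gamma''\rangle=0$ and $\Gamma'\wedge\Gamma''\neq0$ everywhere. Then $\mathbb{V}_\Gamma=[(\Gamma'\wedge\Gamma'')|_\tau]$ is a null plane independent of $\tau$, oriented by positive bivectors. Given a positive area form $dA$ on $\mathbb{V}_\Gamma$, the affine line element of $\Gamma$ relative to $dA$ is the unique 1-form $\zeta$ with $dA(\Gamma',\Gamma'')=1$; affine line elements are defined up to a positive constant factor. With derivatives taken with respect to an affine line element, an isotropic normal vector field along $\Gamma$ is a smooth $\mathrm{R}:\Lambda\to\mathbb{R}^{2,3}$ with $\langle\mathrm{R},\mathrm{R}\rangle=\langle\mathrm{R},\Gamma\rangle=\langle\mathrm{R},\Gamma'\rangle=0$, $\langle\mathrm{R},\Gamma''\rangle=1$; it exists and is unique up to adding a function times $\Gamma'$. The normal tube is $\mathbb{T}_\Gamma=\{(\tau,[V])\in\Lambda\times\mathcal{E}^{1,2}:V\in[(\mathrm{R}\wedge\Gamma')|_\tau]\}$, with points $(\tau,[\cos\theta\,\mathrm{R}|_\tau+\tfrac12\sin\theta\,\Gamma'|_\tau])$, $\theta\in\mathbb{R}/2\pi\mathbb{Z}$; $\mathbb{T}^{\pm}_\Gamma$ is the subset where $\mathrm{sgn}(\cos\theta)=\pm1$. The maps $f^{\pm}_\Gamma:\mathbb{T}^{\pm}_\Gamma\to\mathcal{E}^{1,2}$ are the restrictions to $\mathbb{T}^{\pm}_\Gamma$ of the map $(\tau,[V])\mapsto[V]$.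 Deformations. Two maps $f:M\to\mathcal{E}^{1,2}$ and $\hat f:\hat M\to\mathcal{E}^{1,2}$ are second order deformations of each other (with unfixed parameters) if there exist a diffeomorphism $\Phi:M\to\hat M$ (the change of parameters) and a nonconstant map $\Delta:M\to G$ (the deformation) such that $f$ and $\Delta(p)\cdot\hat f\circ\Phi$ have second order contact at $p$, for every $p\in M$.
   Formalization: Proved for f^± not congruent (equal up to change of parameters and one fixed element of G), since otherwise the deformation is forced constant; and if det(Γ,Γ',Γ'',R,R') has opposite signs for the two curves (e.g. Γ and −Γ), f^± is paired with f^∓ of the other curve. *)

theory Defs
  imports "HOL-Analysis.Analysis"
begin

section \<open>Smooth maps\<close>

fun Ck_on :: "nat \<Rightarrow> 'a::real_normed_vector set \<Rightarrow> ('a \<Rightarrow> 'b::real_normed_vector) \<Rightarrow> bool" where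
  "Ck_on 0 S f \<longleftrightarrow> continuous_on S f"
| "Ck_on (Suc k) S f \<longleftrightarrow>
     (\<forall>x\<in>S. f differentiable (at x)) \<and> (\<forall>v. Ck_on k S (\<lambda>x. frechet_derivative f (at x) v))"

(* For open S. *)
definition smooth_on :: "'a::real_normed_vector set \<Rightarrow> ('a \<Rightarrow> 'b::real_normed_vector) \<Rightarrow> bool" where
  "smooth_on S f \<longleftrightarrow> (\<forall>k. Ck_on k S f)"

(* Smoothness on an arbitrary subset M: local extendability to a smooth map on an open set. For an
   embedded submanifold M this is smoothness in the sense of manifolds. *)
definition smooth_map :: "'a::real_normed_vector set \<Rightarrow> ('a \<Rightarrow> 'b::real_normed_vector) \<Rightarrow> bool" where
  "smooth_map M f \<longleftrightarrow>
     (\<forall>p\<in>M. \<exists>U g. open U \<and> p \<in> U \<and> smooth_on U g \<and> (\<forall>q\<in>M \<inter> U. f q = g q))"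

definition diffeomorphism ::
  "'a::real_normed_vector set \<Rightarrow> 'b::real_normed_vector set \<Rightarrow> ('a \<Rightarrow> 'b) \<Rightarrow> bool" where
  "diffeomorphism M N \<Phi> \<longleftrightarrow>
     bij_betw \<Phi> M N \<and> smooth_map M \<Phi> \<and> smooth_map N (inv_into M \<Phi>)"

definition jet2 :: "(real \<Rightarrow> 'a::real_normed_vector) \<Rightarrow> 'a \<times> 'a \<times> 'a" where
  "jet2 c = (c 0, vector_derivative c (at 0),
             vector_derivative (\<lambda>t. vector_derivative c (at t)) (at 0))"

(* Equality of the 2-jets at p of two smooth maps on the submanifold M, in the coordinate-free form:
   f and g map every smooth curve of M through p to curves with the same 2-jet. *)
definition second_order_contact ::
  "'a::real_normed_vector set \<Rightarrow> ('a \<Rightarrow> 'b::real_normed_vector) \<Rightarrow> ('a \<Rightarrow> 'b) \<Rightarrow> 'a \<Rightarrow> bool" where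
  "second_order_contact M f g p \<longleftrightarrow>
     (\<forall>c e. 0 < e \<and> smooth_on {-e<..<e} c \<and> c ` {-e<..<e} \<subseteq> M \<and> c 0 = p
        \<longrightarrow> jet2 (f \<circ> c) = jet2 (g \<circ> c))"

section \<open>The Einstein universe\<close>

(* The elements of the index type 5 are 0, 1, 2, 3, 4, so X $ i is the coordinate X^i. *)
definition sprod :: "real^5 \<Rightarrow> real^5 \<Rightarrow> real" where
  "sprod X Y = - (X $ 0 * Y $ 4 + X $ 4 * Y $ 0) - X $ 1 * Y $ 1 + X $ 2 * Y $ 2 + X $ 3 * Y $ 3"

definition isometries :: "(real^5^5) set" where
  "isometries = {F. \<forall>X Y. sprod (F *v X) (F *v Y) = sprod X Y}"

definition G :: "(real^5^5) set" where
  "G = connected_component_set isometries (mat 1)"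

(* A ray is encoded by the unique vector of Euclidean norm 1 on it. This identifies the manifold of
   null rays with a submanifold of the Euclidean unit sphere. *)
definition ray :: "real^5 \<Rightarrow> real^5" where
  "ray X = sgn X"

definition einstein :: "(real^5) set" where
  "einstein = {ray X | X. X \<noteq> 0 \<and> sprod X X = 0}"

definition act :: "real^5^5 \<Rightarrow> real^5 \<Rightarrow> real^5" where
  "act F x = ray (F *v x)"

definition S22 :: "(real^5) set" where
  "S22 = {V. sprod V V = 1}"

definition wedge :: "real^5 \<Rightarrow> real^5 \<Rightarrow> real^5^5" where
  "wedge V W = (\<chi> i j. V $ i * W $ j - V $ j * W $ i)"

definition P0 :: "real^5" where
  "P0 = (axis 0 1 + axis 4 1) /\<^sub>R sqrt 2"

definition P1 :: "real^5" where
  "P1 = axis 1 1"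

definition positive_bivector :: "real^5 \<Rightarrow> real^5 \<Rightarrow> bool" where
  "positive_bivector V W \<longleftrightarrow>
     wedge V W \<noteq> 0 \<and> sprod V V = 0 \<and> sprod W W = 0 \<and> sprod V W = 0 \<and>
     sprod P0 V * sprod P1 W - sprod P1 V * sprod P0 W > 0"

section \<open>Biisotropic curves and their normal tubes\<close>

(* A 1-form on an open interval is written z(t) dt and is represented by its coefficient z.
   Prime z H is the derivative H' of H with respect to it, given by dH = H' z(t) dt. *)
definition Prime :: "(real \<Rightarrow> real) \<Rightarrow> (real \<Rightarrow> real^5) \<Rightarrow> real \<Rightarrow> real^5" where
  "Prime \<zeta> H \<tau> = vector_derivative H (at \<tau>) /\<^sub>R \<zeta> \<tau>"

definition open_interval :: "real set \<Rightarrow> bool" where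
  "open_interval \<Lambda> \<longleftrightarrow> open \<Lambda> \<and> is_interval \<Lambda> \<and> \<Lambda> \<noteq> {}"

(* The pointwise conditions do not depend on the nowhere zero 1-form; they are stated with dt. *)
definition biisotropic :: "real set \<Rightarrow> (real \<Rightarrow> real^5) \<Rightarrow> bool" where
  "biisotropic \<Lambda> \<Gamma> \<longleftrightarrow> smooth_on \<Lambda> \<Gamma> \<and>
     (\<forall>\<tau>\<in>\<Lambda>. let T = Prime (\<lambda>_. 1) \<Gamma> \<tau>; U = Prime (\<lambda>_. 1) (Prime (\<lambda>_. 1) \<Gamma>) \<tau> in
        \<Gamma> \<tau> \<in> S22 \<and> T \<noteq> 0 \<and> sprod T T = 0 \<and> sprod U U = 0 \<and> wedge T U \<noteq> 0)"

(* For a biisotropic curve this plane does not depend on the point. *)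
definition null_plane :: "(real \<Rightarrow> real^5) \<Rightarrow> real \<Rightarrow> (real^5) set" where
  "null_plane \<Gamma> \<tau> = span {Prime (\<lambda>_. 1) \<Gamma> \<tau>, Prime (\<lambda>_. 1) (Prime (\<lambda>_. 1) \<Gamma>) \<tau>}"

(* An area form on the plane P is given by a bilinear extension to the whole space; only its
   values on P matter. *)
definition positive_area_form :: "(real^5) set \<Rightarrow> (real^5 \<Rightarrow> real^5 \<Rightarrow> real) \<Rightarrow> bool" where
  "positive_area_form P dA \<longleftrightarrow> bilinear dA \<and> (\<forall>V\<in>P. dA V V = 0) \<and>
     (\<forall>V\<in>P. \<forall>W\<in>P. positive_bivector V W \<longrightarrow> dA V W > 0)"

definition affine_line_element :: "real set \<Rightarrow> (real \<Rightarrow> real^5) \<Rightarrow> (real \<Rightarrow> real) \<Rightarrow> bool" where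
  "affine_line_element \<Lambda> \<Gamma> \<zeta> \<longleftrightarrow> smooth_on \<Lambda> \<zeta> \<and> (\<forall>\<tau>\<in>\<Lambda>. \<zeta> \<tau> \<noteq> 0) \<and>
     (\<exists>dA. \<forall>\<tau>\<in>\<Lambda>. positive_area_form (null_plane \<Gamma> \<tau>) dA \<and>
                   dA (Prime \<zeta> \<Gamma> \<tau>) (Prime \<zeta> (Prime \<zeta> \<Gamma>) \<tau>) = 1)"

definition isotropic_normal ::
  "real set \<Rightarrow> (real \<Rightarrow> real^5) \<Rightarrow> (real \<Rightarrow> real) \<Rightarrow> (real \<Rightarrow> real^5) \<Rightarrow> bool" where
  "isotropic_normal \<Lambda> \<Gamma> \<zeta> R \<longleftrightarrow> smooth_on \<Lambda> R \<and>
     (\<forall>\<tau>\<in>\<Lambda>. sprod (R \<tau>) (R \<tau>) = 0 \<and> sprod (R \<tau>) (\<Gamma> \<tau>) = 0 \<and>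
        sprod (R \<tau>) (Prime \<zeta> \<Gamma> \<tau>) = 0 \<and> sprod (R \<tau>) (Prime \<zeta> (Prime \<zeta> \<Gamma>) \<tau>) = 1)"

definition normal_tube ::
  "real set \<Rightarrow> (real \<Rightarrow> real^5) \<Rightarrow> (real \<Rightarrow> real) \<Rightarrow> (real \<Rightarrow> real^5) \<Rightarrow> (real \<times> (real^5)) set" where
  "normal_tube \<Lambda> \<Gamma> \<zeta> R = {(\<tau>, x). \<tau> \<in> \<Lambda> \<and> x \<in> einstein \<and> x \<in> span {R \<tau>, Prime \<zeta> \<Gamma> \<tau>}}"

definition half_tube ::
  "real \<Rightarrow> real set \<Rightarrow> (real \<Rightarrow> real^5) \<Rightarrow> (real \<Rightarrow> real) \<Rightarrow> (real \<Rightarrow> real^5) \<Rightarrow> (real \<times> (real^5)) set" where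
  "half_tube \<epsilon> \<Lambda> \<Gamma> \<zeta> R = {(\<tau>, x) \<in> normal_tube \<Lambda> \<Gamma> \<zeta> R.
     \<exists>\<theta>. x = ray (cos \<theta> *\<^sub>R R \<tau> + (1/2 * sin \<theta>) *\<^sub>R Prime \<zeta> \<Gamma> \<tau>) \<and> sgn (cos \<theta>) = \<epsilon>}"

definition tube_map :: "real \<times> (real^5) \<Rightarrow> real^5" where
  "tube_map p = snd p"

(* The determinant of the frame (Gamma, Gamma', Gamma'', R, R') never vanishes, so its sign is
   constant along the curve; it depends neither on R nor on the affine line element. It is an
   invariant of the curve under G (all of whose elements have determinant 1), and it takes
   opposite values on Gamma and -Gamma. *)
definition frame_det :: "(real \<Rightarrow> real^5) \<Rightarrow> (real \<Rightarrow> real) \<Rightarrow> (real \<Rightarrow> real^5) \<Rightarrow> real \<Rightarrow> real" where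
  "frame_det \<Gamma> \<zeta> R \<tau> = det ((\<chi> i. if i = 0 then \<Gamma> \<tau>
                             else if i = 1 then Prime \<zeta> \<Gamma> \<tau>
                             else if i = 2 then Prime \<zeta> (Prime \<zeta> \<Gamma>) \<tau>
                             else if i = 3 then R \<tau>
                             else Prime \<zeta> R \<tau>) :: real^5^5)"

definition cooriented ::
  "real set \<Rightarrow> (real \<Rightarrow> real^5) \<Rightarrow> (real \<Rightarrow> real) \<Rightarrow> (real \<Rightarrow> real^5) \<Rightarrow>
   real set \<Rightarrow> (real \<Rightarrow> real^5) \<Rightarrow> (real \<Rightarrow> real) \<Rightarrow> (real \<Rightarrow> real^5) \<Rightarrow> bool" where
  "cooriented \<Lambda> \<Gamma> \<zeta> R \<Lambda>' \<Gamma>' \<zeta>' R' \<longleftrightarrow>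
     (\<forall>\<tau>\<in>\<Lambda>. \<forall>\<tau>'\<in>\<Lambda>'. sgn (frame_det \<Gamma> \<zeta> R \<tau>) = sgn (frame_det \<Gamma>' \<zeta>' R' \<tau>'))"

section \<open>Deformations\<close>

definition second_order_deformation ::
  "'a::real_normed_vector set \<Rightarrow> ('a \<Rightarrow> real^5) \<Rightarrow> 'b::real_normed_vector set \<Rightarrow> ('b \<Rightarrow> real^5) \<Rightarrow> bool" where
  "second_order_deformation M f N h \<longleftrightarrow>
     (\<exists>\<Phi> \<Delta>. diffeomorphism M N \<Phi> \<and>
        smooth_map M \<Delta> \<and> \<Delta> ` M \<subseteq> G \<and> \<not> \<Delta> constant_on M \<and>
        (\<forall>p\<in>M. second_order_contact M f (\<lambda>q. act (\<Delta> p) (h (\<Phi> q))) p))"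

(* Equality up to a change of parameters and one fixed element of G; a constant map Delta would
   amount to this. *)
definition congruent_maps ::
  "'a::real_normed_vector set \<Rightarrow> ('a \<Rightarrow> real^5) \<Rightarrow> 'b::real_normed_vector set \<Rightarrow> ('b \<Rightarrow> real^5) \<Rightarrow> bool" where
  "congruent_maps M f N h \<longleftrightarrow>
     (\<exists>\<Phi>. \<exists>F\<in>G. diffeomorphism M N \<Phi> \<and> (\<forall>p\<in>M. f p = act F (h (\<Phi> p))))"

end

theory Submission
  imports Defs
begin

text \<open>Parametrize both curves by a multiple of the affine length running over \<open>(0,1)\<close>, and choose the
  normal field \<open>r\<close> with \<open>\<langle>r', r'\<rangle> = 0\<close>. The frame \<open>(\<gamma>, T, U, r, q)\<close> with \<open>T = \<gamma>'\<close>, \<open>U = \<gamma>''\<close>,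
  \<open>q = r'\<close> then has a constant Gram matrix and satisfies \<open>U' = a T\<close>, \<open>q' = \<gamma> + a r\<close> for one function \<open>a\<close>.
  Hence the isometry \<open>F s\<close> that carries one frame at the parameter \<open>s\<close> to the other also carries
  \<open>\<phi> = r + u T\<close> and its first derivatives to those of the other tube, while the second derivatives
  differ by a multiple of \<open>\<phi>\<close> itself, which is invisible to the ray \<open>[\<phi>]\<close>. So \<open>(s, u) \<mapsto> (s, u)\<close> is the
  change of parameters and \<open>F s\<close> the deformation. If the frame determinants of the two curves have
  opposite signs, \<open>F s\<close> is brought into the identity component by negating one of the frames,
  which exchanges the two halves of its tube.\<close>

section \<open>Calculus of smooth maps\<close>

text \<open>The common interval (0,1) is where finite affine length enters: an antiderivative of the
  line element has bounded image, and rescaling this image removes the difference between the two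
  lengths. Affine length also kills the U-component of U': the area dA(T, U) is constant, so dA(T,
  U') = 0. A normal field is determined up to adding h T, which changes <r', r'> by -2 h', so one
  quadrature normalizes r. Along a curve (s(t), u(t)) the terms with a in the second derivative of r
  + u T are s'^2 (a r + u a T), which is the announced multiple; F is held fixed at the point of
  contact, so none of its derivatives enters. Two signs put F into the identity component: that of
  det F, a quotient of frame determinants, and the positivity of the bivectors of T and U before and
  after applying F. The deformation is not constant because otherwise contact of order zero at every
  point would be a congruence of the two tubes, which the hypotheses exclude.\<close>

lemma frechet_derivative_cong_open:
  assumes "open S" "x \<in> S" "\<And>y. y \<in> S \<Longrightarrow> f y = g y"
  shows "frechet_derivative f (at x) = frechet_derivative g (at x)"
    and "f differentiable (at x) \<longleftrightarrow> g differentiable (at x)"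
proof -
  have *: "(f has_derivative D) (at x) \<longleftrightarrow> (g has_derivative D) (at x)" for D
    using assms by (metis has_derivative_transform_within_open)
  show "frechet_derivative f (at x) = frechet_derivative g (at x)"
    by (simp add: frechet_derivative_def *)
  show "f differentiable (at x) \<longleftrightarrow> g differentiable (at x)"
    by (simp add: differentiable_def *)
qed

lemma Ck_on_cong:
  assumes "open S" "\<And>x. x \<in> S \<Longrightarrow> f x = g x"
  shows "Ck_on k S f \<longleftrightarrow> Ck_on k S g"
  using assms(2)
proof (induction k arbitrary: f g)
  case 0
  show ?case using continuous_on_cong[OF refl, of S f g] 0 by simp
next
  case (Suc k)
  have "Ck_on k S (\<lambda>x. frechet_derivative f (at x) v) \<longleftrightarrow> Ck_on k S (\<lambda>x. frechet_derivative g (at x) v)" for v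
    by (rule Suc.IH) (simp add: frechet_derivative_cong_open(1)[OF assms(1) _ Suc.prems])
  then show ?case
    using frechet_derivative_cong_open(2)[OF assms(1) _ Suc.prems] by simp
qed

text \<open>\<open>Ck_on\<close> refers to the chosen \<open>frechet_derivative\<close>; here an
  explicit formula for the derivative may replace it, so that the inductions on k can follow the
  usual rules of calculus.\<close>

lemma Ck_on_SucI:
  assumes "open S" "\<And>x. x \<in> S \<Longrightarrow> (f has_derivative D x) (at x)"
    and "\<And>v. Ck_on k S (\<lambda>x. D x v)"
  shows "Ck_on (Suc k) S f"
proof -
  have "frechet_derivative f (at x) = D x" if "x \<in> S" for x
    using frechet_derivative_at[OF assms(2)[OF that]] by simp
  then have "Ck_on k S (\<lambda>x. frechet_derivative f (at x) v)" for v
    using assms(1,3) by (simp add: Ck_on_cong[of S _ "\<lambda>x. D x v"])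
  then show ?thesis
    using assms(2) by (auto simp: differentiable_def)
qed

lemma Ck_on_SucD:
  assumes "Ck_on (Suc k) S f"
  shows "x \<in> S \<Longrightarrow> (f has_derivative frechet_derivative f (at x)) (at x)"
    and "Ck_on k S (\<lambda>x. frechet_derivative f (at x) v)"
  using assms frechet_derivative_works by auto

lemma Ck_on_Suc_imp: "Ck_on (Suc k) S f \<Longrightarrow> Ck_on k S f"
proof (induction k arbitrary: f)
  case 0
  then show ?case
    by (auto intro!: continuous_at_imp_continuous_on differentiable_imp_continuous_within)
next
  case (Suc k)
  then show ?case by (metis Ck_on.simps(2))
qed

lemma Ck_on_subset: "Ck_on k S f \<Longrightarrow> T \<subseteq> S \<Longrightarrow> Ck_on k T f"
  by (induction k arbitrary: f) (auto intro: continuous_on_subset)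

lemma Ck_on_const: "open S \<Longrightarrow> Ck_on k S (\<lambda>x. c)"
  by (induction k arbitrary: c) (auto intro: Ck_on_SucI[where D = "\<lambda>_ _. 0"] simp del: Ck_on.simps(2))

lemma Ck_on_bounded_linear_comp:
  assumes "open S" "bounded_linear L" "Ck_on k S f"
  shows "Ck_on k S (\<lambda>x. L (f x))"
  using assms(3)
proof (induction k arbitrary: f)
  case 0
  then show ?case
    using assms(2) by (simp add: bounded_linear.continuous_on)
next
  case (Suc k)
  show ?case
  proof (rule Ck_on_SucI[OF assms(1)])
    show "((\<lambda>x. L (f x)) has_derivative (\<lambda>v. L (frechet_derivative f (at x) v))) (at x)" if "x \<in> S" for x
      using Ck_on_SucD(1)[OF Suc.prems that] by (rule bounded_linear.has_derivative[OF assms(2)])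
    show "Ck_on k S (\<lambda>x. L (frechet_derivative f (at x) v))" for v
      by (rule Suc.IH) (rule Ck_on_SucD(2)[OF Suc.prems])
  qed
qed

lemma Ck_on_id: "open S \<Longrightarrow> Ck_on k S (\<lambda>x. x)"
  by (cases k) (auto intro!: Ck_on_SucI[where D = "\<lambda>_ v. v"] Ck_on_const simp del: Ck_on.simps(2))

lemma Ck_on_add:
  assumes "open S" "Ck_on k S f" "Ck_on k S g"
  shows "Ck_on k S (\<lambda>x. f x + g x)"
  using assms(2,3)
proof (induction k arbitrary: f g)
  case 0
  then show ?case by (simp add: continuous_on_add)
next
  case (Suc k)
  show ?case
  proof (rule Ck_on_SucI[OF assms(1)])
    show "((\<lambda>x. f x + g x) has_derivative (\<lambda>v. frechet_derivative f (at x) v + frechet_derivative g (at x) v)) (at x)"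
      if "x \<in> S" for x
      using Ck_on_SucD(1)[OF Suc.prems(1) that] Ck_on_SucD(1)[OF Suc.prems(2) that] by (rule has_derivative_add)
    show "Ck_on k S (\<lambda>x. frechet_derivative f (at x) v + frechet_derivative g (at x) v)" for v
      by (rule Suc.IH) (rule Ck_on_SucD(2)[OF Suc.prems(1)] Ck_on_SucD(2)[OF Suc.prems(2)])+
  qed
qed

lemma Ck_on_sum:
  assumes "open S" "\<And>i. i \<in> I \<Longrightarrow> Ck_on k S (f i)"
  shows "Ck_on k S (\<lambda>x. \<Sum>i\<in>I. f i x)"
  using assms(2)
  by (induction I rule: infinite_finite_induct) (auto intro!: Ck_on_const Ck_on_add assms(1))

lemma Ck_on_bounded_bilinear:
  assumes "bounded_bilinear B" "open S" "Ck_on k S f" "Ck_on k S g"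
  shows "Ck_on k S (\<lambda>x. B (f x) (g x))"
  using assms(3,4)
proof (induction k arbitrary: f g)
  case 0
  then show ?case using bounded_bilinear.continuous_on[OF assms(1)] by simp
next
  case (Suc k)
  show ?case
  proof (rule Ck_on_SucI[OF assms(2)])
    show "((\<lambda>x. B (f x) (g x)) has_derivative
        (\<lambda>v. B (f x) (frechet_derivative g (at x) v) + B (frechet_derivative f (at x) v) (g x))) (at x)"
      if "x \<in> S" for x
      using Ck_on_SucD(1)[OF Suc.prems(1) that] Ck_on_SucD(1)[OF Suc.prems(2) that]
      by (rule bounded_bilinear.FDERIV[OF assms(1)])
    show "Ck_on k S (\<lambda>x. B (f x) (frechet_derivative g (at x) v) + B (frechet_derivative f (at x) v) (g x))" for v
      by (intro Ck_on_add Suc.IH assms(2) Ck_on_SucD(2)[OF Suc.prems(1)] Ck_on_SucD(2)[OF Suc.prems(2)]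
          Ck_on_Suc_imp[OF Suc.prems(1)] Ck_on_Suc_imp[OF Suc.prems(2)])
  qed
qed

text \<open>The chain rule only produces derivatives of \<^term>\<open>g\<close> in moving directions; expanding the
  direction in an orthonormal basis reduces them to derivatives in fixed directions.\<close>

lemma Ck_on_compose:
  fixes f :: "'a::real_normed_vector \<Rightarrow> 'b::euclidean_space"
  assumes "open S" "open T" "f ` S \<subseteq> T" "Ck_on k S f" "Ck_on k T g"
  shows "Ck_on k S (\<lambda>x. g (f x))"
  using assms(4,5)
proof (induction k arbitrary: g)
  case 0
  then show ?case using assms(3) by (simp add: continuous_on_compose2)
next
  case (Suc k)
  let ?D = "\<lambda>x v. \<Sum>b\<in>Basis. (frechet_derivative f (at x) v \<bullet> b) *\<^sub>R frechet_derivative g (at (f x)) b"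
  show ?case
  proof (rule Ck_on_SucI[OF assms(1)])
    fix x assume x: "x \<in> S"
    then have fx: "f x \<in> T" using assms(3) by auto
    note dg = Ck_on_SucD(1)[OF Suc.prems(2) fx]
    have "((\<lambda>x. g (f x)) has_derivative (\<lambda>v. frechet_derivative g (at (f x)) (frechet_derivative f (at x) v))) (at x)"
      using has_derivative_compose[OF Ck_on_SucD(1)[OF Suc.prems(1) x] dg] .
    moreover have "frechet_derivative g (at (f x)) w = (\<Sum>b\<in>Basis. (w \<bullet> b) *\<^sub>R frechet_derivative g (at (f x)) b)" for w
    proof -
      have "frechet_derivative g (at (f x)) (\<Sum>b\<in>Basis. (w \<bullet> b) *\<^sub>R b) = (\<Sum>b\<in>Basis. (w \<bullet> b) *\<^sub>R frechet_derivative g (at (f x)) b)"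
        using has_derivative_linear[OF dg] by (simp add: linear_sum linear_cmul o_def)
      then show ?thesis by (simp add: euclidean_representation)
    qed
    then have "(\<lambda>v. frechet_derivative g (at (f x)) (frechet_derivative f (at x) v)) = ?D x"
      by (rule ext)
    ultimately show "((\<lambda>x. g (f x)) has_derivative ?D x) (at x)"
      by simp
  next
    fix v
    show "Ck_on k S (\<lambda>x. ?D x v)"
    proof (intro Ck_on_sum assms(1) Ck_on_bounded_bilinear[OF bounded_bilinear_scaleR])
      fix b :: 'b
      show "Ck_on k S (\<lambda>x. frechet_derivative f (at x) v \<bullet> b)"
        by (intro Ck_on_bounded_linear_comp[OF assms(1) bounded_linear_inner_left] Ck_on_SucD(2)[OF Suc.prems(1)])
      show "Ck_on k S (\<lambda>x. frechet_derivative g (at (f x)) b)"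
        by (rule Suc.IH) (rule Ck_on_Suc_imp[OF Suc.prems(1)] Ck_on_SucD(2)[OF Suc.prems(2)])+
    qed
  qed
qed

lemma Ck_on_real_SucI:
  fixes f :: "real \<Rightarrow> 'b::real_normed_vector"
  assumes "open S" "\<And>x. x \<in> S \<Longrightarrow> (f has_vector_derivative g x) (at x)" "Ck_on k S g"
  shows "Ck_on (Suc k) S f"
proof (rule Ck_on_SucI[OF assms(1)])
  show "(f has_derivative (\<lambda>v. v *\<^sub>R g x)) (at x)" if "x \<in> S" for x
    using assms(2)[OF that] by (simp add: has_vector_derivative_def)
  show "Ck_on k S (\<lambda>x. v *\<^sub>R g x)" for v
    by (rule Ck_on_bounded_linear_comp[OF assms(1) bounded_linear_scaleR_right assms(3)])
qed

text \<open>Up to sign the derivative of \<open>inverse\<close> is a product of two copies of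
  \<open>inverse\<close>, so the product rule at level k closes the induction.\<close>

lemma Ck_on_inverse: "Ck_on k (- {0::real}) inverse"
proof (induction k)
  case 0
  show ?case by (auto intro!: continuous_intros)
next
  case (Suc k)
  show ?case
  proof (rule Ck_on_real_SucI)
    show "(inverse has_vector_derivative (- (inverse x * inverse x))) (at x)" if "x \<in> - {0}" for x :: real
      using that DERIV_inverse[of x UNIV]
      by (auto simp: has_real_derivative_iff_has_vector_derivative power2_eq_square numeral_2_eq_2)
    show "Ck_on k (- {0::real}) (\<lambda>x. - (inverse x * inverse x))"
      by (intro Ck_on_bounded_linear_comp[OF _ bounded_linear_minus[OF bounded_linear_ident]]
          Ck_on_bounded_bilinear[OF bounded_bilinear_mult] Suc.IH) auto
  qed auto
qed

text \<open>The derivative is half the \<open>inverse\<close> of \<open>sqrt\<close> itself; the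
  induction hypothesis enters through composition with \<open>inverse\<close>, whose argument stays
  away from 0 on the open half line.\<close>

lemma Ck_on_sqrt: "Ck_on k {0<..} sqrt"
proof (induction k)
  case 0
  show ?case by (auto intro!: continuous_intros)
next
  case (Suc k)
  show ?case
  proof (rule Ck_on_real_SucI)
    show "(sqrt has_vector_derivative (inverse (sqrt x) * (1 / 2))) (at x)" if "x \<in> {0<..}" for x :: real
      using that DERIV_real_sqrt[of x]
      by (auto simp: has_real_derivative_iff_has_vector_derivative)
    show "Ck_on k {0<..} (\<lambda>x. inverse (sqrt x) * (1 / 2))"
      by (intro Ck_on_bounded_bilinear[OF bounded_bilinear_mult] Ck_on_const Ck_on_compose[OF _ _ _ Suc.IH Ck_on_inverse]) auto
  qed auto
qed

section \<open>Closure properties of smooth functions\<close>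

lemma smooth_on_cong: "open S \<Longrightarrow> (\<And>x. x \<in> S \<Longrightarrow> f x = g x) \<Longrightarrow> smooth_on S f \<longleftrightarrow> smooth_on S g"
  unfolding smooth_on_def using Ck_on_cong by blast

lemma smooth_on_subset: "smooth_on S f \<Longrightarrow> T \<subseteq> S \<Longrightarrow> smooth_on T f"
  unfolding smooth_on_def using Ck_on_subset by blast

lemma smooth_on_const: "open S \<Longrightarrow> smooth_on S (\<lambda>x. c)"
  by (simp add: smooth_on_def Ck_on_const)

lemma smooth_on_id: "open S \<Longrightarrow> smooth_on S (\<lambda>x. x)"
  by (simp add: smooth_on_def Ck_on_id)

lemma smooth_on_bounded_linear_comp:
  "open S \<Longrightarrow> bounded_linear L \<Longrightarrow> smooth_on S f \<Longrightarrow> smooth_on S (\<lambda>x. L (f x))"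
  by (simp add: smooth_on_def Ck_on_bounded_linear_comp)

lemma smooth_on_add:
  "open S \<Longrightarrow> smooth_on S f \<Longrightarrow> smooth_on S g \<Longrightarrow> smooth_on S (\<lambda>x. f x + g x)"
  by (simp add: smooth_on_def Ck_on_add)

lemma smooth_on_bounded_bilinear:
  "bounded_bilinear B \<Longrightarrow> open S \<Longrightarrow> smooth_on S f \<Longrightarrow> smooth_on S g \<Longrightarrow> smooth_on S (\<lambda>x. B (f x) (g x))"
  by (simp add: smooth_on_def Ck_on_bounded_bilinear)

lemma smooth_on_scaleR:
  "open S \<Longrightarrow> smooth_on S f \<Longrightarrow> smooth_on S g \<Longrightarrow> smooth_on S (\<lambda>x. f x *\<^sub>R g x)"
  by (rule smooth_on_bounded_bilinear[OF bounded_bilinear_scaleR])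

lemma smooth_on_mult:
  fixes f g :: "_ \<Rightarrow> real"
  shows "open S \<Longrightarrow> smooth_on S f \<Longrightarrow> smooth_on S g \<Longrightarrow> smooth_on S (\<lambda>x. f x * g x)"
  by (rule smooth_on_bounded_bilinear[OF bounded_bilinear_mult])

lemma smooth_on_minus: "open S \<Longrightarrow> smooth_on S f \<Longrightarrow> smooth_on S (\<lambda>x. - f x)"
  by (rule smooth_on_bounded_linear_comp[OF _ bounded_linear_minus[OF bounded_linear_ident]])

lemma smooth_on_diff:
  "open S \<Longrightarrow> smooth_on S f \<Longrightarrow> smooth_on S g \<Longrightarrow> smooth_on S (\<lambda>x. f x - g x)"
  using smooth_on_add[OF _ _ smooth_on_minus] by simp

lemma smooth_on_compose:
  fixes f :: "'a::real_normed_vector \<Rightarrow> 'b::euclidean_space"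
  assumes "open S" "open T" "f ` S \<subseteq> T" "smooth_on S f" "smooth_on T g"
  shows "smooth_on S (\<lambda>x. g (f x))"
  using assms Ck_on_compose unfolding smooth_on_def by blast

lemma smooth_on_Pair:
  assumes "open S" "smooth_on S f" "smooth_on S g"
  shows "smooth_on S (\<lambda>x. (f x, g x))"
proof -
  have "smooth_on S (\<lambda>x. (f x, 0) + (0, g x))"
    by (intro smooth_on_add smooth_on_bounded_linear_comp[where L = "\<lambda>x. (x, 0)"]
        smooth_on_bounded_linear_comp[where L = "\<lambda>x. (0, x)"] assms bounded_linear_Pair
        bounded_linear_ident bounded_linear_zero)
  then show ?thesis by simp
qed

lemma smooth_on_inverse:
  assumes "open S" "smooth_on S f" "\<And>x. x \<in> S \<Longrightarrow> f x \<noteq> (0::real)"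
  shows "smooth_on S (\<lambda>x. inverse (f x))"
  by (rule smooth_on_compose[OF assms(1) _ _ assms(2), where T = "- {0}"])
    (use assms(3) in \<open>auto simp: smooth_on_def Ck_on_inverse\<close>)

lemma smooth_on_divide:
  assumes "open S" "smooth_on S f" "smooth_on S g" "\<And>x. x \<in> S \<Longrightarrow> g x \<noteq> (0::real)"
  shows "smooth_on S (\<lambda>x. f x / g x)"
  unfolding divide_inverse by (intro smooth_on_mult smooth_on_inverse assms)

lemma smooth_on_sgn:
  fixes f :: "'a::real_normed_vector \<Rightarrow> 'b::euclidean_space"
  assumes "open S" "smooth_on S f" "\<And>x. x \<in> S \<Longrightarrow> f x \<noteq> 0"
  shows "smooth_on S (\<lambda>x. sgn (f x))"
proof -
  have "smooth_on S (\<lambda>x. sqrt (f x \<bullet> f x))"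
    by (rule smooth_on_compose[where T = "{0<..}"])
      (use assms in \<open>auto simp: smooth_on_def Ck_on_sqrt intro!: Ck_on_bounded_bilinear[OF bounded_bilinear_inner]\<close>)
  then have "smooth_on S (\<lambda>x. inverse (sqrt (f x \<bullet> f x)) *\<^sub>R f x)"
    using assms by (intro smooth_on_scaleR smooth_on_inverse) auto
  then show ?thesis
    by (simp add: sgn_div_norm norm_eq_sqrt_inner)
qed

lemma smooth_on_has_derivative:
  "smooth_on S f \<Longrightarrow> x \<in> S \<Longrightarrow> (f has_derivative frechet_derivative f (at x)) (at x)"
  unfolding smooth_on_def using Ck_on_SucD(1) by blast

lemma smooth_on_has_vector_derivative:
  "smooth_on S f \<Longrightarrow> x \<in> S \<Longrightarrow> (f has_vector_derivative vector_derivative f (at x)) (at x)"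
  using smooth_on_has_derivative[of S f x] by (auto simp: vector_derivative_works[symmetric] differentiable_def)

lemma smooth_on_imp_continuous_on: "smooth_on S f \<Longrightarrow> continuous_on S f"
  unfolding smooth_on_def using Ck_on.simps(1) by blast

lemma smooth_on_vector_derivative:
  fixes f :: "real \<Rightarrow> 'b::real_normed_vector"
  assumes "open S" "smooth_on S f"
  shows "smooth_on S (\<lambda>x. vector_derivative f (at x))"
proof -
  have "smooth_on S (\<lambda>x. frechet_derivative f (at x) 1)"
    using assms(2) Ck_on_SucD(2) unfolding smooth_on_def by blast
  moreover have "frechet_derivative f (at x) 1 = vector_derivative f (at x)" if "x \<in> S" for x
  proof -
    have "f differentiable (at x)"
      using smooth_on_has_derivative[OF assms(2) that] by (rule differentiableI)
    then show ?thesis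
      by (simp add: frechet_derivative_eq_vector_derivative)
  qed
  ultimately show ?thesis
    by (rule iffD1[OF smooth_on_cong[OF assms(1)], rotated])
qed

lemma smooth_on_antiderivative:
  fixes f :: "real \<Rightarrow> 'b::real_normed_vector"
  assumes "open S" "\<And>x. x \<in> S \<Longrightarrow> (f has_vector_derivative g x) (at x)" "smooth_on S g"
  shows "smooth_on S f"
  using Ck_on_Suc_imp[OF Ck_on_real_SucI[OF assms(1,2)]] assms(3) unfolding smooth_on_def by blast

text \<open>Bootstrap: if f is of class k, so is its derivative, the composition of g with f, and f
  is of class k + 1. This yields the smoothness of an inverse parameter, whose derivative is a
  function of its own value.\<close>

lemma smooth_on_autonomous_ode:
  fixes f g :: "real \<Rightarrow> real"
  assumes "open S" "open T" "f ` S \<subseteq> T"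
    and "\<And>x. x \<in> S \<Longrightarrow> (f has_vector_derivative g (f x)) (at x)" "smooth_on T g"
  shows "smooth_on S f"
  unfolding smooth_on_def
proof
  show "Ck_on k S f" for k
  proof (induction k)
    case 0
    show ?case
      using assms(4) by (auto intro!: continuous_at_imp_continuous_on has_vector_derivative_continuous)
  next
    case (Suc k)
    show ?case
      by (rule Ck_on_real_SucI[OF assms(1,4)])
        (use assms(5) in \<open>auto simp: smooth_on_def intro!: Ck_on_compose[OF assms(1-3) Suc.IH]\<close>)
  qed
qed

lemma smooth_map_if_smooth_on:
  assumes "open U" "M \<subseteq> U" "smooth_on U g" "\<And>q. q \<in> M \<Longrightarrow> f q = g q"
  shows "smooth_map M f"
  unfolding smooth_map_def using assms by blast

section \<open>The identity component of the isometry group\<close>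

lemma exhaust_5:
  fixes x :: 5
  shows "x = 0 \<or> x = 1 \<or> x = 2 \<or> x = 3 \<or> x = 4"
proof (induct x)
  case (of_int z)
  then have "z = 0 \<or> z = 1 \<or> z = 2 \<or> z = 3 \<or> z = 4" by fastforce
  then show ?case by auto
qed

lemma forall_5: "(\<forall>i::5. P i) \<longleftrightarrow> P 0 \<and> P 1 \<and> P 2 \<and> P 3 \<and> P 4"
  by (metis exhaust_5)

lemma UNIV_5: "UNIV = {0, 1, 2, 3, 4::5}"
  using exhaust_5 by auto

lemma sum_5: "sum f (UNIV::5 set) = f 0 + f 1 + f 2 + f 3 + f 4"
  unfolding UNIV_5 by (simp add: ac_simps)

section \<open>The form of signature (2,3) and the projection of null planes to its negative
  part\<close>

interpretation sprod: bounded_bilinear sprod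
proof -
  have "bilinear sprod"
    unfolding bilinear_def sprod_def by (auto intro!: linearI simp: algebra_simps)
  then show "bounded_bilinear sprod" by (simp add: bilinear_conv_bounded_bilinear)
qed

lemmas sprod_simps = sprod.add_left sprod.add_right sprod.diff_left sprod.diff_right
  sprod.scaleR_left sprod.scaleR_right sprod.minus_left sprod.minus_right sprod.zero_left sprod.zero_right

lemma sprod_commute: "sprod X Y = sprod Y X"
  by (simp add: sprod_def)

lemma sprod_nondegenerate:
  assumes "\<And>Y. sprod X Y = 0"
  shows "X = 0"
  using assms[of "axis 0 1"] assms[of "axis 1 1"] assms[of "axis 2 1"] assms[of "axis 3 1"] assms[of "axis 4 1"]
  by (simp add: sprod_def axis_def vec_eq_iff forall_5)

text \<open>\<open>P0\<close> and \<open>P1\<close> are an orthonormal basis of a negative definite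
  plane, and this is the signed area spanned by the projections of V and W to it.\<close>

definition biproj :: "real^5 \<Rightarrow> real^5 \<Rightarrow> real" where
  "biproj V W = sprod P0 V * sprod P1 W - sprod P1 V * sprod P0 W"

lemma sprod_P:
  "sprod P0 P0 = -1" "sprod P1 P1 = -1" "sprod P0 P1 = 0" "sprod P1 P0 = 0"
  "sprod P0 X = - (X $ 0 + X $ 4) / sqrt 2" "sprod X P0 = - (X $ 0 + X $ 4) / sqrt 2"
  "sprod P1 X = - (X $ 1)" "sprod X P1 = - (X $ 1)"
  by (simp_all add: sprod_def P0_def P1_def axis_def field_simps)

text \<open>Orthogonality to \<open>P0\<close> turns the hyperbolic term -2 X^0 X^4 into 2 (X^0)^2,
  and orthogonality to \<open>P1\<close> removes the negative square: the complement of a maximal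
  negative definite plane is positive definite.\<close>

lemma spacelike:
  assumes "sprod X P0 = 0" "sprod X P1 = 0"
  shows "sprod X X \<ge> 0" "sprod X X = 0 \<Longrightarrow> X = 0"
proof -
  have *: "X $ 4 = - X $ 0" "X $ 1 = 0" using assms by (auto simp: sprod_P)
  have "sprod X X = 2 * (X $ 0)\<^sup>2 + (X $ 2)\<^sup>2 + (X $ 3)\<^sup>2"
    by (simp add: sprod_def * power2_eq_square)
  moreover from this have "X = 0" if "sprod X X = 0"
    using that * by (simp add: vec_eq_iff forall_5 add_nonneg_eq_0_iff)
  ultimately show "sprod X X \<ge> 0" "sprod X X = 0 \<Longrightarrow> X = 0" by auto
qed

text \<open>If the determinant were zero, a nontrivial combination of V and W would be orthogonal to
  \<open>P0\<close> and \<open>P1\<close>; being null as well, it would vanish by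
  \<open>spacelike\<close>. So a totally null plane projects isomorphically to the negative definite
  plane, and the sign of \<open>biproj\<close> orients it.\<close>

lemma biproj_nonzero:
  assumes "sprod V V = 0" "sprod W W = 0" "sprod V W = 0"
    and "\<And>x y. x *\<^sub>R V + y *\<^sub>R W = 0 \<Longrightarrow> x = 0 \<and> y = 0"
  shows "biproj V W \<noteq> 0"
proof
  assume 0: "biproj V W = 0"
  define a b c d where abcd: "a = sprod P0 V" "b = sprod P0 W" "c = sprod P1 V" "d = sprod P1 W"
  have "\<exists>x y. (x, y) \<noteq> (0, 0) \<and> x * a + y * b = 0 \<and> x * c + y * d = 0"
  proof (cases "a = 0 \<and> b = 0")
    case True
    show ?thesis
    proof (cases "c = 0 \<and> d = 0")
      case True
      then show ?thesis using \<open>a = 0 \<and> b = 0\<close> by (intro exI[of _ 1]) auto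
    next
      case False
      then show ?thesis using \<open>a = 0 \<and> b = 0\<close> by (intro exI[of _ d] exI[of _ "- c"]) auto
    qed
  next
    case False
    then show ?thesis using 0 unfolding biproj_def abcd[symmetric]
      by (intro exI[of _ b] exI[of _ "- a"]) (auto simp: algebra_simps)
  qed
  then obtain x y where xy: "(x, y) \<noteq> (0, 0)" "x * a + y * b = 0" "x * c + y * d = 0" by blast
  define X where "X = x *\<^sub>R V + y *\<^sub>R W"
  have "sprod X P0 = 0" "sprod X P1 = 0" "sprod X X = 0"
    using xy(2,3) assms(1-3) by (simp_all add: X_def abcd sprod_simps sprod_commute)
  then have "X = 0" by (rule spacelike(2))
  with assms(4) xy(1) show False by (auto simp: X_def)
qed

lemma biproj_nonzeroD:
  assumes "biproj V W \<noteq> 0" "x *\<^sub>R V + y *\<^sub>R W = 0"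
  shows "x = 0 \<and> y = 0"
proof -
  have "sprod P0 (x *\<^sub>R V + y *\<^sub>R W) = 0" "sprod P1 (x *\<^sub>R V + y *\<^sub>R W) = 0"
    using assms(2) by (simp_all add: sprod_simps)
  then have *: "x * sprod P0 V + y * sprod P0 W = 0" "x * sprod P1 V + y * sprod P1 W = 0"
    by (simp_all add: sprod_simps)
  \<comment> \<open>Cramer's rule for the two equations in x and y.\<close>
  have "x * biproj V W = (x * sprod P0 V + y * sprod P0 W) * sprod P1 W - (x * sprod P1 V + y * sprod P1 W) * sprod P0 W"
       "y * biproj V W = (x * sprod P1 V + y * sprod P1 W) * sprod P0 V - (x * sprod P0 V + y * sprod P0 W) * sprod P1 V"
    by (simp_all add: biproj_def algebra_simps)
  with assms(1) * show ?thesis by auto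
qed

section \<open>Isometries and the component of the identity\<close>

lemma isometries_sprod: "A \<in> isometries \<Longrightarrow> sprod (A *v X) (A *v Y) = sprod X Y"
  by (simp add: isometries_def)

lemma isometries_mult: "A \<in> isometries \<Longrightarrow> B \<in> isometries \<Longrightarrow> A ** B \<in> isometries"
  by (simp add: isometries_def matrix_vector_mul_assoc[symmetric])

lemma isometries_injective:
  assumes "A \<in> isometries" "A *v X = 0"
  shows "X = 0"
  using assms isometries_sprod[OF assms(1), of X] by (auto intro!: sprod_nondegenerate simp: sprod_simps)

lemma isometries_det_nonzero: "A \<in> isometries \<Longrightarrow> det A \<noteq> 0"
  using isometries_injective invertible_det_nz[of A] invertible_left_inverse[of A]
    matrix_left_invertible_ker[of A] by blast

lemma isometries_biproj_nonzero:
  assumes "A \<in> isometries" "biproj V W \<noteq> 0" "sprod V V = 0" "sprod W W = 0" "sprod V W = 0"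
  shows "biproj (A *v V) (A *v W) \<noteq> 0"
proof (rule biproj_nonzero)
  fix x y
  assume "x *\<^sub>R (A *v V) + y *\<^sub>R (A *v W) = 0"
  then have "A *v (x *\<^sub>R V + y *\<^sub>R W) = 0"
    by (simp add: matrix_vector_right_distrib matrix_vector_mult_scaleR)
  then show "x = 0 \<and> y = 0"
    using isometries_injective[OF assms(1)] biproj_nonzeroD[OF assms(2)] by blast
qed (simp_all add: assms isometries_sprod)

lemma mat_1_in_G: "mat 1 \<in> G"
  by (simp add: G_def isometries_def)

lemma G_subset_isometries: "G \<subseteq> isometries"
  by (simp add: G_def connected_component_subset)

lemma G_superset:
  assumes "connected T" "T \<subseteq> isometries" "g \<in> T" "g \<in> G"
  shows "T \<subseteq> G"
proof -
  have "G = connected_component_set isometries g"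
    using assms(4) unfolding G_def by (metis connected_component_eq)
  then show ?thesis
    using connected_component_maximal[OF assms(3,1,2)] by simp
qed

lemma connected_G_image: "connected ((\<lambda>h. h ** A) ` G)"
proof (rule connected_continuous_image)
  have "linear (\<lambda>h::real^5^5. h ** A)"
    by (rule linearI) (simp_all add: matrix_matrix_mult_def vec_eq_iff sum.distrib distrib_right
        sum_distrib_left mult.assoc)
  then show "continuous_on G (\<lambda>h. h ** A)"
    by (intro linear_continuous_on) (simp add: linear_conv_bounded_linear)
  show "connected G" by (simp add: G_def connected_connected_component)
qed

lemma G_image_subset: "A \<in> isometries \<Longrightarrow> (\<lambda>h. h ** A) ` G \<subseteq> isometries"
  using isometries_mult G_subset_isometries by blast

text \<open>This does the work of inverses in \<open>G\<close>: the translate of \<open>G\<close> by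
  A from the right is connected, meets \<open>G\<close> in \<open>g ** A\<close>, and contains A as
  the translate of \<open>mat 1\<close>.\<close>

lemma G_cancel_left:
  assumes "g \<in> G" "A \<in> isometries" "g ** A \<in> G"
  shows "A \<in> G"
  using G_superset[OF connected_G_image[of A] G_image_subset[OF assms(2)] imageI[OF assms(1)] assms(3)]
    imageI[OF mat_1_in_G, of "\<lambda>g. g ** A"]
  by auto

lemma sgn_constant_on_connected:
  fixes f :: "'a::topological_space \<Rightarrow> real"
  assumes "connected S" "continuous_on S f" "\<And>x. x \<in> S \<Longrightarrow> f x \<noteq> 0" "x \<in> S" "y \<in> S"
  shows "sgn (f x) = sgn (f y)"
proof (rule ccontr)
  assume "sgn (f x) \<noteq> sgn (f y)"
  then have "f x < 0 \<and> f y > 0 \<or> f x > 0 \<and> f y < 0"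
    using assms(3)[OF assms(4)] assms(3)[OF assms(5)] by (auto simp: sgn_if split: if_splits)
  moreover have "is_interval (f ` S)"
    using connected_continuous_image[OF assms(2,1)] by (simp add: is_interval_connected_1)
  ultimately have "0 \<in> f ` S"
    using assms(4,5) unfolding is_interval_1 by (meson imageI less_imp_le)
  then show False using assms(3) by auto
qed

text \<open>A and \<open>g ** A\<close> lie in one connected set of isometries, the right translate
  of \<open>G\<close> by A, on which f has no zero. It is used for \<open>det\<close> and for
  \<open>biproj\<close> on a fixed null plane.\<close>

lemma sgn_invariant_left_mult:
  assumes "continuous_on UNIV f" "\<And>B. B \<in> isometries \<Longrightarrow> f B \<noteq> (0::real)" "g \<in> G" "A \<in> isometries"
  shows "sgn (f (g ** A)) = sgn (f A)"
proof (rule sgn_constant_on_connected[OF connected_G_image[of A]])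
  show "continuous_on ((\<lambda>h. h ** A) ` G) f" using assms(1) continuous_on_subset by blast
  show "A \<in> (\<lambda>h. h ** A) ` G" using mat_1_in_G by (metis image_eqI matrix_mul_lid)
qed (use assms(2-4) G_image_subset in blast)+

section \<open>Rotations and boosts as paths of isometries from the identity\<close>

lemma one_parameter_in_G:
  assumes "\<And>t. linear (f t)" "\<And>t X Y. sprod (f t X) (f t Y) = sprod X Y"
    and "\<And>X. continuous_on UNIV (\<lambda>t::real. f t X)" "\<And>X. f 0 X = X"
  shows "matrix (f t) \<in> G"
proof -
  have mv: "matrix (f t) *v X = f t X" for t X
    by (simp add: matrix_works assms(1) linear_matrix_vector_mul_eq)
  have "continuous_on UNIV (\<lambda>t. matrix (f t))"
    unfolding matrix_def by (intro continuous_on_vec_lambda continuous_on_component assms(3))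
  then have "connected (range (\<lambda>t. matrix (f t)))"
    by (rule connected_continuous_image) (rule connected_UNIV)
  moreover have "range (\<lambda>t. matrix (f t)) \<subseteq> isometries"
    by (auto simp: isometries_def mv assms(2))
  moreover have "matrix (f 0) = mat 1"
    unfolding matrix_eq by (simp add: mv assms(4))
  ultimately show ?thesis
    using G_superset mat_1_in_G by (metis rangeI subsetD)
qed

text \<open>Since \<alpha> is its own inverse, \<open>\<alpha> * sprod X p\<close> is the
  p-coordinate of X. The path f t turns the definite plane of p and q by the angle t and fixes its
  orthogonal complement; undoing the polar angle of the projection of v moves that projection onto
  the ray of p.\<close>

lemma rotation:
  assumes "sprod p p = \<alpha>" "sprod q q = \<alpha>" "sprod p q = 0" "\<alpha> = 1 \<or> \<alpha> = -1"
  obtains g where "g \<in> G" "\<And>X. sprod X p = 0 \<Longrightarrow> sprod X q = 0 \<Longrightarrow> g *v X = X"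
    "sprod (g *v v) q = 0" "\<alpha> * sprod (g *v v) p \<ge> 0"
proof -
  define f where "f = (\<lambda>t X. X + (\<alpha> * sprod X p) *\<^sub>R ((cos t - 1) *\<^sub>R p + sin t *\<^sub>R q)
     + (\<alpha> * sprod X q) *\<^sub>R ((cos t - 1) *\<^sub>R q - sin t *\<^sub>R p))"
  have lin: "linear (f t)" for t
    by (rule linearI) (auto simp: f_def sprod_simps algebra_simps)
  have iso: "sprod (f t X) (f t Y) = sprod X Y" for t X Y
  proof -
    have qp: "sprod q p = 0" using assms(3) by (simp add: sprod_commute)
    define a b a' b' c s where abbr: "a = sprod X p" "b = sprod X q" "a' = sprod Y p" "b' = sprod Y q"
      "c = cos t" "s = sin t"
    have YX: "sprod p Y = a'" "sprod q Y = b'" by (simp_all add: abbr sprod_commute)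
    have "c\<^sup>2 + s\<^sup>2 = 1" by (simp add: abbr)
    then have s: "s * s = 1 - c * c" by (simp add: power2_eq_square)
    define m n m' n' where mn: "m = \<alpha> * (a * (c - 1) - b * s)" "n = \<alpha> * (a * s + b * (c - 1))"
       "m' = \<alpha> * (a' * (c - 1) - b' * s)" "n' = \<alpha> * (a' * s + b' * (c - 1))"
    have "f t X = X + m *\<^sub>R p + n *\<^sub>R q" "f t Y = Y + m' *\<^sub>R p + n' *\<^sub>R q"
      by (simp_all add: f_def mn abbr algebra_simps)
    then have "sprod (f t X) (f t Y) = sprod X Y + m' * a + n' * b + m * a' + n * b' + \<alpha> * m * m' + \<alpha> * n * n'"
      by (simp add: sprod_simps assms qp YX abbr(1-4)[symmetric] algebra_simps)
    moreover have "m' * a + n' * b + m * a' + n * b' + \<alpha> * m * m' + \<alpha> * n * n' = 0"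
      using assms(4) s unfolding mn by (elim disjE; simp; algebra)
    ultimately show ?thesis by simp
  qed
  have inG: "matrix (f t) \<in> G" for t
    by (rule one_parameter_in_G[OF lin iso]) (auto simp: f_def intro!: continuous_intros)
  have mv: "matrix (f t) *v X = f t X" for t X
    by (simp add: matrix_works lin linear_matrix_vector_mul_eq)
  obtain r \<phi> where r: "r \<ge> 0" "sprod v p = \<alpha> * (r * cos \<phi>)" "sprod v q = \<alpha> * (r * sin \<phi>)"
  proof -
    obtain r \<phi> where *: "\<alpha> * sprod v p = r * cos \<phi>" "\<alpha> * sprod v q = r * sin \<phi>"
      using polar_Ex by blast
    have "\<alpha> * (\<alpha> * x) = x" for x using assms(4) by auto
    then have *: "sprod v p = \<alpha> * (r * cos \<phi>)" "sprod v q = \<alpha> * (r * sin \<phi>)"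
      by (simp_all only: *[symmetric])
    \<comment> \<open>\<open>polar_Ex\<close> leaves the sign of the radius open; half a turn
      repairs a negative one, which secures the inequality in the conclusion.\<close>
    show ?thesis
    proof (cases "r \<ge> 0")
      case True
      then show ?thesis using * by (rule that)
    next
      case False
      show ?thesis
        by (rule that[of "-r" "\<phi> + pi"]) (use False * in simp_all)
    qed
  qed
  show thesis
  proof (rule that[of "matrix (f (- \<phi>))"])
    have qp: "sprod q p = 0" using assms(3) by (simp add: sprod_commute)
    have aa: "\<alpha> * \<alpha> = 1" using assms(4) by auto
    then have a: "\<alpha> * (\<alpha> * x) = x" for x by (simp add: mult.assoc[symmetric])
    have cs: "sin \<phi> * sin \<phi> = 1 - cos \<phi> * cos \<phi>"
      using sin_cos_squared_add[of \<phi>] by (simp add: power2_eq_square algebra_simps)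
    have "sprod (f (- \<phi>) v) q = \<alpha> * (r * sin \<phi>) + \<alpha> * ((\<alpha> * (\<alpha> * (r * cos \<phi>))) * (- sin \<phi>))
        + \<alpha> * ((\<alpha> * (\<alpha> * (r * sin \<phi>))) * (cos \<phi> - 1))"
      by (simp add: f_def sprod_simps assms(1-3) r algebra_simps)
    also have "\<dots> = 0" unfolding a by (simp add: algebra_simps)
    finally show "sprod (matrix (f (- \<phi>)) *v v) q = 0" by (simp add: mv)
    have "sprod (f (- \<phi>) v) p = \<alpha> * (r * cos \<phi>) + \<alpha> * ((\<alpha> * (\<alpha> * (r * cos \<phi>))) * (cos \<phi> - 1))
        + \<alpha> * ((\<alpha> * (\<alpha> * (r * sin \<phi>))) * sin \<phi>)"
      by (simp add: f_def sprod_simps assms(1,2) qp r algebra_simps)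
    also have "\<dots> = \<alpha> * r" unfolding a using cs by algebra
    finally show "\<alpha> * sprod (matrix (f (- \<phi>)) *v v) p \<ge> 0" using r(1) by (simp add: mv a)
  qed (simp_all add: inG mv, simp_all add: f_def)
qed

lemma tanh_surj:
  fixes y :: real
  assumes "\<bar>y\<bar> < 1"
  obtains t where "tanh t = y"
proof
  have "-1 < y" "y < 1" using assms by auto
  then have "exp (ln ((1 + y) / (1 - y))) = (1 + y) / (1 - y)" by simp
  then have "exp (- ln ((1 + y) / (1 - y))) = (1 - y) / (1 + y)"
    by (simp add: exp_minus)
  then have "tanh (ln ((1 + y) / (1 - y)) / 2) = (1 - (1 - y) / (1 + y)) / (1 + (1 - y) / (1 + y))"
    by (simp add: tanh_real_altdef)
  moreover have "1 - (1 - y) / (1 + y) = 2 * y / (1 + y)" "1 + (1 - y) / (1 + y) = 2 / (1 + y)"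
    using \<open>-1 < y\<close> by (simp_all add: field_simps)
  ultimately show "tanh (ln ((1 + y) / (1 - y)) / 2) = y"
    using \<open>-1 < y\<close> by simp
qed

text \<open>The hyperbolic counterpart of \<open>rotation\<close> in the indefinite plane of p and
  q. The bound on v says that its projection to this plane is negative; only then is the quotient of
  its two products a value of \<open>tanh\<close>, and the q-component can be removed.\<close>

lemma boost:
  assumes "sprod p p = -1" "sprod q q = 1" "sprod p q = 0" "\<bar>sprod v q\<bar> < \<bar>sprod v p\<bar>"
  obtains g where "g \<in> G" "\<And>X. sprod X p = 0 \<Longrightarrow> sprod X q = 0 \<Longrightarrow> g *v X = X"
    "sprod (g *v v) q = 0"
proof -
  have qp: "sprod q p = 0" using assms(3) by (simp add: sprod_commute)
  define f where "f = (\<lambda>t X. X - sprod X p *\<^sub>R ((cosh t - 1) *\<^sub>R p + sinh t *\<^sub>R q)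
     + sprod X q *\<^sub>R ((cosh t - 1) *\<^sub>R q + sinh t *\<^sub>R p))"
  have lin: "linear (f t)" for t
    by (rule linearI) (auto simp: f_def sprod_simps algebra_simps)
  have iso: "sprod (f t X) (f t Y) = sprod X Y" for t X Y
  proof -
    define a b a' b' c s where abbr: "a = sprod X p" "b = sprod X q" "a' = sprod Y p" "b' = sprod Y q"
      "c = cosh t" "s = sinh t"
    have YX: "sprod p Y = a'" "sprod q Y = b'" by (simp_all add: abbr sprod_commute)
    have s: "s * s = c * c - 1" using cosh_square_eq[of t] by (simp add: abbr power2_eq_square)
    define m n m' n' where mn: "m = b * s - a * (c - 1)" "n = b * (c - 1) - a * s"
       "m' = b' * s - a' * (c - 1)" "n' = b' * (c - 1) - a' * s"
    have "f t X = X + m *\<^sub>R p + n *\<^sub>R q" "f t Y = Y + m' *\<^sub>R p + n' *\<^sub>R q"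
      by (simp_all add: f_def mn abbr algebra_simps)
    then have "sprod (f t X) (f t Y) = sprod X Y + m' * a + n' * b + m * a' + n * b' - m * m' + n * n'"
      by (simp add: sprod_simps assms(1-3) qp YX abbr(1-4)[symmetric] algebra_simps)
    moreover have "m' * a + n' * b + m * a' + n * b' - m * m' + n * n' = 0"
      using s unfolding mn by algebra
    ultimately show ?thesis by simp
  qed
  have inG: "matrix (f t) \<in> G" for t
    by (rule one_parameter_in_G[OF lin iso]) (auto simp: f_def intro!: continuous_intros)
  have mv: "matrix (f t) *v X = f t X" for t X
    by (simp add: matrix_works lin linear_matrix_vector_mul_eq)
  have p0: "sprod v p \<noteq> 0" using assms(4) by auto
  then have "\<bar>sprod v q / sprod v p\<bar> < 1" using assms(4) by simp
  then obtain t where "tanh t = sprod v q / sprod v p" by (rule tanh_surj)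
  then have t: "sprod v p * sinh t = sprod v q * cosh t"
    using p0 cosh_real_nonzero[of t] by (simp add: tanh_def field_simps)
  have "sprod (f t v) q = 0"
    using t by (simp add: f_def sprod_simps assms(1-3) algebra_simps)
  then show thesis
    by (intro that[of "matrix (f t)"]) (simp_all add: inG mv, simp_all add: f_def)
qed


text \<open>An isometry that fixes the orthogonal complement of the plane pointwise keeps vectors of
  the plane orthogonal to that complement, hence in the plane. The vanishing q-component leaves a
  multiple of p.\<close>

lemma plane_image:
  assumes "sprod p p = \<alpha>" "sprod q q = \<beta>" "sprod p q = 0" "\<alpha> = 1 \<or> \<alpha> = -1" "\<beta> = 1 \<or> \<beta> = -1"
    and "g \<in> isometries" "\<And>X. sprod X p = 0 \<Longrightarrow> sprod X q = 0 \<Longrightarrow> g *v X = X"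
    and "sprod (g *v (x *\<^sub>R p + y *\<^sub>R q)) q = 0"
  shows "g *v (x *\<^sub>R p + y *\<^sub>R q) = (\<alpha> * sprod (g *v (x *\<^sub>R p + y *\<^sub>R q)) p) *\<^sub>R p"
proof -
  define w where "w = g *v (x *\<^sub>R p + y *\<^sub>R q)"
  have qp: "sprod q p = 0" using assms(3) by (simp add: sprod_commute)
  have aa: "\<alpha> * \<alpha> = 1" "\<beta> * \<beta> = 1" using assms(4,5) by auto
  have "w - (\<alpha> * sprod w p) *\<^sub>R p = 0"
  proof (rule sprod_nondegenerate)
    fix Y
    define Z where "Z = Y - (\<alpha> * sprod Y p) *\<^sub>R p - (\<beta> * sprod Y q) *\<^sub>R q"
    have a: "\<alpha> * (c * \<alpha>) = c" "\<beta> * (c * \<beta>) = c" for c using assms(4,5) by auto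
    have Z: "sprod Z p = 0" "sprod Z q = 0"
      using a by (simp_all add: Z_def sprod_simps assms(1-3) qp mult.assoc mult.commute)
    have "sprod w Z = sprod (x *\<^sub>R p + y *\<^sub>R q) Z"
      using isometries_sprod[OF assms(6), of "x *\<^sub>R p + y *\<^sub>R q" Z] assms(7)[OF Z] by (simp add: w_def)
    also have "\<dots> = 0" using Z by (simp add: sprod_simps sprod_commute)
    finally have wZ: "sprod w Z = 0" .
    have Y: "Y = Z + (\<alpha> * sprod Y p) *\<^sub>R p + (\<beta> * sprod Y q) *\<^sub>R q" by (simp add: Z_def)
    have "sprod (w - (\<alpha> * sprod w p) *\<^sub>R p) p = 0" "sprod (w - (\<alpha> * sprod w p) *\<^sub>R p) q = 0"
      using assms(8) a by (simp_all add: sprod_simps assms(1-3) w_def mult.assoc mult.commute)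
    moreover have "sprod (w - (\<alpha> * sprod w p) *\<^sub>R p) Z = 0"
      using wZ Z by (simp add: sprod_simps sprod_commute)
    ultimately show "sprod (w - (\<alpha> * sprod w p) *\<^sub>R p) Y = 0"
      by (subst Y) (simp add: sprod.add_right sprod.scaleR_right)
  qed
  then show ?thesis by (simp add: w_def)
qed

text \<open>On the positive definite complement of \<open>P0\<close> and \<open>P1\<close> a nonzero
  z can be normalized; q0 stands in when z is zero. The vector e is one more direction to stay
  orthogonal to; callers without such a direction instantiate it by zero.\<close>

lemma spacelike_direction:
  assumes "sprod z P0 = 0" "sprod z P1 = 0" "sprod z e = 0"
    and "sprod q0 q0 = 1" "sprod q0 P0 = 0" "sprod q0 P1 = 0" "sprod q0 e = 0"
  obtains q n where "sprod q q = 1" "sprod q P0 = 0" "sprod q P1 = 0" "sprod q e = 0" "z = n *\<^sub>R q"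
proof (cases "z = 0")
  case True
  then show ?thesis using that[of q0 0] assms by simp
next
  case False
  define n where "n = sqrt (sprod z z)"
  have "sprod z z > 0" using spacelike[OF assms(1,2)] False by force
  then have n: "n > 0" "n * n = sprod z z" by (simp_all add: n_def)
  have "inverse n * (inverse n * sprod z z) = 1" using n(1) by (simp add: field_simps flip: n(2))
  then show ?thesis
    using that[of "z /\<^sub>R n" n] n(1) assms(1-3) by (simp add: sprod_simps)
qed

text \<open>Completes \<open>P0\<close>, \<open>P1\<close>, \<open>axis 2 1\<close>,
  \<open>axis 3 1\<close> to an orthonormal basis: it is the positive partner of \<open>P0\<close>
  in the hyperbolic plane of the coordinates 0 and 4.\<close>

definition P4 :: "real^5" where
  "P4 = (axis 4 1 - axis 0 1) /\<^sub>R sqrt 2"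

lemma sprod_basis:
  "sprod X (axis 2 1) = X $ 2" "sprod X (axis 3 1) = X $ 3" "sprod X P4 = (X $ 4 - X $ 0) / sqrt 2"
  "sprod (axis 2 1) X = X $ 2" "sprod (axis 3 1) X = X $ 3" "sprod P4 X = (X $ 4 - X $ 0) / sqrt 2"
  by (simp_all add: sprod_def axis_def P4_def field_simps)

lemma basis_components:
  "P0 $ 0 = 1 / sqrt 2" "P0 $ 4 = 1 / sqrt 2" "P0 $ 1 = 0" "P0 $ 2 = 0" "P0 $ 3 = 0"
  "P4 $ 0 = - (1 / sqrt 2)" "P4 $ 4 = 1 / sqrt 2" "P4 $ 1 = 0" "P4 $ 2 = 0" "P4 $ 3 = 0"
  "P1 $ 0 = 0" "P1 $ 4 = 0" "P1 $ 1 = 1" "P1 $ 2 = 0" "P1 $ 3 = 0"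
  by (simp_all add: P0_def P1_def P4_def axis_def field_simps)

lemma sprod_axis3:
  "sprod (axis 3 1) (axis 3 1) = 1" "sprod (axis 3 1) P0 = 0" "sprod (axis 3 1) P1 = 0"
  "sprod (axis 3 1) (axis 2 1) = 0"
  by (simp_all add: sprod_basis basis_components) (simp_all add: axis_def)

lemma basis_expansion:
  "X = ((X $ 0 + X $ 4) / sqrt 2) *\<^sub>R P0 + X $ 1 *\<^sub>R P1 + X $ 2 *\<^sub>R axis 2 1 + X $ 3 *\<^sub>R axis 3 1
     + ((X $ 4 - X $ 0) / sqrt 2) *\<^sub>R P4"
  by (simp add: vec_eq_iff forall_5 basis_components axis_def field_simps)

text \<open>Multiplying an isometry from the left by rotations and boosts in planes, all of them in
  \<^term>\<open>G\<close>, one makes it fix the basis vectors one after the other.\<close>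

context
  fixes V W :: "real^5"
  assumes null: "sprod V V = 0" "sprod W W = 0" "sprod V W = 0" and pos: "biproj V W > 0"
begin

text \<open>The two sign conditions single out the identity component: \<open>det\<close> sees the
  orientation of the whole space, and \<open>biproj\<close> that of the negative part, tested on one
  fixed null plane.\<close>

definition proper :: "real^5^5 \<Rightarrow> bool" where
  "proper A \<longleftrightarrow> A \<in> isometries \<and> det A > 0 \<and> biproj (A *v V) (A *v W) > 0"

lemma proper_left_mult:
  assumes "g \<in> G" "proper A"
  shows "proper (g ** A)"
proof -
  have A: "A \<in> isometries" using assms(2) by (simp add: proper_def)
  have det: "continuous_on UNIV (det :: real^5^5 \<Rightarrow> real)"
    unfolding det_def by (intro continuous_intros)
  have bi: "continuous_on UNIV (\<lambda>A. biproj (A *v V) (A *v W))"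
    unfolding biproj_def sprod_def matrix_vector_mult_def by (simp, intro continuous_intros)
  have "sgn (det (g ** A)) = sgn (det A)"
    by (rule sgn_invariant_left_mult[OF det _ assms(1) A]) (rule isometries_det_nonzero)
  moreover have "sgn (biproj ((g ** A) *v V) ((g ** A) *v W)) = sgn (biproj (A *v V) (A *v W))"
    by (rule sgn_invariant_left_mult[OF bi _ assms(1) A])
      (rule isometries_biproj_nonzero, use null pos in auto)
  ultimately show ?thesis
    using assms(2) isometries_mult[OF _ A, of g] G_subset_isometries assms(1)
    by (auto simp: proper_def sgn_1_pos[symmetric])
qed

lemma proper_cancel_left:
  assumes "g \<in> G" "proper A" "proper (g ** A) \<Longrightarrow> g ** A \<in> G"
  shows "A \<in> G"
  using G_cancel_left[OF assms(1), of A] proper_left_mult[OF assms(1,2)] assms(2,3)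
  by (auto simp: proper_def)

lemma proper_fix4:
  assumes "proper A" "A *v P0 = P0" "A *v P1 = P1" "A *v axis 2 1 = axis 2 1" "A *v axis 3 1 = axis 3 1"
  shows "A \<in> G"
proof -
  have A: "A \<in> isometries" "det A > 0" using assms(1) by (auto simp: proper_def)
  define w where "w = A *v P4"
  have "sprod w P0 = 0" "sprod w P1 = 0" "sprod w (axis 2 1) = 0" "sprod w (axis 3 1) = 0" "sprod w w = 1"
    using isometries_sprod[OF A(1), of P4] assms(2-5)
    by (metis w_def sprod_basis sprod_P basis_components add.left_inverse minus_zero div_0,
        metis w_def sprod_basis sprod_P basis_components minus_zero,
        metis w_def sprod_basis basis_components,
        metis w_def sprod_basis basis_components,
        simp add: w_def sprod_basis basis_components)
  then have w: "w $ 1 = 0" "w $ 2 = 0" "w $ 3 = 0" "w $ 0 = - w $ 4"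
    and "sprod w w = 1"
    by (auto simp: sprod_P sprod_basis)
  then have w5: "2 * (w $ 4 * w $ 4) = 1" by (simp add: sprod_def)
  have "(w $ 4)\<^sup>2 = (1 / sqrt 2)\<^sup>2" using w5 by (simp add: power2_eq_square field_simps)
  then have "w $ 4 = 1 / sqrt 2 \<or> w $ 4 = - (1 / sqrt 2)" by (simp only: power2_eq_iff)
  then have w4: "w = P4 \<or> w = - P4"
    by (elim disjE) (simp_all add: vec_eq_iff forall_5 basis_components w)
  have AX: "A *v X = ((X $ 0 + X $ 4) / sqrt 2) *\<^sub>R P0 + X $ 1 *\<^sub>R P1 + X $ 2 *\<^sub>R axis 2 1 + X $ 3 *\<^sub>R axis 3 1
     + ((X $ 4 - X $ 0) / sqrt 2) *\<^sub>R w" for X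
    by (subst basis_expansion[of X])
      (simp only: matrix_vector_right_distrib matrix_vector_mult_scaleR assms(2-5) w_def)
  \<comment> \<open>Fixing \<open>P0\<close> and negating \<open>P4\<close> interchanges the
    coordinate axes 0 and 4; the other axes being fixed, A would be an odd permutation of the basis,
    of determinant -1.\<close>
  have "w \<noteq> - P4"
  proof
    assume w': "w = - P4"
    have "A *v X = (\<chi> i. X $ Transposition.transpose 0 4 i)" for X
      by (simp add: AX w' vec_eq_iff forall_5 basis_components axis_def field_simps Transposition.transpose_def)
    moreover have "(\<chi> i. mat 1 $ Transposition.transpose 0 4 i) *v X = (\<chi> i. X $ Transposition.transpose 0 4 i)"
      for X :: "real^5"
      by (simp add: vec_eq_iff forall_5 matrix_vector_mult_def sum_5 mat_def Transposition.transpose_def)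
    ultimately have "A = (\<chi> i. mat 1 $ Transposition.transpose 0 4 i)"
      by (simp add: matrix_eq)
    then have "det A = of_int (sign (Transposition.transpose (0::5) 4)) * det (mat 1 :: real^5^5)"
      by (simp only: det_permute_rows permutes_swap_id UNIV_I)
    then show False using A(2) by (simp add: sign_swap_id)
  qed
  then have "A *v X = mat 1 *v X" for X
    using w4 AX[of X] basis_expansion[of X] by simp
  then show ?thesis using mat_1_in_G by (metis matrix_eq)
qed

lemma proper_fix3:
  assumes "proper A" "A *v P0 = P0" "A *v P1 = P1" "A *v axis 2 1 = axis 2 1"
  shows "A \<in> G"
proof -
  \<comment> \<open>A maps \<open>axis 3 1\<close> into the complement of its three fixed vectors,
    the definite plane of \<open>axis 3 1\<close> and \<open>P4\<close>. After the rotation the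
    image is a unit vector with no \<open>P4\<close> component and a nonnegative first one, that is
    \<open>axis 3 1\<close>.\<close>
  obtain g where g: "g \<in> G" "\<And>X. sprod X (axis 3 1) = 0 \<Longrightarrow> sprod X P4 = 0 \<Longrightarrow> g *v X = X"
    "sprod (g *v (A *v axis 3 1)) P4 = 0" "1 * sprod (g *v (A *v axis 3 1)) (axis 3 1) \<ge> 0"
    by (rule rotation[of "axis 3 1" 1 P4 "A *v axis 3 1"])
      (simp_all add: sprod_axis3 sprod_basis basis_components, simp_all add: axis_def)
  define B where "B = g ** A"
  have B: "B \<in> isometries" "B *v P0 = P0" "B *v P1 = P1" "B *v axis 2 1 = axis 2 1"
  proof -
    show "B \<in> isometries"
      using assms(1) g(1) isometries_mult[of g A] G_subset_isometries by (auto simp: B_def proper_def)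
    have "g *v P0 = P0" "g *v P1 = P1" "g *v axis 2 1 = axis 2 1"
      by (rule g(2); simp add: sprod_basis basis_components; simp add: axis_def)+
    then show "B *v P0 = P0" "B *v P1 = P1" "B *v axis 2 1 = axis 2 1"
      using assms(2-4) by (simp_all add: B_def matrix_vector_mul_assoc[symmetric])
  qed
  define w where "w = B *v axis 3 1"
  have "sprod w P0 = sprod (axis 3 1) P0" "sprod w P1 = sprod (axis 3 1) P1"
    "sprod w (axis 2 1) = sprod (axis 3 1) (axis 2 1)" "sprod w w = 1" "sprod w P4 = 0" "sprod w (axis 3 1) \<ge> 0"
    using isometries_sprod[OF B(1), of "axis 3 1"] B(2-) g(3,4)
    by (metis w_def, metis w_def, metis w_def, simp add: w_def sprod_basis,
        simp_all add: w_def B_def matrix_vector_mul_assoc)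
  then have w: "w $ 0 + w $ 4 = 0" "w $ 4 - w $ 0 = 0" "w $ 1 = 0" "w $ 2 = 0" "w $ 3 \<ge> 0" "sprod w w = 1"
    by (simp_all add: sprod_P sprod_basis, simp_all add: axis_def)
  then have w04: "w $ 0 = 0" "w $ 4 = 0" by auto
  with w have "w $ 3 * w $ 3 = 1" by (simp add: sprod_def)
  with w(5) have "w $ 3 = 1" by (simp add: square_eq_1_iff)
  then have "w = axis 3 1"
    using w w04 by (simp add: vec_eq_iff forall_5 axis_def)
  then have "B *v axis 3 1 = axis 3 1" by (simp add: w_def)
  then show ?thesis
    using proper_cancel_left[OF g(1) assms(1)] proper_fix4 B by (simp add: B_def)
qed

lemma proper_fix2:
  assumes "proper A" "A *v P0 = P0" "A *v P1 = P1"
  shows "A \<in> G"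
proof -
  have A: "A \<in> isometries" using assms(1) by (auto simp: proper_def)
  let ?e = "axis 2 1 :: real^5"
  have ee: "sprod ?e ?e = 1" "sprod ?e P0 = 0" "sprod ?e P1 = 0"
    by (simp_all add: sprod_basis basis_components)
  define v where "v = A *v ?e"
  have v: "sprod v v = 1" "sprod v P0 = 0" "sprod v P1 = 0"
    using isometries_sprod[OF A, of ?e] assms(2,3) ee by (metis v_def)+
  \<comment> \<open>The part of v orthogonal to \<open>?e\<close>. Like v and \<open>?e\<close> it
    is orthogonal to \<open>P0\<close> and \<open>P1\<close>, so a rotation in the plane of
    \<open>?e\<close> and z keeps these two fixed.\<close>
  define z where "z = v - sprod v ?e *\<^sub>R ?e"
  have "sprod z P0 = 0" "sprod z P1 = 0" "sprod z ?e = 0"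
    using v ee by (simp_all add: z_def sprod_simps)
  then obtain q n where q: "sprod q q = 1" "sprod q P0 = 0" "sprod q P1 = 0" "sprod q ?e = 0" "z = n *\<^sub>R q"
    by (rule spacelike_direction[OF _ _ _ sprod_axis3])
  have vq: "v = sprod v ?e *\<^sub>R ?e + n *\<^sub>R q" using q(5) by (simp add: z_def algebra_simps)
  have eq: "sprod ?e q = 0" using q(4) by (simp add: sprod_commute)
  obtain g where g: "g \<in> G" "\<And>X. sprod X ?e = 0 \<Longrightarrow> sprod X q = 0 \<Longrightarrow> g *v X = X"
    "sprod (g *v v) q = 0" "1 * sprod (g *v v) ?e \<ge> 0"
    by (rule rotation[of ?e 1 q v]) (use ee q eq in auto)
  have gi: "g \<in> isometries" using g(1) G_subset_isometries by blast
  have "g *v v = (1 * sprod (g *v v) ?e) *\<^sub>R ?e"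
    using plane_image[of ?e 1 q 1 g "sprod v ?e" n] ee q(1) eq gi g(2,3) vq by auto
  then obtain l where l: "g *v v = l *\<^sub>R ?e" "l \<ge> 0" using g(4) by blast
  have "l * l = 1" using isometries_sprod[OF gi, of v v] v(1) ee by (simp add: l sprod_simps)
  then have "l = 1" using l(2) by (simp add: square_eq_1_iff)
  moreover have "g *v P0 = P0" "g *v P1 = P1"
    by (rule g(2); use ee q in \<open>simp add: sprod_commute\<close>)+
  ultimately show ?thesis
    using proper_cancel_left[OF g(1) assms(1)] proper_fix3[of "g ** A"] assms(2,3) l
    by (simp add: matrix_vector_mul_assoc[symmetric] v_def)
qed

text \<open>The image v of \<open>P1\<close> is negative, so its component n along the positive
  direction q satisfies n^2 < (sprod v P1)^2 and a boost can remove it. A boost cannot correct a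
  sign, and \<open>P1\<close> may end up at \<open>- P1\<close>; with \<open>P0\<close> fixed this
  would reverse \<open>biproj\<close> on the plane of V and W, which \<open>proper\<close>
  forbids.\<close>

lemma proper_fix1:
  assumes "proper A" "A *v P0 = P0"
  shows "A \<in> G"
proof -
  have A: "A \<in> isometries" using assms(1) by (auto simp: proper_def)
  define v where "v = A *v P1"
  have v: "sprod v v = -1" "sprod v P0 = 0"
    using isometries_sprod[OF A, of P1] assms(2) sprod_P(2,4) by (metis v_def)+
  define z where "z = v + sprod v P1 *\<^sub>R P1"
  have "sprod z P0 = 0" "sprod z P1 = 0"
    using v by (simp_all add: z_def sprod_simps sprod_P(1-4))
  then obtain q n where q: "sprod q q = 1" "sprod q P0 = 0" "sprod q P1 = 0" "z = n *\<^sub>R q"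
    by (rule spacelike_direction[OF _ _ sprod.zero_right sprod_axis3(1-3) sprod.zero_right])
  have vq: "v = (- sprod v P1) *\<^sub>R P1 + n *\<^sub>R q" using q(4) by (simp add: z_def algebra_simps)
  have Pq: "sprod P1 q = 0" "sprod P0 q = 0" using q(2,3) by (simp_all add: sprod_commute)
  have vn: "sprod v q = n" by (subst vq) (simp add: sprod_simps q Pq)
  have "sprod v v = - (sprod v P1)\<^sup>2 + n\<^sup>2"
    by (subst (1) vq) (simp add: sprod_simps vn power2_eq_square sprod_commute[of P1] sprod_commute[of q])
  then have "(sprod v q)\<^sup>2 < (sprod v P1)\<^sup>2" using v(1) vn by simp
  then have "\<bar>sprod v q\<bar> < \<bar>sprod v P1\<bar>"
    using abs_le_square_iff[of "sprod v P1" "sprod v q"] by simp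
  then obtain g where g: "g \<in> G" "\<And>X. sprod X P1 = 0 \<Longrightarrow> sprod X q = 0 \<Longrightarrow> g *v X = X"
    "sprod (g *v v) q = 0"
    by (rule boost[rotated 3]) (use q Pq sprod_P in auto)
  have gi: "g \<in> isometries" using g(1) G_subset_isometries by blast
  have "g *v v = (-1 * sprod (g *v v) P1) *\<^sub>R P1"
    using plane_image[of P1 "-1" q 1 g "- sprod v P1" n] sprod_P(2) q(1) Pq gi g(2,3) vq by auto
  then obtain l where l: "g *v v = l *\<^sub>R P1" by blast
  have "l * l = 1" using isometries_sprod[OF gi, of v v] v(1) sprod_P(2) by (simp add: l sprod.scaleR_left sprod.scaleR_right)
  then have l1: "l = 1 \<or> l = -1" by (simp add: square_eq_1_iff)
  have g0: "g *v P0 = P0" by (rule g(2); use Pq sprod_P in simp)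
  define B where "B = g ** A"
  have B: "proper B" "B *v P0 = P0" "B *v P1 = l *\<^sub>R P1"
    using proper_left_mult[OF g(1) assms(1)] g0 assms(2) l
    by (simp_all add: B_def matrix_vector_mul_assoc[symmetric] v_def)
  have "l \<noteq> -1"
  proof
    assume "l = -1"
    then have *: "sprod P0 (B *v X) = sprod P0 X" "sprod P1 (B *v X) = - sprod P1 X" for X
      using isometries_sprod[of B P0 X] isometries_sprod[of B P1 X] B
      by (simp_all add: proper_def sprod.minus_left)
    have "biproj (B *v V) (B *v W) = - biproj V W" unfolding biproj_def * by simp
    then show False using B(1) pos by (simp add: proper_def)
  qed
  then show ?thesis
    using proper_cancel_left[OF g(1) assms(1)] proper_fix2[of B] B l1 by (simp add: B_def)
qed

lemma proper_in_G:
  assumes "proper A"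
  shows "A \<in> G"
proof -
  \<comment> \<open>Once the image of \<open>P0\<close> is orthogonal to \<open>P1\<close>, its part
    outside \<open>P0\<close> lies in the definite complement of both, as the boost below
    demands.\<close>
  obtain g where g: "g \<in> G" "sprod (g *v (A *v P0)) P1 = 0"
    by (rule rotation[of P0 "-1" P1 "A *v P0"]) (use sprod_P(1-4) in auto)
  define B where "B = g ** A"
  have B: "proper B" using proper_left_mult[OF g(1) assms] by (simp add: B_def)
  then have Bi: "B \<in> isometries" by (simp add: proper_def)
  define v where "v = B *v P0"
  have v: "sprod v v = -1" "sprod v P1 = 0"
    using isometries_sprod[OF Bi, of P0 P0] g(2) sprod_P(1)
    by (simp_all add: v_def B_def matrix_vector_mul_assoc)
  define z where "z = v + sprod v P0 *\<^sub>R P0"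
  have "sprod z P0 = 0" "sprod z P1 = 0"
    using v by (simp_all add: z_def sprod_simps sprod_P(1-4))
  then obtain q n where q: "sprod q q = 1" "sprod q P0 = 0" "sprod q P1 = 0" "z = n *\<^sub>R q"
    by (rule spacelike_direction[OF _ _ sprod.zero_right sprod_axis3(1-3) sprod.zero_right])
  have vq: "v = (- sprod v P0) *\<^sub>R P0 + n *\<^sub>R q" using q(4) by (simp add: z_def algebra_simps)
  have Pq: "sprod P1 q = 0" "sprod P0 q = 0" using q(2,3) by (simp_all add: sprod_commute)
  have vn: "sprod v q = n" by (subst vq) (simp add: sprod_simps q Pq)
  have "sprod v v = - (sprod v P0)\<^sup>2 + n\<^sup>2"
    by (subst (1) vq) (simp add: sprod_simps vn power2_eq_square sprod_commute[of P0] sprod_commute[of q])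
  then have "(sprod v q)\<^sup>2 < (sprod v P0)\<^sup>2" using v(1) vn by simp
  then have "\<bar>sprod v q\<bar> < \<bar>sprod v P0\<bar>"
    using abs_le_square_iff[of "sprod v P0" "sprod v q"] by simp
  then obtain h where h: "h \<in> G" "\<And>X. sprod X P0 = 0 \<Longrightarrow> sprod X q = 0 \<Longrightarrow> h *v X = X"
    "sprod (h *v v) q = 0"
    by (rule boost[rotated 3]) (use q Pq sprod_P in auto)
  have hi: "h \<in> isometries" using h(1) G_subset_isometries by blast
  have "h *v v = (-1 * sprod (h *v v) P0) *\<^sub>R P0"
    using plane_image[of P0 "-1" q 1 h "- sprod v P0" n] sprod_P(1) q(1) Pq hi h(2,3) vq by auto
  then obtain l where l: "h *v v = l *\<^sub>R P0" by blast
  \<comment> \<open>The boost may have led to \<open>- P0\<close>. Turning the plane of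
    \<open>P0\<close> and \<open>P1\<close> repairs this sign; the effect on \<open>P1\<close> is
    left to \<open>proper_fix1\<close>.\<close>
  obtain k where k: "k \<in> G" "\<And>X. sprod X P0 = 0 \<Longrightarrow> sprod X P1 = 0 \<Longrightarrow> k *v X = X"
    "sprod (k *v (l *\<^sub>R P0)) P1 = 0" "-1 * sprod (k *v (l *\<^sub>R P0)) P0 \<ge> 0"
    by (rule rotation[of P0 "-1" P1 "l *\<^sub>R P0"]) (use sprod_P(1-4) in auto)
  have ki: "k \<in> isometries" using k(1) G_subset_isometries by blast
  have "k *v (l *\<^sub>R P0) = (-1 * sprod (k *v (l *\<^sub>R P0)) P0) *\<^sub>R P0"
    using plane_image[of P0 "-1" P1 "-1" k l 0] sprod_P(1-4) ki k(2,3) by auto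
  then obtain m where m: "k *v (l *\<^sub>R P0) = m *\<^sub>R P0" "m \<ge> 0" using k(4) by blast
  have "sprod (m *\<^sub>R P0) (m *\<^sub>R P0) = sprod v v"
    using isometries_sprod[OF ki, of "l *\<^sub>R P0" "l *\<^sub>R P0"] isometries_sprod[OF hi, of v v] m l by simp
  then have "m * m = 1" using v(1) sprod_P(1) by (simp add: sprod.scaleR_left sprod.scaleR_right)
  then have "m = 1" using m(2) by (simp add: square_eq_1_iff)
  then have "(k ** (h ** B)) *v P0 = P0"
    using m l by (simp add: matrix_vector_mul_assoc[symmetric] v_def)
  then have "k ** (h ** B) \<in> G"
    using proper_fix1 proper_left_mult[OF k(1) proper_left_mult[OF h(1) B]] by blast
  then have "h ** B \<in> G" using proper_cancel_left[OF k(1) proper_left_mult[OF h(1) B]] by blast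
  then have "B \<in> G" using proper_cancel_left[OF h(1) B] by blast
  then show ?thesis using proper_cancel_left[OF g(1) assms] by (simp add: B_def)
qed

end

lemma isometry_in_G:
  assumes "A \<in> isometries" "det A > 0"
    and "sprod V V = 0" "sprod W W = 0" "sprod V W = 0" "biproj V W > 0" "biproj (A *v V) (A *v W) > 0"
  shows "A \<in> G"
  using proper_in_G[OF assms(3-6)] proper_def[OF assms(3-6)] assms by blast

section \<open>Null frames and two-jets of rays\<close>

text \<open>The Gram matrix of (\<gamma>, \<gamma>', \<gamma>'', r, r') for a normalized normal
  field r: a unit vector and two hyperbolic pairs (T, q) and (U, r). The value -1 of
  \<open>sprod T q\<close> comes from differentiating \<open>sprod T r\<close> = 0 with
  \<open>sprod U r\<close> = 1.\<close>

definition null_frame :: "real^5 \<Rightarrow> real^5 \<Rightarrow> real^5 \<Rightarrow> real^5 \<Rightarrow> real^5 \<Rightarrow> bool" where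
  "null_frame \<gamma> T U r q \<longleftrightarrow>
     sprod \<gamma> \<gamma> = 1 \<and> sprod T T = 0 \<and> sprod U U = 0 \<and> sprod r r = 0 \<and> sprod q q = 0 \<and>
     sprod \<gamma> T = 0 \<and> sprod \<gamma> U = 0 \<and> sprod \<gamma> r = 0 \<and> sprod \<gamma> q = 0 \<and>
     sprod T U = 0 \<and> sprod T r = 0 \<and> sprod U q = 0 \<and> sprod r q = 0 \<and>
     sprod T q = -1 \<and> sprod U r = 1"

lemma null_frameD:
  assumes "null_frame \<gamma> T U r q"
  shows "sprod \<gamma> \<gamma> = 1" "sprod T T = 0" "sprod U U = 0" "sprod r r = 0" "sprod q q = 0"
    "sprod \<gamma> T = 0" "sprod \<gamma> U = 0" "sprod \<gamma> r = 0" "sprod \<gamma> q = 0"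
    "sprod T U = 0" "sprod T r = 0" "sprod U q = 0" "sprod r q = 0" "sprod T q = -1" "sprod U r = 1"
    "sprod T \<gamma> = 0" "sprod U \<gamma> = 0" "sprod r \<gamma> = 0" "sprod q \<gamma> = 0"
    "sprod U T = 0" "sprod r T = 0" "sprod q U = 0" "sprod q r = 0" "sprod q T = -1" "sprod r U = 1"
  using assms unfolding null_frame_def by (simp_all add: sprod_commute)

definition frame_matrix :: "real^5 \<Rightarrow> real^5 \<Rightarrow> real^5 \<Rightarrow> real^5 \<Rightarrow> real^5 \<Rightarrow> real^5^5" where
  "frame_matrix \<gamma> T U r q =
     (\<chi> i. if i = 0 then \<gamma> else if i = 1 then T else if i = 2 then U else if i = 3 then r else q)"

lemma frame_matrix_nth:
  "frame_matrix \<gamma> T U r q $ 0 = \<gamma>" "frame_matrix \<gamma> T U r q $ 1 = T" "frame_matrix \<gamma> T U r q $ 2 = U"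
  "frame_matrix \<gamma> T U r q $ 3 = r" "frame_matrix \<gamma> T U r q $ 4 = q"
  by (simp_all add: frame_matrix_def)

text \<open>The dual basis of a null frame with respect to \<^term>\<open>sprod\<close> is \<open>(\<gamma>, - q, r, U, - T)\<close>.\<close>

lemma null_frame_dual:
  assumes "null_frame \<gamma> T U r q"
  defines "D \<equiv> \<chi> i j. sprod (frame_matrix \<gamma> (- q) r U (- T) $ i) (axis j 1)"
  shows "D ** transpose (frame_matrix \<gamma> T U r q) = mat 1"
proof -
  have *: "(\<Sum>j\<in>UNIV. sprod V (axis j 1) * W $ j) = sprod V W" for V W
    by (simp add: sum_5 sprod_def axis_def)
  have "(D ** transpose (frame_matrix \<gamma> T U r q)) $ i $ k =
      sprod (frame_matrix \<gamma> (- q) r U (- T) $ i) (frame_matrix \<gamma> T U r q $ k)" for i k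
    by (simp add: D_def matrix_matrix_mult_def transpose_def *)
  then show ?thesis
    unfolding vec_eq_iff forall_5
    by (simp add: frame_matrix_nth null_frameD[OF assms(1)] sprod.minus_left mat_def)
qed

lemma det_null_frame_nonzero:
  assumes "null_frame \<gamma> T U r q"
  shows "det (frame_matrix \<gamma> T U r q) \<noteq> 0"
proof
  assume "det (frame_matrix \<gamma> T U r q) = 0"
  then have "det (mat 1 :: real^5^5) = 0"
    unfolding null_frame_dual[OF assms, symmetric] by (simp add: det_mul)
  then show False by simp
qed

lemma null_frame_expansion:
  assumes "null_frame \<gamma> T U r q"
  shows "X = sprod X \<gamma> *\<^sub>R \<gamma> + sprod X U *\<^sub>R r + sprod X r *\<^sub>R U - sprod X q *\<^sub>R T - sprod X T *\<^sub>R q"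
proof -
  define D where "D = (\<chi> i j. sprod (frame_matrix \<gamma> (- q) r U (- T) $ i) (axis j 1))"
  have *: "(\<Sum>j\<in>UNIV. sprod V (axis j 1) * W $ j) = sprod V W" for V W
    by (simp add: sum_5 sprod_def axis_def)
  have D: "(D *v X) $ i = sprod X (frame_matrix \<gamma> (- q) r U (- T) $ i)" for i
    by (simp add: D_def matrix_vector_mult_def *) (rule sprod_commute)
  have "transpose (frame_matrix \<gamma> T U r q) ** D = mat 1"
    using null_frame_dual[OF assms] unfolding D_def by (simp add: matrix_left_right_inverse)
  then have "X = transpose (frame_matrix \<gamma> T U r q) *v (D *v X)"
    by (simp add: matrix_vector_mul_assoc)
  also have "\<dots> = (\<Sum>i\<in>UNIV. (D *v X) $ i *\<^sub>R frame_matrix \<gamma> T U r q $ i)"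
    by (simp add: vec_eq_iff matrix_vector_mult_def transpose_def mult.commute)
  also have "\<dots> = sprod X \<gamma> *\<^sub>R \<gamma> + sprod X U *\<^sub>R r + sprod X r *\<^sub>R U - sprod X q *\<^sub>R T - sprod X T *\<^sub>R q"
    by (simp add: sum_5 D frame_matrix_nth sprod.minus_right)
  finally show ?thesis .
qed

section \<open>The isometry between two null frames\<close>

definition outer :: "real^5 \<Rightarrow> real^5 \<Rightarrow> real^5^5" where
  "outer v w = (\<chi> i j. v $ i * sprod (axis j 1) w)"

lemma outer_apply: "outer v w *v X = sprod X w *\<^sub>R v"
proof -
  have "(\<Sum>j\<in>UNIV. sprod (axis j 1) w * X $ j) = sprod X w"
    by (simp add: sum_5 sprod_def axis_def)
  then show ?thesis
    by (simp add: outer_def vec_eq_iff matrix_vector_mult_def mult.assoc sum_distrib_left[symmetric])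
qed

lemma bounded_bilinear_outer: "bounded_bilinear outer"
proof -
  have "bilinear outer"
    unfolding bilinear_def
    by (auto intro!: linearI simp: outer_def vec_eq_iff sprod_simps algebra_simps)
  then show ?thesis by (simp add: bilinear_conv_bounded_bilinear)
qed

text \<open>Each vector of the first frame is paired with the dual vector of its counterpart in the
  second. In this form the map is a sum of terms bilinear in the two frames, so it is smooth along
  curves.\<close>

definition frame_map ::
  "real^5 \<Rightarrow> real^5 \<Rightarrow> real^5 \<Rightarrow> real^5 \<Rightarrow> real^5 \<Rightarrow> real^5 \<Rightarrow> real^5 \<Rightarrow> real^5 \<Rightarrow> real^5 \<Rightarrow> real^5 \<Rightarrow> real^5^5" where
  "frame_map \<gamma> T U r q \<gamma>' T' U' r' q' =
     outer \<gamma> \<gamma>' + outer r U' + outer U r' - outer T q' - outer q T'"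

lemma frame_map_apply:
  "frame_map \<gamma> T U r q \<gamma>' T' U' r' q' *v X =
     sprod X \<gamma>' *\<^sub>R \<gamma> + sprod X U' *\<^sub>R r + sprod X r' *\<^sub>R U - sprod X q' *\<^sub>R T - sprod X T' *\<^sub>R q"
  by (simp add: frame_map_def matrix_vector_mult_add_rdistrib matrix_vector_mult_diff_rdistrib outer_apply)

lemma frame_map_frame:
  fixes \<gamma> T U r q
  assumes "null_frame \<gamma>' T' U' r' q'"
  defines "F \<equiv> frame_map \<gamma> T U r q \<gamma>' T' U' r' q'"
  shows "F *v \<gamma>' = \<gamma>" "F *v T' = T" "F *v U' = U" "F *v r' = r" "F *v q' = q"
  by (simp_all add: F_def frame_map_apply null_frameD[OF assms(1)])

lemma frame_map_isometry:
  assumes "null_frame \<gamma> T U r q" "null_frame \<gamma>' T' U' r' q'"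
  shows "frame_map \<gamma> T U r q \<gamma>' T' U' r' q' \<in> isometries"
proof -
  have "sprod (frame_map \<gamma> T U r q \<gamma>' T' U' r' q' *v X) (frame_map \<gamma> T U r q \<gamma>' T' U' r' q' *v Y) = sprod X Y" for X Y
  proof -
    have "sprod (frame_map \<gamma> T U r q \<gamma>' T' U' r' q' *v X) (frame_map \<gamma> T U r q \<gamma>' T' U' r' q' *v Y) =
      sprod X \<gamma>' * sprod Y \<gamma>' + sprod X U' * sprod Y r' + sprod X r' * sprod Y U'
        - sprod X q' * sprod Y T' - sprod X T' * sprod Y q'"
      unfolding frame_map_apply by (simp add: sprod_simps null_frameD[OF assms(1)])
    also have "\<dots> = sprod X Y"
      using arg_cong[OF null_frame_expansion[OF assms(2), of X], of "\<lambda>Z. sprod Z Y"]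
      by (simp add: sprod_simps sprod_commute[of _ Y])
    finally show ?thesis .
  qed
  then show ?thesis by (simp add: isometries_def)
qed

text \<open>The determinant of the map is the quotient of the two frame determinants, and it carries
  the null plane of T', U' to that of T, U, so both signs required by \<open>isometry_in_G\<close>
  can be read off the frames.\<close>

lemma frame_map_in_G:
  assumes "null_frame \<gamma> T U r q" "null_frame \<gamma>' T' U' r' q'"
    and "sgn (det (frame_matrix \<gamma> T U r q)) = sgn (det (frame_matrix \<gamma>' T' U' r' q'))"
    and "biproj T U > 0" "biproj T' U' > 0"
  shows "frame_map \<gamma> T U r q \<gamma>' T' U' r' q' \<in> G"
proof -
  define F where "F = frame_map \<gamma> T U r q \<gamma>' T' U' r' q'"
  note F = frame_map_frame[OF assms(2), of \<gamma> T U r q, folded F_def]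
  have "(frame_matrix \<gamma>' T' U' r' q' ** transpose F) $ i = F *v (frame_matrix \<gamma>' T' U' r' q' $ i)" for i
    by (simp add: vec_eq_iff matrix_matrix_mult_def matrix_vector_mult_def transpose_def mult.commute)
  then have "frame_matrix \<gamma>' T' U' r' q' ** transpose F = frame_matrix \<gamma> T U r q"
    unfolding vec_eq_iff[of "_ ** _"] forall_5 by (simp add: F frame_matrix_nth)
  then have "det (frame_matrix \<gamma> T U r q) = det (frame_matrix \<gamma>' T' U' r' q') * det F"
    by (metis det_mul det_transpose)
  then have "sgn (det (frame_matrix \<gamma>' T' U' r' q')) * sgn (det F) = sgn (det (frame_matrix \<gamma>' T' U' r' q'))"
    using assms(3) by (simp add: sgn_mult)
  then have "sgn (det F) = 1"
    using det_null_frame_nonzero[OF assms(2)] by (simp add: sgn_zero_iff)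
  then show ?thesis
    using isometry_in_G[of F T' U'] frame_map_isometry[OF assms(1,2)] assms(4,5) null_frameD[OF assms(2)] F
    by (simp add: F_def[symmetric] sgn_1_pos)
qed

section \<open>Two-jets of normalized curves\<close>

lemma jet2_cong:
  assumes "open S" "0 \<in> S" "\<And>t. t \<in> S \<Longrightarrow> f t = g t"
  shows "jet2 f = jet2 g"
proof -
  have vd: "vector_derivative h (at t) = vector_derivative k (at t)"
    if "t \<in> S" "\<And>t. t \<in> S \<Longrightarrow> h t = k t" for t and h k :: "real \<Rightarrow> 'a"
  proof -
    have "(h has_vector_derivative D) (at t) \<longleftrightarrow> (k has_vector_derivative D) (at t)" for D
      using that has_vector_derivative_transform_within_open[OF _ assms(1) that(1)] by metis
    then show ?thesis by (simp add: vector_derivative_def)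
  qed
  have 1: "vector_derivative f (at t) = vector_derivative g (at t)" if "t \<in> S" for t
    by (rule vd[OF that assms(3)])
  show ?thesis
    unfolding jet2_def using assms(3)[OF assms(2)] 1[OF assms(2)] vd[OF assms(2) 1] by simp
qed

lemma jet2_eqI:
  assumes "open S" "0 \<in> S" "\<And>t. t \<in> S \<Longrightarrow> (f has_vector_derivative f1 t) (at t)"
    and "(f1 has_vector_derivative f2) (at 0)"
  shows "jet2 f = (f 0, f1 0, f2)"
proof -
  have 1: "vector_derivative f (at t) = f1 t" if "t \<in> S" for t
    by (rule vector_derivative_at[OF assms(3)[OF that]])
  have "((\<lambda>t. vector_derivative f (at t)) has_vector_derivative f2) (at 0)"
    by (rule has_vector_derivative_transform_within_open[OF assms(4,1,2)]) (simp add: 1)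
  then show ?thesis
    by (simp add: jet2_def 1 assms(2) vector_derivative_at)
qed

text \<open>The product rule, applied twice to n A where n is the inverse norm of A and n' = - (A
  \<bullet> A') n^3. The explicit formula serves to compare two curves with slightly different
  accelerations.\<close>

lemma jet2_sgn:
  fixes A A1 :: "real \<Rightarrow> 'a::real_inner"
  assumes "open S" "0 \<in> S" "\<And>t. t \<in> S \<Longrightarrow> A t \<noteq> 0"
    and "\<And>t. t \<in> S \<Longrightarrow> (A has_vector_derivative A1 t) (at t)" "(A1 has_vector_derivative c) (at 0)"
  defines "N \<equiv> inverse (norm (A 0))"
  shows "jet2 (\<lambda>t. sgn (A t)) = (sgn (A 0), N *\<^sub>R A1 0 - ((A 0 \<bullet> A1 0) * N ^ 3) *\<^sub>R A 0,
     N *\<^sub>R c - (2 * (A 0 \<bullet> A1 0) * N ^ 3) *\<^sub>R A1 0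
       - ((A1 0 \<bullet> A1 0 + A 0 \<bullet> c) * N ^ 3 - 3 * (A 0 \<bullet> A1 0)\<^sup>2 * N ^ 5) *\<^sub>R A 0)"
proof -
  define n where "n = (\<lambda>t. inverse (norm (A t)))"
  have n: "(n has_real_derivative (- ((A t \<bullet> A1 t) * n t ^ 3))) (at t)" if t: "t \<in> S" for t
  proof -
    have "(norm has_derivative (\<lambda>v. sgn (A t) \<bullet> v)) (at (A t))"
      using has_derivative_norm[OF assms(3)[OF t]] by (simp add: inner_commute)
    then have "((\<lambda>t. norm (A t)) has_derivative (\<lambda>h. sgn (A t) \<bullet> (h *\<^sub>R A1 t))) (at t)"
      by (rule has_derivative_compose[OF assms(4)[OF t, unfolded has_vector_derivative_def]])
    then have "((\<lambda>t. norm (A t)) has_real_derivative (sgn (A t) \<bullet> A1 t)) (at t)"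
      by (simp add: has_field_derivative_def mult.commute[of _ "sgn _ \<bullet> _"] mult_commute_abs)
    from DERIV_inverse'[OF this] assms(3)[OF t] show ?thesis
      unfolding n_def by (simp add: sgn_div_norm power3_eq_cube algebra_simps)
  qed
  have in1: "((\<lambda>t. A t \<bullet> A1 t) has_real_derivative (A 0 \<bullet> c + A1 0 \<bullet> A1 0)) (at 0)"
    using bounded_bilinear.has_vector_derivative[OF bounded_bilinear_inner assms(4)[OF assms(2)] assms(5)]
    by (simp add: has_real_derivative_iff_has_vector_derivative)
  define f1 where "f1 = (\<lambda>t. n t *\<^sub>R A1 t - ((A t \<bullet> A1 t) * n t ^ 3) *\<^sub>R A t)"
  have "jet2 (\<lambda>t. n t *\<^sub>R A t) = (n 0 *\<^sub>R A 0, f1 0, N *\<^sub>R c - (2 * (A 0 \<bullet> A1 0) * N ^ 3) *\<^sub>R A1 0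
       - ((A1 0 \<bullet> A1 0 + A 0 \<bullet> c) * N ^ 3 - 3 * (A 0 \<bullet> A1 0)\<^sup>2 * N ^ 5) *\<^sub>R A 0)"
  proof (rule jet2_eqI[OF assms(1,2)])
    show "((\<lambda>t. n t *\<^sub>R A t) has_vector_derivative f1 t) (at t)" if "t \<in> S" for t
      using has_vector_derivative_scaleR[OF n[OF that] assms(4)[OF that]] by (simp add: f1_def)
    have "((\<lambda>t. (A t \<bullet> A1 t) * n t ^ 3) has_real_derivative
        ((A1 0 \<bullet> A1 0 + A 0 \<bullet> c) * N ^ 3 - 3 * (A 0 \<bullet> A1 0)\<^sup>2 * N ^ 5)) (at 0)"
      by (rule derivative_eq_intros in1 n[OF assms(2)] refl)+
        (simp add: N_def[symmetric] n_def[THEN fun_cong] power2_eq_square eval_nat_numeral algebra_simps)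
    then have "((\<lambda>t. ((A t \<bullet> A1 t) * n t ^ 3) *\<^sub>R A t) has_vector_derivative
       ((A 0 \<bullet> A1 0) * N ^ 3) *\<^sub>R A1 0 + ((A1 0 \<bullet> A1 0 + A 0 \<bullet> c) * N ^ 3 - 3 * (A 0 \<bullet> A1 0)\<^sup>2 * N ^ 5) *\<^sub>R A 0) (at 0)"
      using has_vector_derivative_scaleR[OF _ assms(4)[OF assms(2)]] by (simp add: N_def n_def)
    from has_vector_derivative_diff[OF has_vector_derivative_scaleR[OF n[OF assms(2)] assms(5)] this]
    show "(f1 has_vector_derivative (N *\<^sub>R c - (2 * (A 0 \<bullet> A1 0) * N ^ 3) *\<^sub>R A1 0
       - ((A1 0 \<bullet> A1 0 + A 0 \<bullet> c) * N ^ 3 - 3 * (A 0 \<bullet> A1 0)\<^sup>2 * N ^ 5) *\<^sub>R A 0)) (at 0)"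
      unfolding f1_def
      by (rule has_vector_derivative_eq_rhs) (simp add: N_def n_def algebra_simps, simp flip: scaleR_add_left)
  qed
  then show ?thesis by (simp add: f1_def n_def N_def sgn_div_norm)
qed

text \<open>Normalization does not see a radial change of the second derivative: k B contributes k N
  B through the linear term and - k |B|^2 N^3 B through the inner product, and these cancel because
  N is the inverse of |B|.\<close>

lemma jet2_sgn_eqI:
  fixes A A1 B B1 :: "real \<Rightarrow> 'a::real_inner"
  assumes "open S" "0 \<in> S" "\<And>t. t \<in> S \<Longrightarrow> A t \<noteq> 0" "\<And>t. t \<in> S \<Longrightarrow> B t \<noteq> 0"
    and "\<And>t. t \<in> S \<Longrightarrow> (A has_vector_derivative A1 t) (at t)" "(A1 has_vector_derivative c) (at 0)"
    and "\<And>t. t \<in> S \<Longrightarrow> (B has_vector_derivative B1 t) (at t)" "(B1 has_vector_derivative d) (at 0)"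
    and "A 0 = B 0" "A1 0 = B1 0" "c = d + k *\<^sub>R B 0"
  shows "jet2 (\<lambda>t. sgn (A t)) = jet2 (\<lambda>t. sgn (B t))"
proof -
  define N where "N = inverse (norm (B 0))"
  have "N * (B 0 \<bullet> B 0) * N ^ 2 = N * (norm (B 0) * N)\<^sup>2"
    by (simp add: power2_norm_eq_inner[symmetric] power_mult_distrib)
  also have "\<dots> = N" using assms(4)[OF assms(2)] by (simp add: N_def)
  finally have "N = (B 0 \<bullet> B 0) * N ^ 3" by (simp add: power3_eq_cube power2_eq_square mult_ac)
  then have *: "N * k = k * (B 0 \<bullet> B 0) * N ^ 3" by (simp add: mult_ac)
  have "N *\<^sub>R (d + k *\<^sub>R B 0) - x - ((y + B 0 \<bullet> (d + k *\<^sub>R B 0)) * N ^ 3 - z) *\<^sub>R B 0 =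
     N *\<^sub>R d - x - ((y + B 0 \<bullet> d) * N ^ 3 - z) *\<^sub>R B 0" for x y z
  proof -
    have "N *\<^sub>R (d + k *\<^sub>R B 0) - x - ((y + B 0 \<bullet> (d + k *\<^sub>R B 0)) * N ^ 3 - z) *\<^sub>R B 0 =
      (N *\<^sub>R d - x - ((y + B 0 \<bullet> d) * N ^ 3 - z) *\<^sub>R B 0) + (N * k - k * (B 0 \<bullet> B 0) * N ^ 3) *\<^sub>R B 0"
      by (simp add: inner_add_right algebra_simps)
    then show ?thesis unfolding * by simp
  qed
  then have "(sgn (A 0), inverse (norm (A 0)) *\<^sub>R A1 0 - ((A 0 \<bullet> A1 0) * inverse (norm (A 0)) ^ 3) *\<^sub>R A 0,
     inverse (norm (A 0)) *\<^sub>R c - (2 * (A 0 \<bullet> A1 0) * inverse (norm (A 0)) ^ 3) *\<^sub>R A1 0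
       - ((A1 0 \<bullet> A1 0 + A 0 \<bullet> c) * inverse (norm (A 0)) ^ 3
         - 3 * (A 0 \<bullet> A1 0)\<^sup>2 * inverse (norm (A 0)) ^ 5) *\<^sub>R A 0) =
    (sgn (B 0), N *\<^sub>R B1 0 - ((B 0 \<bullet> B1 0) * N ^ 3) *\<^sub>R B 0,
     N *\<^sub>R d - (2 * (B 0 \<bullet> B1 0) * N ^ 3) *\<^sub>R B1 0
       - ((B1 0 \<bullet> B1 0 + B 0 \<bullet> d) * N ^ 3 - 3 * (B 0 \<bullet> B1 0)\<^sup>2 * N ^ 5) *\<^sub>R B 0)"
    unfolding assms(9-11) N_def[symmetric] by simp
  then show ?thesis
    unfolding N_def using jet2_sgn[OF assms(1-3,5,6)] jet2_sgn[OF assms(1,2,4,7,8)] by (simp only:)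
qed

section \<open>Deformations of tubes in normal form\<close>

lemma ray_scaleR: "k > 0 \<Longrightarrow> ray (k *\<^sub>R X) = ray X"
  by (simp add: ray_def sgn_scaleR)

lemma act_ray: "act F (ray X) = ray (F *v X)"
proof (cases "X = 0")
  case False
  then have "act F (ray X) = ray (inverse (norm X) *\<^sub>R (F *v X))"
    by (simp add: act_def ray_def sgn_div_norm[of X] matrix_vector_mult_scaleR)
  then show ?thesis using False by (simp add: ray_scaleR)
qed (simp add: act_def ray_def)

text \<open>Here \<sigma> is the affine parameter scaled to (0,1) and \<tau> its inverse, u is the
  coordinate along the fibre, and \<open>a\<close> is the only function in the structure equations,
  a curvature of the curve. A half tube becomes the strip of all (s, u) with s in (0,1).\<close>

locale tube_chart =
  fixes \<epsilon> :: real and M :: "(real \<times> (real^5)) set" and \<Lambda> :: "real set" and \<sigma> \<tau> a :: "real \<Rightarrow> real"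
    and \<gamma> T U r q :: "real \<Rightarrow> real^5"
  assumes eps: "\<epsilon> \<in> {1, -1}"
    and open_\<Lambda>: "open \<Lambda>" and \<Lambda>_nonempty: "\<Lambda> \<noteq> {}"
    and \<sigma>_in: "t \<in> \<Lambda> \<Longrightarrow> \<sigma> t \<in> {0<..<1}" and \<tau>_in: "s \<in> {0<..<1} \<Longrightarrow> \<tau> s \<in> \<Lambda>"
    and \<tau>_\<sigma>: "t \<in> \<Lambda> \<Longrightarrow> \<tau> (\<sigma> t) = t" and \<sigma>_\<tau>: "s \<in> {0<..<1} \<Longrightarrow> \<sigma> (\<tau> s) = s"
    and smooth_\<sigma>: "smooth_on \<Lambda> \<sigma>" and smooth_\<tau>: "smooth_on {0<..<1} \<tau>"
    and smooth_\<gamma>: "smooth_on {0<..<1} \<gamma>" and smooth_T: "smooth_on {0<..<1} T"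
    and smooth_U: "smooth_on {0<..<1} U" and smooth_r: "smooth_on {0<..<1} r"
    and smooth_q: "smooth_on {0<..<1} q"
    and frame: "s \<in> {0<..<1} \<Longrightarrow> null_frame (\<gamma> s) (T s) (U s) (r s) (q s)"
    and deriv_T: "s \<in> {0<..<1} \<Longrightarrow> (T has_vector_derivative U s) (at s)"
    and deriv_U: "s \<in> {0<..<1} \<Longrightarrow> (U has_vector_derivative a s *\<^sub>R T s) (at s)"
    and deriv_r: "s \<in> {0<..<1} \<Longrightarrow> (r has_vector_derivative q s) (at s)"
    and deriv_q: "s \<in> {0<..<1} \<Longrightarrow> (q has_vector_derivative \<gamma> s + a s *\<^sub>R r s) (at s)"
    and biproj_pos: "s \<in> {0<..<1} \<Longrightarrow> biproj (T s) (U s) > 0"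
    and M_eq: "M = {(t, ray (\<epsilon> *\<^sub>R (r (\<sigma> t) + u *\<^sub>R T (\<sigma> t)))) | t u. t \<in> \<Lambda>}"
begin

section \<open>Coordinates on a half tube\<close>

definition \<phi> :: "real \<Rightarrow> real \<Rightarrow> real^5" where
  "\<phi> s u = \<epsilon> *\<^sub>R (r s + u *\<^sub>R T s)"

definition chart :: "real \<times> real \<Rightarrow> real \<times> (real^5)" where
  "chart y = (\<tau> (fst y), ray (\<phi> (fst y) (snd y)))"

text \<open>The products of r + u T with q and U are - u and 1, and their quotient is homogeneous of
  degree zero, hence independent of how a ray is normalized. The formula makes sense on an open set
  of the ambient space, which is what \<open>smooth_map\<close> asks for.\<close>

definition coord :: "real \<times> (real^5) \<Rightarrow> real \<times> real" where
  "coord p = (\<sigma> (fst p), - (sprod (snd p) (q (\<sigma> (fst p))) / sprod (snd p) (U (\<sigma> (fst p)))))"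

definition coord_dom :: "(real \<times> (real^5)) set" where
  "coord_dom = {p \<in> \<Lambda> \<times> UNIV. sprod (snd p) (U (\<sigma> (fst p))) \<noteq> 0}"

lemma eps_nonzero: "\<epsilon> \<noteq> 0"
  using eps by auto

lemma sprod_\<phi>:
  assumes "s \<in> {0<..<1}"
  shows "sprod (\<phi> s u) (U s) = \<epsilon>" "sprod (\<phi> s u) (q s) = - (\<epsilon> * u)"
  by (simp_all add: \<phi>_def sprod_simps null_frameD[OF frame[OF assms]])

lemma \<phi>_nonzero: "s \<in> {0<..<1} \<Longrightarrow> \<phi> s u \<noteq> 0"
  using sprod_\<phi>(1)[of s u] eps_nonzero by (auto simp: sprod_simps)

lemma sprod_ray_\<phi>: "sprod (ray (\<phi> s u)) X = inverse (norm (\<phi> s u)) * sprod (\<phi> s u) X"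
  by (simp add: ray_def sgn_div_norm sprod_simps)

lemma chart_in: "s \<in> {0<..<1} \<Longrightarrow> chart (s, u) \<in> M"
  unfolding M_eq chart_def \<phi>_def using \<tau>_in \<sigma>_\<tau> by fastforce

lemma coord_chart:
  assumes "y \<in> {0<..<1} \<times> UNIV"
  shows "coord (chart y) = y"
proof -
  obtain s u where y: "y = (s, u)" "s \<in> {0<..<1}" using assms by auto
  show ?thesis
    using y(2) \<phi>_nonzero[OF y(2), of u] eps_nonzero
    by (simp add: y(1) coord_def chart_def \<sigma>_\<tau>[OF y(2)] sprod_ray_\<phi> sprod_\<phi>[OF y(2)])
qed

lemma M_cases:
  assumes "p \<in> M"
  obtains s u where "s \<in> {0<..<1}" "p = chart (s, u)"
proof -
  obtain t u where "t \<in> \<Lambda>" "p = (t, ray (\<epsilon> *\<^sub>R (r (\<sigma> t) + u *\<^sub>R T (\<sigma> t))))"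
    using assms unfolding M_eq by auto
  then show ?thesis
    using \<sigma>_in[of t] by (intro that[of "\<sigma> t" u]) (simp_all add: chart_def \<phi>_def \<tau>_\<sigma>)
qed

lemma chart_coord: "p \<in> M \<Longrightarrow> chart (coord p) = p"
  by (erule M_cases) (simp add: coord_chart)

lemma coord_in: "p \<in> M \<Longrightarrow> coord p \<in> {0<..<1} \<times> UNIV"
  by (erule M_cases) (simp add: coord_chart)

lemma M_subset: "M \<subseteq> coord_dom"
proof
  fix p assume "p \<in> M"
  then obtain s u where su: "s \<in> {0<..<1}" "p = chart (s, u)" by (rule M_cases)
  then show "p \<in> coord_dom"
    using \<tau>_in[OF su(1)] \<phi>_nonzero[OF su(1), of u] eps_nonzero
    by (simp add: coord_dom_def chart_def \<sigma>_\<tau>[OF su(1)] sprod_ray_\<phi> sprod_\<phi>[OF su(1)])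
qed

lemma M_nonempty: "M \<noteq> {}"
  using \<Lambda>_nonempty unfolding M_eq by auto

lemma smooth_fst_comp:
  assumes "smooth_on {0<..<1} f"
  shows "smooth_on (\<Lambda> \<times> UNIV) (\<lambda>p. f (\<sigma> (fst p)))"
proof -
  have op: "open (\<Lambda> \<times> (UNIV::'b::real_normed_vector set))" by (intro open_Times open_\<Lambda> open_UNIV)
  have *: "smooth_on (\<Lambda> \<times> (UNIV::'b set)) (\<lambda>p. \<sigma> (fst p))"
    by (rule smooth_on_compose[OF op open_\<Lambda> _ _ smooth_\<sigma>])
      (auto intro!: smooth_on_bounded_linear_comp[OF op bounded_linear_fst] smooth_on_id op)
  show ?thesis
    by (rule smooth_on_compose[OF op _ _ * assms]) (use \<sigma>_in in auto)
qed

lemma smooth_\<sigma>_fst: "smooth_on (\<Lambda> \<times> UNIV) (\<lambda>p. \<sigma> (fst p))"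
  by (rule smooth_fst_comp) (simp add: smooth_on_id)

lemma open_coord_dom: "open coord_dom"
proof -
  have op: "open (\<Lambda> \<times> (UNIV::(real^5) set))" by (intro open_Times open_\<Lambda> open_UNIV)
  have "continuous_on (\<Lambda> \<times> (UNIV::(real^5) set)) (\<lambda>p. sprod (snd p) (U (\<sigma> (fst p))))"
    by (rule sprod.continuous_on[OF continuous_on_snd[OF continuous_on_id]
          smooth_on_imp_continuous_on[OF smooth_fst_comp[OF smooth_U]]])
  then have "open ((\<Lambda> \<times> UNIV) \<inter> (\<lambda>p. sprod (snd p) (U (\<sigma> (fst p)))) -` (- {0}))"
    using op by (rule continuous_open_preimage) (auto intro: open_Compl)
  moreover have "coord_dom = (\<Lambda> \<times> UNIV) \<inter> (\<lambda>p. sprod (snd p) (U (\<sigma> (fst p)))) -` (- {0})"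
    by (auto simp: coord_dom_def)
  ultimately show ?thesis by simp
qed

lemma smooth_coord: "smooth_on coord_dom coord"
proof -
  note op = open_coord_dom
  have sub: "coord_dom \<subseteq> \<Lambda> \<times> UNIV" by (auto simp: coord_dom_def)
  have snd: "smooth_on coord_dom snd"
    by (rule smooth_on_bounded_linear_comp[OF op bounded_linear_snd smooth_on_id[OF op]])
  have *: "smooth_on coord_dom (\<lambda>p. sprod (snd p) (f (\<sigma> (fst p))))" if "smooth_on {0<..<1} f" for f
    by (intro smooth_on_bounded_bilinear[OF sprod.bounded_bilinear_axioms] op snd
        smooth_on_subset[OF smooth_fst_comp sub] that)
  show ?thesis
    unfolding coord_def
    by (intro smooth_on_Pair smooth_on_minus smooth_on_divide op * smooth_q smooth_U
        smooth_on_subset[OF smooth_\<sigma>_fst sub]) (auto simp: coord_dom_def)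
qed

lemma smooth_chart: "smooth_on ({0<..<1} \<times> UNIV) chart"
proof -
  have op: "open ({0<..<1::real} \<times> (UNIV::real set))" by (intro open_Times open_UNIV) simp
  have id: "smooth_on ({0<..<1} \<times> UNIV) (\<lambda>y::real \<times> real. fst y)"
    by (rule smooth_on_bounded_linear_comp[OF op bounded_linear_fst smooth_on_id[OF op]])
  have snd: "smooth_on ({0<..<1} \<times> UNIV) (\<lambda>y::real \<times> real. snd y)"
    by (rule smooth_on_bounded_linear_comp[OF op bounded_linear_snd smooth_on_id[OF op]])
  have *: "smooth_on ({0<..<1} \<times> UNIV) (\<lambda>y::real \<times> real. f (fst y))"
    if "smooth_on {0<..<1} f" for f :: "real \<Rightarrow> 'c::real_normed_vector"
    by (rule smooth_on_compose[OF op _ _ id that]) auto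
  show ?thesis
    unfolding chart_def ray_def
  proof (intro smooth_on_Pair smooth_on_sgn op *)
    show "smooth_on ({0<..<1} \<times> UNIV) (\<lambda>y. \<phi> (fst y) (snd y))"
      unfolding \<phi>_def
      by (intro smooth_on_scaleR smooth_on_add smooth_on_const * snd op smooth_r smooth_T)
  qed (auto simp: smooth_\<tau> \<phi>_nonzero)
qed

section \<open>Velocity and acceleration of the tube along a curve\<close>

definition \<phi>\<^sub>1 :: "real \<Rightarrow> real \<Rightarrow> real \<Rightarrow> real \<Rightarrow> real^5" where
  "\<phi>\<^sub>1 s u s1 u1 = \<epsilon> *\<^sub>R (s1 *\<^sub>R q s + u1 *\<^sub>R T s + (u * s1) *\<^sub>R U s)"

text \<open>The arguments s1, u1 and s2, u2 are first and second derivatives of s and u. All terms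
  containing \<open>a\<close> come from the derivatives of q and U; they are collected in the last
  summand, a multiple of \<open>\<phi> s u\<close>, so that the rest does not depend on the
  curvature.\<close>

definition \<phi>\<^sub>2 :: "real \<Rightarrow> real \<Rightarrow> real \<Rightarrow> real \<Rightarrow> real \<Rightarrow> real \<Rightarrow> real^5" where
  "\<phi>\<^sub>2 s u s1 u1 s2 u2 = \<epsilon> *\<^sub>R (s2 *\<^sub>R q s + s1\<^sup>2 *\<^sub>R \<gamma> s + u2 *\<^sub>R T s + (2 * u1 * s1 + u * s2) *\<^sub>R U s)
     + (a s * s1\<^sup>2) *\<^sub>R \<phi> s u"

lemma \<phi>_curve:
  assumes "s t \<in> {0<..<1}" "(s has_vector_derivative s1 t) (at t)" "(u has_vector_derivative u1 t) (at t)"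
  shows "((\<lambda>t. \<phi> (s t) (u t)) has_vector_derivative \<phi>\<^sub>1 (s t) (u t) (s1 t) (u1 t)) (at t)"
    and "(s1 has_vector_derivative s2) (at t) \<Longrightarrow> (u1 has_vector_derivative u2) (at t) \<Longrightarrow>
      ((\<lambda>t. \<phi>\<^sub>1 (s t) (u t) (s1 t) (u1 t)) has_vector_derivative \<phi>\<^sub>2 (s t) (u t) (s1 t) (u1 t) s2 u2) (at t)"
proof -
  note comp = vector_diff_chain_at[OF assms(2), unfolded o_def]
  note r' = comp[OF deriv_r[OF assms(1)]] and T' = comp[OF deriv_T[OF assms(1)]]
    and U' = comp[OF deriv_U[OF assms(1)]] and q' = comp[OF deriv_q[OF assms(1)]]
  note sc = bounded_bilinear.has_vector_derivative[OF bounded_bilinear_scaleR]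
  note mu = bounded_bilinear.has_vector_derivative[OF bounded_bilinear_mult]
  note cst = bounded_linear.has_vector_derivative[OF bounded_linear_scaleR_right]
  show "((\<lambda>t. \<phi> (s t) (u t)) has_vector_derivative \<phi>\<^sub>1 (s t) (u t) (s1 t) (u1 t)) (at t)"
    unfolding \<phi>_def \<phi>\<^sub>1_def
    by (rule has_vector_derivative_eq_rhs[OF cst[OF has_vector_derivative_add[OF r' sc[OF assms(3) T']]]])
      (simp add: algebra_simps)
  assume s2: "(s1 has_vector_derivative s2) (at t)" and u2: "(u1 has_vector_derivative u2) (at t)"
  show "((\<lambda>t. \<phi>\<^sub>1 (s t) (u t) (s1 t) (u1 t)) has_vector_derivative \<phi>\<^sub>2 (s t) (u t) (s1 t) (u1 t) s2 u2) (at t)"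
    unfolding \<phi>\<^sub>1_def \<phi>\<^sub>2_def \<phi>_def
    by (rule has_vector_derivative_eq_rhs[OF cst[OF has_vector_derivative_add[OF has_vector_derivative_add[OF
              sc[OF s2 q'] sc[OF u2 T']] sc[OF mu[OF assms(3) s2] U']]]])
      (simp add: vec_eq_iff power2_eq_square algebra_simps)
qed

end

locale tube_pair =
  A: tube_chart \<epsilon> M \<Lambda> \<sigma> \<tau> a \<gamma> T U r q + B: tube_chart \<epsilon> M' \<Lambda>' \<sigma>' \<tau>' a' \<gamma>' T' U' r' q'
  for \<epsilon> M \<Lambda> \<sigma> \<tau> a \<gamma> T U r q M' \<Lambda>' \<sigma>' \<tau>' a' \<gamma>' T' U' r' q' +
  assumes same_sgn: "s \<in> {0<..<1} \<Longrightarrow> sgn (det (frame_matrix (\<gamma> s) (T s) (U s) (r s) (q s)))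
    = sgn (det (frame_matrix (\<gamma>' s) (T' s) (U' s) (r' s) (q' s)))"
begin

section \<open>The change of parameters and the deformation\<close>

definition F :: "real \<Rightarrow> real^5^5" where
  "F s = frame_map (\<gamma> s) (T s) (U s) (r s) (q s) (\<gamma>' s) (T' s) (U' s) (r' s) (q' s)"

definition \<Delta> :: "real \<times> (real^5) \<Rightarrow> real^5^5" where
  "\<Delta> p = F (\<sigma> (fst p))"

definition \<Phi> :: "real \<times> (real^5) \<Rightarrow> real \<times> (real^5)" where
  "\<Phi> p = B.chart (A.coord p)"

lemma F_in_G: "s \<in> {0<..<1} \<Longrightarrow> F s \<in> G"
  unfolding F_def
  by (intro frame_map_in_G A.frame B.frame same_sgn A.biproj_pos B.biproj_pos)

lemma F_frame:
  assumes "s \<in> {0<..<1}"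
  shows "F s *v \<gamma>' s = \<gamma> s" "F s *v T' s = T s" "F s *v U' s = U s" "F s *v r' s = r s" "F s *v q' s = q s"
  unfolding F_def by (rule frame_map_frame[OF B.frame[OF assms]])+

text \<open>\<open>F s\<close> matches the frames at s. The structure equations of both tubes have
  the same coefficients except for a and a', so only a radial term survives in the difference of the
  accelerations.\<close>

lemma F_jets:
  assumes "s \<in> {0<..<1}"
  shows "F s *v B.\<phi> s u = A.\<phi> s u" "F s *v B.\<phi>\<^sub>1 s u s1 u1 = A.\<phi>\<^sub>1 s u s1 u1"
    "A.\<phi>\<^sub>2 s u s1 u1 s2 u2 = F s *v B.\<phi>\<^sub>2 s u s1 u1 s2 u2 + ((a s - a' s) * s1\<^sup>2) *\<^sub>R (F s *v B.\<phi> s u)"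
  by (simp_all add: A.\<phi>_def B.\<phi>_def A.\<phi>\<^sub>1_def B.\<phi>\<^sub>1_def A.\<phi>\<^sub>2_def B.\<phi>\<^sub>2_def matrix_vector_right_distrib
      matrix_vector_mult_scaleR F_frame[OF assms]) (simp add: algebra_simps)

lemma bij_\<Phi>: "bij_betw \<Phi> M M'"
proof (rule bij_betw_byWitness[where f' = "\<lambda>p. A.chart (B.coord p)"])
  show "\<forall>p\<in>M. A.chart (B.coord (\<Phi> p)) = p"
    by (simp add: \<Phi>_def A.coord_in B.coord_chart A.chart_coord)
  show "\<forall>p\<in>M'. \<Phi> (A.chart (B.coord p)) = p"
    by (simp add: \<Phi>_def B.coord_in A.coord_chart B.chart_coord)
  show "\<Phi> ` M \<subseteq> M'"
  proof (rule image_subsetI)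
    fix p assume "p \<in> M"
    then show "\<Phi> p \<in> M'"
      using A.coord_in[of p] B.chart_in[of "fst (A.coord p)" "snd (A.coord p)"]
      by (auto simp: \<Phi>_def mem_Times_iff)
  qed
  show "(\<lambda>p. A.chart (B.coord p)) ` M' \<subseteq> M"
  proof (rule image_subsetI)
    fix p assume "p \<in> M'"
    then show "A.chart (B.coord p) \<in> M"
      using B.coord_in[of p] A.chart_in[of "fst (B.coord p)" "snd (B.coord p)"]
      by (auto simp: mem_Times_iff)
  qed
qed

lemma inv_\<Phi>: "p \<in> M' \<Longrightarrow> inv_into M \<Phi> p = A.chart (B.coord p)"
proof (rule inv_into_f_eq)
  assume p: "p \<in> M'"
  show "inj_on \<Phi> M" using bij_\<Phi> by (rule bij_betw_imp_inj_on)
  show "A.chart (B.coord p) \<in> M" using B.coord_in[OF p] A.chart_in[of "fst (B.coord p)" "snd (B.coord p)"]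
    by (simp add: mem_Times_iff)
  show "\<Phi> (A.chart (B.coord p)) = p"
    using p by (simp add: \<Phi>_def B.coord_in A.coord_chart B.chart_coord)
qed

text \<open>Both maps are a chart after a coordinate map. They extend smoothly to the ambient open
  set on which the coordinate map is defined and takes its values in the strip.\<close>

lemma diffeomorphism_\<Phi>: "diffeomorphism M M' \<Phi>"
proof -
  have op: "open ({0<..<1::real} \<times> (UNIV::real set))" by (intro open_Times open_UNIV) simp
  have "smooth_map M \<Phi>"
  proof (rule smooth_map_if_smooth_on[where g = \<Phi>])
    show "open (A.coord_dom \<inter> A.coord -` ({0<..<1} \<times> UNIV))"
      by (rule continuous_open_preimage[OF smooth_on_imp_continuous_on[OF A.smooth_coord] A.open_coord_dom op])
    then show "smooth_on (A.coord_dom \<inter> A.coord -` ({0<..<1} \<times> UNIV)) \<Phi>"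
      unfolding \<Phi>_def
      by (rule smooth_on_compose[OF _ op _ _ B.smooth_chart])
        (auto intro: smooth_on_subset[OF A.smooth_coord])
    show "M \<subseteq> (A.coord_dom \<inter> A.coord -` ({0<..<1} \<times> UNIV))"
      using A.M_subset A.coord_in by blast
  qed simp
  moreover have "smooth_map M' (inv_into M \<Phi>)"
  proof (rule smooth_map_if_smooth_on[where g = "\<lambda>p. A.chart (B.coord p)"])
    show "open (B.coord_dom \<inter> B.coord -` ({0<..<1} \<times> UNIV))"
      by (rule continuous_open_preimage[OF smooth_on_imp_continuous_on[OF B.smooth_coord] B.open_coord_dom op])
    then show "smooth_on (B.coord_dom \<inter> B.coord -` ({0<..<1} \<times> UNIV)) (\<lambda>p. A.chart (B.coord p))"
      by (rule smooth_on_compose[OF _ op _ _ A.smooth_chart])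
        (auto intro: smooth_on_subset[OF B.smooth_coord])
    show "M' \<subseteq> (B.coord_dom \<inter> B.coord -` ({0<..<1} \<times> UNIV))"
      using B.M_subset B.coord_in by blast
  qed (rule inv_\<Phi>)
  ultimately show ?thesis
    using bij_\<Phi> by (simp add: diffeomorphism_def)
qed

lemma smooth_\<Delta>: "smooth_map M \<Delta>"
proof (rule smooth_map_if_smooth_on[where g = \<Delta> and U = "\<Lambda> \<times> UNIV"])
  have op: "open {0<..<1::real}" by simp
  have "smooth_on {0<..<1} F"
    unfolding F_def frame_map_def
    by (intro smooth_on_add smooth_on_diff smooth_on_bounded_bilinear[OF bounded_bilinear_outer] op
        A.smooth_\<gamma> A.smooth_T A.smooth_U A.smooth_r A.smooth_q
        B.smooth_\<gamma> B.smooth_T B.smooth_U B.smooth_r B.smooth_q)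
  then show "smooth_on (\<Lambda> \<times> UNIV) \<Delta>"
    unfolding \<Delta>_def by (rule A.smooth_fst_comp)
  show "M \<subseteq> \<Lambda> \<times> UNIV" unfolding A.M_eq by auto
  show "open (\<Lambda> \<times> (UNIV::(real^5) set))" by (intro open_Times open_UNIV A.open_\<Lambda>)
qed simp

lemma \<Delta>_in_G: "p \<in> M \<Longrightarrow> \<Delta> p \<in> G"
  using A.coord_in[of p] by (simp add: \<Delta>_def A.coord_def F_in_G)

lemma zero_order_contact:
  assumes "p \<in> M"
  shows "tube_map p = act (\<Delta> p) (tube_map (\<Phi> p))"
proof -
  obtain s u where su: "s \<in> {0<..<1}" "p = A.chart (s, u)" using assms by (rule A.M_cases)
  then show ?thesis
    using F_jets(1)[OF su(1)]
    by (simp add: tube_map_def \<Phi>_def A.coord_chart)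
      (simp add: \<Delta>_def A.chart_def B.chart_def A.\<sigma>_\<tau> act_ray)
qed

lemma contact:
  assumes p: "p \<in> M"
  shows "second_order_contact M tube_map (\<lambda>x. act (\<Delta> p) (tube_map (\<Phi> x))) p"
  unfolding second_order_contact_def
proof (intro allI impI, elim conjE)
  fix c :: "real \<Rightarrow> real \<times> (real^5)" and e :: real
  assume e: "0 < e" and c: "smooth_on {-e<..<e} c" and cM: "c ` {-e<..<e} \<subseteq> M" and c0: "c 0 = p"
  define S where "S = {-e<..<e}"
  have S: "open S" "0 \<in> S" using e by (auto simp: S_def)
  have cS: "c t \<in> M" if "t \<in> S" for t using cM that by (auto simp: S_def)
  \<comment> \<open>The test curve is lifted to the strip, so that the derivatives of both tube maps
    are given by the same s and u.\<close>
  define y where "y = (\<lambda>t. A.coord (c t))"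
  have y: "smooth_on S y"
    unfolding y_def
    by (rule smooth_on_compose[OF S(1) A.open_coord_dom _ c[folded S_def] A.smooth_coord]) (use cS A.M_subset in auto)
  define s u where "s = (\<lambda>t. fst (y t))" and "u = (\<lambda>t. snd (y t))"
  have s: "smooth_on S s" and u: "smooth_on S u"
    unfolding s_def u_def
    using smooth_on_bounded_linear_comp[OF S(1) bounded_linear_fst y]
      smooth_on_bounded_linear_comp[OF S(1) bounded_linear_snd y] .
  define s1 u1 where "s1 = (\<lambda>t. vector_derivative s (at t))" and "u1 = (\<lambda>t. vector_derivative u (at t))"
  define s2 u2 where "s2 = vector_derivative s1 (at 0)" and "u2 = vector_derivative u1 (at 0)"
  have s1: "(s has_vector_derivative s1 t) (at t)" and u1: "(u has_vector_derivative u1 t) (at t)"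
    if "t \<in> S" for t
    unfolding s1_def u1_def using smooth_on_has_vector_derivative s u that by blast+
  have s2: "(s1 has_vector_derivative s2) (at 0)" and u2: "(u1 has_vector_derivative u2) (at 0)"
    unfolding s2_def u2_def s1_def u1_def
    using smooth_on_has_vector_derivative smooth_on_vector_derivative S s u by blast+
  have sI: "s t \<in> {0<..<1}" if "t \<in> S" for t
    using A.coord_in[OF cS[OF that]] by (auto simp: s_def y_def)
  have ct: "c t = A.chart (s t, u t)" if "t \<in> S" for t
    using A.chart_coord[OF cS[OF that]] by (simp add: s_def u_def y_def)
  have coord: "A.coord (A.chart (s t, u t)) = (s t, u t)" if "t \<in> S" for t
    using sI[OF that] by (intro A.coord_chart) simp
  \<comment> \<open>Contact at p is tested with the single isometry \<open>\<Delta> p\<close>; as a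
    constant linear map it commutes with both differentiations.\<close>
  define F0 where "F0 = F (s 0)"
  have \<Delta>p: "\<Delta> p = F0"
    by (simp add: \<Delta>_def F0_def c0[symmetric] ct[OF S(2)] A.chart_def A.\<sigma>_\<tau>[OF sI[OF S(2)]] del: c0)
  have F0: "F0 *v X = 0 \<Longrightarrow> X = 0" for X
    using isometries_injective F_in_G[OF sI[OF S(2)]] G_subset_isometries by (auto simp: F0_def)
  note lin = bounded_linear.has_vector_derivative[OF matrix_vector_mul_bounded_linear[of F0]]
  have "jet2 (tube_map \<circ> c) = jet2 (\<lambda>t. sgn (A.\<phi> (s t) (u t)))"
    by (rule jet2_cong[OF S]) (simp add: ct tube_map_def A.chart_def ray_def)
  also have "\<dots> = jet2 (\<lambda>t. sgn (F0 *v B.\<phi> (s t) (u t)))"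
  proof (rule jet2_sgn_eqI[OF S, where k = "(a (s 0) - a' (s 0)) * (s1 0)\<^sup>2"])
    show "A.\<phi> (s t) (u t) \<noteq> 0" if "t \<in> S" for t by (rule A.\<phi>_nonzero[OF sI[OF that]])
    show "F0 *v B.\<phi> (s t) (u t) \<noteq> 0" if "t \<in> S" for t
      using F0 B.\<phi>_nonzero[OF sI[OF that]] by blast
    show "((\<lambda>t. A.\<phi> (s t) (u t)) has_vector_derivative A.\<phi>\<^sub>1 (s t) (u t) (s1 t) (u1 t)) (at t)" if "t \<in> S" for t
      by (rule A.\<phi>_curve(1)[OF sI s1 u1]) (rule that)+
    show "((\<lambda>t. F0 *v B.\<phi> (s t) (u t)) has_vector_derivative F0 *v B.\<phi>\<^sub>1 (s t) (u t) (s1 t) (u1 t)) (at t)"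
      if "t \<in> S" for t
      by (rule lin, rule B.\<phi>_curve(1)[OF sI s1 u1]) (rule that)+
    show "((\<lambda>t. A.\<phi>\<^sub>1 (s t) (u t) (s1 t) (u1 t)) has_vector_derivative A.\<phi>\<^sub>2 (s 0) (u 0) (s1 0) (u1 0) s2 u2) (at 0)"
      by (rule A.\<phi>_curve(2)[OF sI s1 u1 s2 u2]) (rule S)+
    show "((\<lambda>t. F0 *v B.\<phi>\<^sub>1 (s t) (u t) (s1 t) (u1 t)) has_vector_derivative
        F0 *v B.\<phi>\<^sub>2 (s 0) (u 0) (s1 0) (u1 0) s2 u2) (at 0)"
      by (rule lin, rule B.\<phi>_curve(2)[OF sI s1 u1 s2 u2]) (rule S)+
  qed (use F_jets[OF sI[OF S(2)]] in \<open>simp_all add: F0_def\<close>)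
  also have "\<dots> = jet2 ((\<lambda>x. act (\<Delta> p) (tube_map (\<Phi> x))) \<circ> c)"
    by (rule jet2_cong[OF S])
      (simp add: ct \<Phi>_def coord \<Delta>p tube_map_def B.chart_def act_ray, simp add: ray_def)
  finally show "jet2 (tube_map \<circ> c) = jet2 ((\<lambda>x. act (\<Delta> p) (tube_map (\<Phi> x))) \<circ> c)" .
qed

text \<open>If \<Delta> took one value only, \<open>zero_order_contact\<close> at all points would
  exhibit \<Phi> and that value as a congruence.\<close>

theorem deformation:
  assumes "\<not> congruent_maps M tube_map M' tube_map"
  shows "second_order_deformation M tube_map M' tube_map"
proof -
  have "\<not> \<Delta> constant_on M"
  proof
    assume "\<Delta> constant_on M"
    then obtain F where F: "\<And>p. p \<in> M \<Longrightarrow> \<Delta> p = F" by (auto simp: constant_on_def)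
    then have "F \<in> G" using A.M_nonempty \<Delta>_in_G by blast
    moreover have "\<forall>p\<in>M. tube_map p = act F (tube_map (\<Phi> p))"
      using zero_order_contact F by metis
    ultimately show False
      using assms diffeomorphism_\<Phi> unfolding congruent_maps_def by blast
  qed
  then show ?thesis
    unfolding second_order_deformation_def
    using diffeomorphism_\<Phi> smooth_\<Delta> \<Delta>_in_G contact by blast
qed

end

section \<open>Reduction to the normal form\<close>

lemma integrable_on_segment:
  fixes f :: "real \<Rightarrow> real"
  assumes "is_interval \<Lambda>" "continuous_on \<Lambda> f" "a \<in> \<Lambda>" "b \<in> \<Lambda>"
  shows "{a..b} \<subseteq> \<Lambda>" "continuous_on {a..b} f"
proof -
  show "{a..b} \<subseteq> \<Lambda>" using mem_is_interval_1_I[OF assms(1,3,4)] by auto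
  then show "continuous_on {a..b} f" using assms(2) continuous_on_subset by blast
qed

lemma antiderivative_exists:
  fixes f :: "real \<Rightarrow> real"
  assumes "open_interval \<Lambda>" "continuous_on \<Lambda> f"
  obtains S where "\<And>t. t \<in> \<Lambda> \<Longrightarrow> (S has_vector_derivative f t) (at t)"
proof -
  have \<Lambda>: "open \<Lambda>" "is_interval \<Lambda>" "\<Lambda> \<noteq> {}" using assms(1) by (auto simp: open_interval_def)
  then obtain t0 where t0: "t0 \<in> \<Lambda>" by blast
  \<comment> \<open>Integrals over reversed intervals are zero here, so of the two terms only one is
    active on each side of t0 and a single formula serves both.\<close>
  define S where "S = (\<lambda>t. integral {t0..t} f - integral {t..t0} f)"
  have "(S has_vector_derivative f t) (at t)" if t: "t \<in> \<Lambda>" for t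
  proof -
    obtain e where e: "e > 0" "ball (min t t0) e \<subseteq> \<Lambda>" using \<Lambda>(1) t t0 by (metis min_def open_contains_ball)
    obtain d where d: "d > 0" "ball (max t t0) d \<subseteq> \<Lambda>" using \<Lambda>(1) t t0 by (metis max_def open_contains_ball)
    \<comment> \<open>A closed interval in \<Lambda> with t and t0 in its interior, so that the
      derivative at t is two-sided. On it S differs by a constant from the integral starting at
      a.\<close>
    define a b where "a = min t t0 - e / 2" and "b = max t t0 + d / 2"
    have "a \<in> ball (min t t0) e" "b \<in> ball (max t t0) d" using e(1) d(1) by (auto simp: a_def b_def dist_real_def)
    then have ab: "a \<in> \<Lambda>" "b \<in> \<Lambda>" using e d by auto
    have atb: "a < t" "t < b" "a < t0" "t0 < b" using e(1) d(1) by (auto simp: a_def b_def)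
    note cont = integrable_on_segment(2)[OF \<Lambda>(2) assms(2) ab]
    have int: "f integrable_on {x..y}" if "a \<le> x" "y \<le> b" for x y
      using integrable_subinterval_real[OF integrable_continuous_real[OF cont]] that by auto
    have "((\<lambda>u. integral {a..u} f) has_vector_derivative f t) (at t)"
      using integral_has_vector_derivative[OF cont, of t] at_within_Icc_at[OF atb(1,2)] atb by simp
    then have "((\<lambda>u. integral {a..u} f - integral {a..t0} f) has_vector_derivative f t) (at t)"
      by (auto intro: derivative_eq_intros)
    then show ?thesis
    proof (rule has_vector_derivative_transform_within_open[where S = "{a<..<b}"])
      fix u assume "u \<in> {a<..<b}"
      then have u: "a \<le> u" "u \<le> b" by auto
      show "integral {a..u} f - integral {a..t0} f = S u"
      proof (cases "u \<le> t0")
        case True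
        then show ?thesis
          using Henstock_Kurzweil_Integration.integral_combine[of a u t0 f] u atb int
          by (cases "u = t0") (auto simp: S_def)
      next
        case False
        then show ?thesis
          using Henstock_Kurzweil_Integration.integral_combine[of a t0 u f] u atb int by (auto simp: S_def)
      qed
    qed (use atb in auto)
  qed
  then show thesis by (rule that)
qed

text \<open>Every increment of S is at most the integral of |f| over \<Lambda>. This is where
  finiteness of the affine length is used.\<close>

lemma bounded_antiderivative:
  fixes f :: "real \<Rightarrow> real"
  assumes "is_interval \<Lambda>" "continuous_on \<Lambda> f" "f absolutely_integrable_on \<Lambda>"
    and "\<And>t. t \<in> \<Lambda> \<Longrightarrow> (S has_vector_derivative f t) (at t)"
  shows "bounded (S ` \<Lambda>)"
proof (cases "\<Lambda> = {}")
  case False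
  then obtain t0 where t0: "t0 \<in> \<Lambda>" by blast
  define L where "L = integral \<Lambda> (\<lambda>t. \<bar>f t\<bar>)"
  have le: "\<bar>S y - S x\<bar> \<le> L" if "x \<le> y" "x \<in> \<Lambda>" "y \<in> \<Lambda>" for x y
  proof -
    note xy = integrable_on_segment[OF assms(1,2) that(2,3)]
    have "(f has_integral (S y - S x)) {x..y}"
      by (rule fundamental_theorem_of_calculus[OF that(1)])
        (rule has_vector_derivative_at_within, rule assms(4), use xy(1) in blast)
    then have "\<bar>S y - S x\<bar> = norm (integral {x..y} f)" by (simp add: integral_unique)
    also have "\<dots> \<le> integral {x..y} (\<lambda>t. \<bar>f t\<bar>)"
      using xy(2) by (intro integral_norm_bound_integral integrable_continuous_real continuous_intros) auto
    also have "\<dots> \<le> L"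
      unfolding L_def
    proof (rule integral_subset_le[OF xy(1)])
      show "(\<lambda>t. \<bar>f t\<bar>) integrable_on {x..y}"
        using xy(2) by (intro integrable_continuous_real continuous_intros)
      show "(\<lambda>t. \<bar>f t\<bar>) integrable_on \<Lambda>"
        using assms(3) by (simp add: absolutely_integrable_on_def)
    qed auto
    finally show ?thesis .
  qed
  have "\<bar>S t - S t0\<bar> \<le> L" if "t \<in> \<Lambda>" for t
    using le[of t t0] le[of t0 t] that t0 by (cases "t \<le> t0") (auto simp: abs_minus_commute)
  then have "\<bar>S t\<bar> \<le> L + \<bar>S t0\<bar>" if "t \<in> \<Lambda>" for t
    using that by (smt (verit))
  then show ?thesis unfolding bounded_iff by auto
qed simp

lemma open_bounded_interval:
  fixes I :: "real set"
  assumes "open I" "is_interval I" "bounded I" "I \<noteq> {}"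
  obtains a b where "a < b" "I = {a<..<b}"
proof
  have bdd: "bdd_below I" "bdd_above I"
    using assms(3) by (auto simp: bounded_imp_bdd_below bounded_imp_bdd_above)
  have "Inf I < x \<and> x < Sup I" if x: "x \<in> I" for x
  proof -
    obtain e where e: "e > 0" "ball x e \<subseteq> I" using assms(1) x open_contains_ball by blast
    then have "x - e / 2 \<in> I" "x + e / 2 \<in> I" by (auto simp: dist_real_def subset_iff)
    then show ?thesis
      using cInf_lower[OF _ bdd(1), of "x - e / 2"] cSup_upper[OF _ bdd(2), of "x + e / 2"] e(1) by auto
  qed
  moreover have "x \<in> I" if x: "Inf I < x" "x < Sup I" for x
  proof -
    obtain y z where "y \<in> I" "y < x" "z \<in> I" "x < z"
      using x cInf_lessD[OF assms(4)] less_cSup_iff[OF assms(4) bdd(2)] by blast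
    then show ?thesis using assms(2) unfolding is_interval_1 by (meson less_imp_le)
  qed
  ultimately show "I = {Inf I<..<Sup I}" by auto
  then show "Inf I < Sup I" using assms(4) by auto
qed

text \<open>An antiderivative S of \<zeta> is injective by Rolle's theorem, since \<zeta> has no
  zero, and its image is an open bounded interval (a, b). Put \<sigma> = (S - a) / l with l = b - a.
  The case of negative \<zeta> is included: l is positive throughout, while \<sigma> may decrease.
  The derivative of \<tau> comes from the inverse function theorem, its smoothness from the
  differential equation it satisfies.\<close>

lemma normalized_parameter:
  assumes \<Lambda>: "open_interval \<Lambda>" and smooth: "smooth_on \<Lambda> \<zeta>"
    and nz: "\<And>t. t \<in> \<Lambda> \<Longrightarrow> \<zeta> t \<noteq> 0" and int: "\<zeta> absolutely_integrable_on \<Lambda>"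
  obtains l \<sigma> \<tau> where "l > 0" "\<And>t. t \<in> \<Lambda> \<Longrightarrow> \<sigma> t \<in> {0<..<1}" "\<And>s. s \<in> {0<..<1} \<Longrightarrow> \<tau> s \<in> \<Lambda>"
    "\<And>t. t \<in> \<Lambda> \<Longrightarrow> \<tau> (\<sigma> t) = t" "\<And>s. s \<in> {0<..<1} \<Longrightarrow> \<sigma> (\<tau> s) = s"
    "smooth_on \<Lambda> \<sigma>" "smooth_on {0<..<1} \<tau>"
    "\<And>s. s \<in> {0<..<1} \<Longrightarrow> (\<tau> has_vector_derivative l / \<zeta> (\<tau> s)) (at s)"
proof -
  have op: "open \<Lambda>" and iv: "is_interval \<Lambda>" and ne: "\<Lambda> \<noteq> {}" using \<Lambda> by (auto simp: open_interval_def)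
  note cont = smooth_on_imp_continuous_on[OF smooth]
  obtain S where S: "\<And>t. t \<in> \<Lambda> \<Longrightarrow> (S has_vector_derivative \<zeta> t) (at t)"
    using antiderivative_exists[OF \<Lambda> cont] by blast
  have contS: "continuous_on \<Lambda> S"
    using S by (auto intro!: continuous_at_imp_continuous_on has_vector_derivative_continuous)
  have "S x \<noteq> S y" if xy: "x < y" "x \<in> \<Lambda>" "y \<in> \<Lambda>" for x y
  proof
    assume eq: "S x = S y"
    note seg = integrable_on_segment[OF iv cont xy(2,3)]
    have "\<exists>z. x < z \<and> z < y \<and> (\<lambda>h. h * \<zeta> z) = (\<lambda>h. 0)"
    proof (rule Rolle_deriv[OF xy(1)])
      show "continuous_on {x..y} S" using contS seg(1) continuous_on_subset by blast
      show "(S has_derivative (\<lambda>h. h * \<zeta> z)) (at z)" if "x < z" "z < y" for z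
        using S[of z] seg(1) that by (auto simp: has_vector_derivative_def subset_iff)
    qed (rule eq)
    then obtain z where "x < z" "z < y" "1 * \<zeta> z = 0" by meson
    then show False using nz[of z] subsetD[OF seg(1), of z] by auto
  qed
  then have inj: "inj_on S \<Lambda>" by (metis inj_onI linorder_neqE_linordered_idom)
  have "open (S ` \<Lambda>)" using invariance_of_domain[OF contS op inj] .
  moreover have "is_interval (S ` \<Lambda>)"
    using connected_continuous_image[OF contS] iv by (simp add: is_interval_connected_1)
  moreover have "bounded (S ` \<Lambda>)" using bounded_antiderivative[OF iv cont int S] .
  ultimately obtain a b where ab: "a < b" "S ` \<Lambda> = {a<..<b}"
    using open_bounded_interval ne by (metis image_is_empty)
  define l where "l = b - a"
  define \<sigma> where "\<sigma> = (\<lambda>t. (S t - a) / l)"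
  define \<tau> where "\<tau> = inv_into \<Lambda> \<sigma>"
  have l: "l > 0" using ab(1) by (simp add: l_def)
  have img: "\<sigma> ` \<Lambda> = {0<..<1}"
  proof -
    have "\<sigma> ` \<Lambda> = (\<lambda>x. (x - a) / l) ` {a<..<b}" by (simp add: \<sigma>_def image_image flip: ab(2))
    also have "\<dots> = {0<..<1}"
    proof (intro equalityI subsetI)
      fix y :: real assume "y \<in> {0<..<1}"
      then have "0 < l * y" "l * y < l * 1" using l by simp_all
      then have "a + l * y \<in> {a<..<b}" by (simp add: l_def)
      then show "y \<in> (\<lambda>x. (x - a) / l) ` {a<..<b}" using l by (intro image_eqI[of _ _ "a + l * y"]) auto
    qed (use l in \<open>auto simp: l_def\<close>)
    finally show ?thesis .
  qed
  have inj\<sigma>: "inj_on \<sigma> \<Lambda>" using inj l by (auto simp: inj_on_def \<sigma>_def)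
  have \<sigma>': "(\<sigma> has_vector_derivative \<zeta> t / l) (at t)" if "t \<in> \<Lambda>" for t
  proof -
    have "((\<lambda>t. (S t - a) / l) has_real_derivative (\<zeta> t / l)) (at t)"
      using S[OF that] l unfolding has_real_derivative_iff_has_vector_derivative[symmetric]
      by (auto intro!: derivative_eq_intros)
    then show ?thesis by (simp add: \<sigma>_def has_real_derivative_iff_has_vector_derivative)
  qed
  have in\<tau>: "\<tau> s \<in> \<Lambda>" "\<sigma> (\<tau> s) = s" if "s \<in> {0<..<1}" for s
    using that unfolding img[symmetric] \<tau>_def by (auto intro: inv_into_into f_inv_into_f)
  have \<tau>\<sigma>: "\<tau> (\<sigma> t) = t" if "t \<in> \<Lambda>" for t
    using that inj\<sigma> by (simp add: \<tau>_def)
  have \<tau>': "(\<tau> has_vector_derivative l / \<zeta> (\<tau> s)) (at s)" if s: "s \<in> {0<..<1}" for s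
  proof -
    have "(\<tau> has_derivative (\<lambda>h. h * (l / \<zeta> (\<tau> s)))) (at (\<sigma> (\<tau> s)))"
    proof (rule has_derivative_inverse_strong[OF op in\<tau>(1)[OF s]])
      show "continuous_on \<Lambda> \<sigma>"
        using \<sigma>' by (auto intro!: continuous_at_imp_continuous_on has_vector_derivative_continuous)
      show "(\<sigma> has_derivative (\<lambda>h. h * (\<zeta> (\<tau> s) / l))) (at (\<tau> s))"
        using \<sigma>'[OF in\<tau>(1)[OF s]] by (simp add: has_vector_derivative_def)
      show "(\<lambda>h. h * (\<zeta> (\<tau> s) / l)) \<circ> (\<lambda>h. h * (l / \<zeta> (\<tau> s))) = id"
        using l nz[OF in\<tau>(1)[OF s]] by (auto simp: fun_eq_iff)
    qed (rule \<tau>\<sigma>)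
    then show ?thesis by (simp add: has_vector_derivative_def in\<tau>(2)[OF s])
  qed
  show thesis
  proof (rule that[OF l _ in\<tau>(1) \<tau>\<sigma> in\<tau>(2) _ _ \<tau>'])
    show "\<sigma> t \<in> {0<..<1}" if "t \<in> \<Lambda>" for t using img that by blast
    show "smooth_on \<Lambda> \<sigma>"
      by (rule smooth_on_antiderivative[OF op, where g = "\<lambda>t. \<zeta> t / l"], rule \<sigma>')
        (use l in \<open>auto intro!: smooth_on_divide op smooth smooth_on_const\<close>)
    show "smooth_on {0<..<1} \<tau>"
      by (rule smooth_on_autonomous_ode[OF _ op _ \<tau>'])
        (use in\<tau>(1) nz in \<open>auto intro!: smooth_on_divide op smooth smooth_on_const\<close>)
  qed
qed

section \<open>Differentiating frame relations and changing the 1-form\<close>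

lemma sprod_constant_derivative:
  assumes "open I" "s \<in> I" "\<And>x. x \<in> I \<Longrightarrow> sprod (X x) (Y x) = c"
    and "(X has_vector_derivative X') (at s)" "(Y has_vector_derivative Y') (at s)"
  shows "sprod (X s) Y' + sprod X' (Y s) = 0"
proof -
  have "((\<lambda>x. sprod (X x) (Y x)) has_vector_derivative 0) (at s)"
    by (rule has_vector_derivative_transform_within_open[OF has_vector_derivative_const[of c] assms(1,2)])
      (simp add: assms(3))
  then show ?thesis
    using sprod.has_vector_derivative[OF assms(4,5)] vector_derivative_unique_at by blast
qed

lemma smooth_on_Prime:
  assumes "open \<Lambda>" "smooth_on \<Lambda> \<zeta>" "\<And>t. t \<in> \<Lambda> \<Longrightarrow> \<zeta> t \<noteq> 0" "smooth_on \<Lambda> H"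
  shows "smooth_on \<Lambda> (Prime \<zeta> H)"
  unfolding Prime_def[abs_def]
  by (intro smooth_on_scaleR smooth_on_inverse smooth_on_vector_derivative assms)

lemma Prime_reparametrized:
  assumes "open \<Lambda>" "smooth_on \<Lambda> H" "\<tau> s \<in> \<Lambda>" "(\<tau> has_vector_derivative l / \<zeta> (\<tau> s)) (at s)"
  shows "((\<lambda>s. H (\<tau> s)) has_vector_derivative l *\<^sub>R Prime \<zeta> H (\<tau> s)) (at s)"
  using vector_diff_chain_at[OF assms(4) smooth_on_has_vector_derivative[OF assms(2,3)]]
  by (simp add: Prime_def o_def divide_inverse)

text \<open>\<open>biisotropic\<close> and \<open>null_plane\<close> are stated with dt, the affine
  normalization with \<zeta>. Passing from one to the other rescales the first derivative and adds a
  multiple of it to the second.\<close>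

lemma Prime_Prime:
  assumes "open \<Lambda>" "smooth_on \<Lambda> \<zeta>" "\<And>t. t \<in> \<Lambda> \<Longrightarrow> \<zeta> t \<noteq> 0" "smooth_on \<Lambda> \<Gamma>" "t \<in> \<Lambda>"
  obtains x y where "Prime \<zeta> \<Gamma> t = inverse (\<zeta> t) *\<^sub>R Prime (\<lambda>_. 1) \<Gamma> t"
    "Prime \<zeta> (Prime \<zeta> \<Gamma>) t = x *\<^sub>R Prime (\<lambda>_. 1) (Prime (\<lambda>_. 1) \<Gamma>) t + y *\<^sub>R Prime (\<lambda>_. 1) \<Gamma> t"
proof -
  let ?T = "Prime (\<lambda>_. 1) \<Gamma>"
  have 1: "Prime \<zeta> \<Gamma> = (\<lambda>t. inverse (\<zeta> t) *\<^sub>R ?T t)"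
    by (simp add: Prime_def fun_eq_iff)
  have iz: "smooth_on \<Lambda> (\<lambda>t. inverse (\<zeta> t))" by (rule smooth_on_inverse[OF assms(1-3)])
  have "smooth_on \<Lambda> ?T" by (rule smooth_on_Prime[OF assms(1) smooth_on_const[OF assms(1)] _ assms(4)]) simp
  from bounded_bilinear.has_vector_derivative[OF bounded_bilinear_scaleR
      smooth_on_has_vector_derivative[OF iz assms(5)] smooth_on_has_vector_derivative[OF this assms(5)]]
  have "vector_derivative (Prime \<zeta> \<Gamma>) (at t) = inverse (\<zeta> t) *\<^sub>R vector_derivative ?T (at t)
      + vector_derivative (\<lambda>t. inverse (\<zeta> t)) (at t) *\<^sub>R ?T t"
    unfolding 1 by (rule vector_derivative_at)
  then have "Prime \<zeta> (Prime \<zeta> \<Gamma>) t = (inverse (\<zeta> t) * inverse (\<zeta> t)) *\<^sub>R Prime (\<lambda>_. 1) ?T t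
      + (inverse (\<zeta> t) * vector_derivative (\<lambda>t. inverse (\<zeta> t)) (at t)) *\<^sub>R ?T t"
    by (simp add: Prime_def[of \<zeta> "Prime \<zeta> \<Gamma>"] Prime_def[of "\<lambda>_. 1" ?T] scaleR_add_right)
  with fun_cong[OF 1] show thesis by (rule that)
qed

text \<open>The change of frame is lower triangular with diagonal 1, c1, c2, c3, c4. It compares the
  normalized frame with that of \<open>frame_det\<close>, where the four factors are powers of l
  with product 1.\<close>

lemma det_frame_matrix_triangular:
  "det (frame_matrix \<gamma> (c1 *\<^sub>R T) (c2 *\<^sub>R U) (c3 *\<^sub>R r + h *\<^sub>R T) (c4 *\<^sub>R q + x *\<^sub>R T + y *\<^sub>R U)) =
     c1 * c2 * c3 * c4 * det (frame_matrix \<gamma> T U r q)"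
proof -
  define E :: "real^5^5" where "E = (\<chi> i. if i = 0 then axis 0 1 else if i = 1 then axis 1 c1
    else if i = 2 then axis 2 c2 else if i = 3 then axis 3 c3 + axis 1 h
    else axis 4 c4 + axis 1 x + axis 2 y)"
  have "frame_matrix \<gamma> (c1 *\<^sub>R T) (c2 *\<^sub>R U) (c3 *\<^sub>R r + h *\<^sub>R T) (c4 *\<^sub>R q + x *\<^sub>R T + y *\<^sub>R U) $ i
      = (E ** frame_matrix \<gamma> T U r q) $ i" for i
    using exhaust_5[of i]
    by (elim disjE; simp; simp add: vec_eq_iff matrix_matrix_mult_def sum_5 frame_matrix_nth E_def axis_def)
  then have "frame_matrix \<gamma> (c1 *\<^sub>R T) (c2 *\<^sub>R U) (c3 *\<^sub>R r + h *\<^sub>R T) (c4 *\<^sub>R q + x *\<^sub>R T + y *\<^sub>R U)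
      = E ** frame_matrix \<gamma> T U r q"
    by (simp add: vec_eq_iff[of "frame_matrix _ _ _ _ _"])
  moreover have "(0::5) < 1" "(1::5) < 2" "(2::5) < 3" "(3::5) < 4"
    by (simp_all add: less_bit1_def bit1.Rep_0 bit1.Rep_1 bit1.Rep_numeral)
  then have "det E = prod (\<lambda>i. E $ i $ i) UNIV"
  proof (intro det_lowerdiagonal)
    fix i j :: 5
    assume o: "(0::5) < 1" "(1::5) < 2" "(2::5) < 3" "(3::5) < 4" and ij: "i < j"
    show "E $ i $ j = 0"
      using exhaust_5[of i] exhaust_5[of j] ij o by (elim disjE) (auto simp: E_def axis_def)
  qed
  moreover have "prod (\<lambda>i. E $ i $ i) UNIV = c1 * c2 * c3 * c4"
    unfolding UNIV_5 by (simp add: E_def axis_def)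
  ultimately show ?thesis by (simp add: det_mul)
qed

text \<open>Where the cosine is not zero, a ray of the tube is determined by its sign \<epsilon> and
  by tan \<theta>, positive factors being invisible; each half circle thus becomes a line. The
  function k shifts the origin of this line, which amounts to another choice of the normal field. Z
  certifies that the vectors are not zero.\<close>

lemma half_tube_eq:
  assumes "l > 0" "\<epsilon> \<in> {1, -1}"
    and null: "\<And>t. t \<in> \<Lambda> \<Longrightarrow> sprod (R t) (R t) = 0 \<and> sprod (R t) (Prime \<zeta> \<Gamma> t) = 0 \<and>
      sprod (Prime \<zeta> \<Gamma> t) (Prime \<zeta> \<Gamma> t) = 0"
    and Z: "\<And>t. t \<in> \<Lambda> \<Longrightarrow> sprod (R t) (Z t) = 1 \<and> sprod (Prime \<zeta> \<Gamma> t) (Z t) = 0"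
  shows "half_tube \<epsilon> \<Lambda> \<Gamma> \<zeta> R =
    {(t, ray (\<epsilon> *\<^sub>R ((1 / l\<^sup>2) *\<^sub>R R t + (k t + u * l) *\<^sub>R Prime \<zeta> \<Gamma> t))) | t u. t \<in> \<Lambda>}"
proof (intro set_eqI iffI)
  fix p assume "p \<in> half_tube \<epsilon> \<Lambda> \<Gamma> \<zeta> R"
  then obtain t \<theta> where p: "t \<in> \<Lambda>" "sgn (cos \<theta>) = \<epsilon>"
    "p = (t, ray (cos \<theta> *\<^sub>R R t + (1/2 * sin \<theta>) *\<^sub>R Prime \<zeta> \<Gamma> t))"
    by (auto simp: half_tube_def normal_tube_def)
  have c: "cos \<theta> \<noteq> 0" using p(2) assms(2) by auto
  have "\<epsilon> / (l\<^sup>2 * cos \<theta>) > 0"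
    using p(2)[symmetric] c assms(1) by (auto simp: sgn_if zero_less_mult_iff mult_pos_neg)
  then have "ray (cos \<theta> *\<^sub>R R t + (1/2 * sin \<theta>) *\<^sub>R Prime \<zeta> \<Gamma> t)
    = ray ((\<epsilon> / (l\<^sup>2 * cos \<theta>)) *\<^sub>R (cos \<theta> *\<^sub>R R t + (1/2 * sin \<theta>) *\<^sub>R Prime \<zeta> \<Gamma> t))"
    by (simp add: ray_scaleR)
  also have "(\<epsilon> / (l\<^sup>2 * cos \<theta>)) *\<^sub>R (cos \<theta> *\<^sub>R R t + (1/2 * sin \<theta>) *\<^sub>R Prime \<zeta> \<Gamma> t)
    = \<epsilon> *\<^sub>R ((1 / l\<^sup>2) *\<^sub>R R t + (k t + ((sin \<theta> / (2 * cos \<theta> * l\<^sup>2) - k t) / l) * l) *\<^sub>R Prime \<zeta> \<Gamma> t)"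
    using c assms(1) by (simp add: vec_eq_iff field_simps)
  finally show "p \<in> {(t, ray (\<epsilon> *\<^sub>R ((1 / l\<^sup>2) *\<^sub>R R t + (k t + u * l) *\<^sub>R Prime \<zeta> \<Gamma> t))) | t u. t \<in> \<Lambda>}"
    using p(1,3) by blast
next
  fix p assume "p \<in> {(t, ray (\<epsilon> *\<^sub>R ((1 / l\<^sup>2) *\<^sub>R R t + (k t + u * l) *\<^sub>R Prime \<zeta> \<Gamma> t))) | t u. t \<in> \<Lambda>}"
  then obtain t u where t: "t \<in> \<Lambda>"
    and p: "p = (t, ray (\<epsilon> *\<^sub>R ((1 / l\<^sup>2) *\<^sub>R R t + (k t + u * l) *\<^sub>R Prime \<zeta> \<Gamma> t)))" by blast
  define X where "X = \<epsilon> *\<^sub>R ((1 / l\<^sup>2) *\<^sub>R R t + (k t + u * l) *\<^sub>R Prime \<zeta> \<Gamma> t)"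
  \<comment> \<open>The value of tan \<theta>: the quotient of the two coefficients, doubled on
    account of the factor 1/2 in the tube. For \<epsilon> = -1 half a turn is added to the
    arctangent.\<close>
  define w where "w = 2 * (k t + u * l) * l\<^sup>2"
  define \<theta> where "\<theta> = arctan w + (if \<epsilon> = 1 then 0 else pi)"
  have c: "cos (arctan w) > 0" by (rule cos_gt_zero_pi) (rule arctan_lbound arctan_ubound)+
  have "sin (arctan w) = tan (arctan w) * cos (arctan w)" using c by (simp add: tan_def)
  then have s: "sin (arctan w) = w * cos (arctan w)" by (simp add: tan_arctan)
  have cs: "cos \<theta> = \<epsilon> * cos (arctan w)" "sin \<theta> = \<epsilon> * (w * cos (arctan w))"
    using assms(2) s by (auto simp: \<theta>_def)
  have "cos \<theta> *\<^sub>R R t + (1/2 * sin \<theta>) *\<^sub>R Prime \<zeta> \<Gamma> t = (l\<^sup>2 * cos (arctan w)) *\<^sub>R X"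
    using assms(1) by (simp add: cs X_def w_def vec_eq_iff field_simps)
  then have ray: "ray X = ray (cos \<theta> *\<^sub>R R t + (1/2 * sin \<theta>) *\<^sub>R Prime \<zeta> \<Gamma> t)"
    using assms(1) c by (simp add: ray_scaleR)
  have sg: "sgn (cos \<theta>) = \<epsilon>" using assms(2) c by (auto simp: cs sgn_mult)
  have "sprod X X = 0" using null[OF t] by (simp add: X_def sprod_simps sprod_commute)
  moreover have "sprod X (Z t) = \<epsilon> / l\<^sup>2" using Z[OF t] by (simp add: X_def sprod_simps)
  then have "X \<noteq> 0" using assms(1,2) by (auto simp: sprod_simps)
  ultimately have e: "ray X \<in> einstein" unfolding einstein_def by blast
  have "ray X \<in> span {R t, Prime \<zeta> \<Gamma> t}"
    unfolding ray_def sgn_div_norm X_def by (intro span_scale span_add span_base) auto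
  then show "p \<in> half_tube \<epsilon> \<Lambda> \<Gamma> \<zeta> R"
    using t e ray sg by (auto simp: p X_def[symmetric] half_tube_def normal_tube_def)
qed

text \<open>\<open>biproj V W\<close> is the sum of the entries (0,1) and (4,1) of
  \<open>wedge V W\<close> divided by \<open>sqrt 2\<close>, so it vanishes together with the
  bivector.\<close>

lemma positive_bivector_iff:
  "positive_bivector V W \<longleftrightarrow> sprod V V = 0 \<and> sprod W W = 0 \<and> sprod V W = 0 \<and> biproj V W > 0"
proof -
  have "biproj V W = 0" if "wedge V W = 0"
  proof -
    have "V $ i * W $ j = V $ j * W $ i" for i j
      using that by (simp add: wedge_def vec_eq_iff)
    from this[of 0 1] this[of 4 1] show ?thesis
      by (simp add: biproj_def sprod_P field_simps)
  qed
  then show ?thesis by (auto simp: positive_bivector_def biproj_def)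
qed

text \<open>Two normalizations produce the structure equations: the affine parameter makes U' a
  multiple of T, and a shift of the normal field along T makes its derivative null. The remaining
  relations follow by differentiating constant products.\<close>

lemma normal_form:
  assumes \<Lambda>: "open_interval \<Lambda>" and bi: "biisotropic \<Lambda> \<Gamma>" and ale: "affine_line_element \<Lambda> \<Gamma> \<zeta>"
    and int: "\<zeta> absolutely_integrable_on \<Lambda>" and iso: "isotropic_normal \<Lambda> \<Gamma> \<zeta> R"
  obtains \<sigma> \<tau> a \<gamma> T U r q
  where "\<And>\<epsilon>. \<epsilon> \<in> {1, -1} \<Longrightarrow> tube_chart \<epsilon> (half_tube \<epsilon> \<Lambda> \<Gamma> \<zeta> R) \<Lambda> \<sigma> \<tau> a \<gamma> T U r q"
    and "\<And>t. t \<in> \<Lambda> \<Longrightarrow> det (frame_matrix (\<gamma> (\<sigma> t)) (T (\<sigma> t)) (U (\<sigma> t)) (r (\<sigma> t)) (q (\<sigma> t))) = frame_det \<Gamma> \<zeta> R t"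
proof -
  have op: "open \<Lambda>" and iv: "is_interval \<Lambda>" and ne: "\<Lambda> \<noteq> {}" using \<Lambda> by (auto simp: open_interval_def)
  have sz: "smooth_on \<Lambda> \<zeta>" and nz: "\<And>t. t \<in> \<Lambda> \<Longrightarrow> \<zeta> t \<noteq> 0"
    using ale by (auto simp: affine_line_element_def)
  have s\<Gamma>: "smooth_on \<Lambda> \<Gamma>" using bi by (auto simp: biisotropic_def)
  have sR: "smooth_on \<Lambda> R" using iso by (auto simp: isotropic_normal_def)
  obtain l \<sigma> \<tau> where l: "l > 0" and \<sigma>in: "\<And>t. t \<in> \<Lambda> \<Longrightarrow> \<sigma> t \<in> {0<..<1}"
    and \<tau>in: "\<And>s. s \<in> {0<..<1} \<Longrightarrow> \<tau> s \<in> \<Lambda>"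
    and \<tau>\<sigma>: "\<And>t. t \<in> \<Lambda> \<Longrightarrow> \<tau> (\<sigma> t) = t" and \<sigma>\<tau>: "\<And>s. s \<in> {0<..<1} \<Longrightarrow> \<sigma> (\<tau> s) = s"
    and s\<sigma>: "smooth_on \<Lambda> \<sigma>" and s\<tau>: "smooth_on {0<..<1} \<tau>"
    and \<tau>': "\<And>s. s \<in> {0<..<1} \<Longrightarrow> (\<tau> has_vector_derivative l / \<zeta> (\<tau> s)) (at s)"
    by (rule normalized_parameter[OF \<Lambda> sz nz int]) blast+
  define I where "I = {0<..<1::real}"
  have opI: "open I" by (simp add: I_def)
  note inI = \<tau>in[folded I_def] and \<tau>'I = \<tau>'[folded I_def]
  let ?P = "Prime \<zeta> \<Gamma>" and ?Q = "Prime \<zeta> (Prime \<zeta> \<Gamma>)"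
  have sP: "smooth_on \<Lambda> ?P" and sQ: "smooth_on \<Lambda> ?Q" and sPR: "smooth_on \<Lambda> (Prime \<zeta> R)"
    by (intro smooth_on_Prime[OF op sz] nz s\<Gamma> sR; assumption)+
  have comp: "smooth_on I (\<lambda>s. H (\<tau> s))" if "smooth_on \<Lambda> H" for H :: "real \<Rightarrow> real^5"
    by (rule smooth_on_compose[OF opI op _ _ that]) (use inI s\<tau> in \<open>auto simp: I_def\<close>)
  \<comment> \<open>Differentiation by s is l times differentiation by \<zeta>, which explains the
    powers of l; the factor of R keeps its product with U equal to 1.\<close>
  define \<gamma> T U W r0 q0 where "\<gamma> = (\<lambda>s. \<Gamma> (\<tau> s))" and "T = (\<lambda>s. l *\<^sub>R ?P (\<tau> s))"
    and "U = (\<lambda>s. l\<^sup>2 *\<^sub>R ?Q (\<tau> s))" and "W = (\<lambda>s. l ^ 3 *\<^sub>R Prime \<zeta> ?Q (\<tau> s))"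
    and "r0 = (\<lambda>s. (1 / l\<^sup>2) *\<^sub>R R (\<tau> s))" and "q0 = (\<lambda>s. (1 / l) *\<^sub>R Prime \<zeta> R (\<tau> s))"
  have smooth: "smooth_on I \<gamma>" "smooth_on I T" "smooth_on I U" "smooth_on I r0" "smooth_on I q0"
    unfolding \<gamma>_def T_def U_def r0_def q0_def
    by (rule smooth_on_scaleR[OF opI smooth_on_const[OF opI]] comp s\<Gamma> sP sQ sR sPR)+
  note lin = bounded_linear.has_vector_derivative[OF bounded_linear_scaleR_right]
  have d: "(\<gamma> has_vector_derivative T s) (at s)" "(T has_vector_derivative U s) (at s)"
    "(U has_vector_derivative W s) (at s)" "(r0 has_vector_derivative q0 s) (at s)" if s: "s \<in> I" for s
  proof -
    note pr = Prime_reparametrized[where \<tau> = \<tau> and \<zeta> = \<zeta> and s = s and l = l, OF op _ inI[OF s] \<tau>'I[OF s]]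
    show "(\<gamma> has_vector_derivative T s) (at s)" unfolding \<gamma>_def T_def by (rule pr[OF s\<Gamma>])
    show "(T has_vector_derivative U s) (at s)" unfolding T_def U_def
      by (rule has_vector_derivative_eq_rhs[OF lin[OF pr[OF sP]]]) (simp add: power2_eq_square)
    show "(U has_vector_derivative W s) (at s)" unfolding U_def W_def
      by (rule has_vector_derivative_eq_rhs[OF lin[OF pr[OF sQ]]]) (simp add: power2_eq_square power3_eq_cube)
    show "(r0 has_vector_derivative q0 s) (at s)" unfolding r0_def q0_def
      by (rule has_vector_derivative_eq_rhs[OF lin[OF pr[OF sR]]]) (use l in \<open>simp add: power2_eq_square\<close>)
  qed
  have bi': "sprod (\<Gamma> t) (\<Gamma> t) = 1" "sprod (Prime (\<lambda>_. 1) \<Gamma> t) (Prime (\<lambda>_. 1) \<Gamma> t) = 0"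
    "sprod (Prime (\<lambda>_. 1) (Prime (\<lambda>_. 1) \<Gamma>) t) (Prime (\<lambda>_. 1) (Prime (\<lambda>_. 1) \<Gamma>) t) = 0" if "t \<in> \<Lambda>" for t
    using bi that by (auto simp: biisotropic_def S22_def Let_def)
  have deriv0: "sprod (X s) (Y' s) + sprod (X' s) (Y s) = 0"
    if "s \<in> I" "\<And>s. s \<in> I \<Longrightarrow> sprod (X s) (Y s) = c"
      "\<And>s. s \<in> I \<Longrightarrow> (X has_vector_derivative X' s) (at s)" "\<And>s. s \<in> I \<Longrightarrow> (Y has_vector_derivative Y' s) (at s)"
    for X Y X' Y' c s
    by (rule sprod_constant_derivative[OF opI that(1,2) that(3)[OF that(1)] that(4)[OF that(1)]])
  have \<gamma>\<gamma>: "sprod (\<gamma> s) (\<gamma> s) = 1" if "s \<in> I" for s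
    using bi'(1)[OF inI[OF that]] by (simp add: \<gamma>_def)
  have TT: "sprod (T s) (T s) = 0" and Tspan: "T s \<in> null_plane \<Gamma> (\<tau> s)" and Uspan: "U s \<in> null_plane \<Gamma> (\<tau> s)"
    and UU0: "sprod (T s) (U s) = 0 \<Longrightarrow> sprod (U s) (U s) = 0" if s: "s \<in> I" for s
  proof -
    let ?A = "Prime (\<lambda>_. 1) \<Gamma> (\<tau> s)" and ?B = "Prime (\<lambda>_. 1) (Prime (\<lambda>_. 1) \<Gamma>) (\<tau> s)"
    \<comment> \<open>The second derivative with respect to \<zeta> mixes ?B with ?A, so nullity of
      U needs the product of ?A and ?B to drop out; this is why it is derived here only under
      \<open>sprod (T s) (U s)\<close> = 0.\<close>
    obtain x y where xy: "?P (\<tau> s) = inverse (\<zeta> (\<tau> s)) *\<^sub>R ?A" "?Q (\<tau> s) = x *\<^sub>R ?B + y *\<^sub>R ?A"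
      by (rule Prime_Prime[OF op sz nz s\<Gamma> inI[OF s]])
    show "sprod (T s) (T s) = 0" using bi'(2)[OF inI[OF s]] by (simp add: T_def xy sprod_simps)
    show "T s \<in> null_plane \<Gamma> (\<tau> s)" "U s \<in> null_plane \<Gamma> (\<tau> s)"
      unfolding T_def U_def xy null_plane_def by (intro span_scale span_add span_base; simp)+
    assume "sprod (T s) (U s) = 0"
    then have "x * sprod ?A ?B = 0"
      using l nz[OF inI[OF s]] bi'(2)[OF inI[OF s]] by (simp add: T_def U_def xy sprod_simps)
    then show "sprod (U s) (U s) = 0"
      using bi'(2,3)[OF inI[OF s]] by (auto simp: U_def xy sprod_simps sprod_commute[of ?B ?A])
  qed
  have iso': "sprod (R t) (R t) = 0" "sprod (R t) (\<Gamma> t) = 0" "sprod (R t) (?P t) = 0" "sprod (R t) (?Q t) = 1"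
    if "t \<in> \<Lambda>" for t
    using iso that by (auto simp: isotropic_normal_def)
  have r0: "sprod (r0 s) (r0 s) = 0" "sprod (r0 s) (\<gamma> s) = 0" "sprod (r0 s) (T s) = 0" "sprod (r0 s) (U s) = 1"
    if "s \<in> I" for s
    using iso'[OF inI[OF that]] l by (simp_all add: r0_def \<gamma>_def T_def U_def sprod_simps)
  have \<gamma>T: "sprod (\<gamma> s) (T s) = 0" if "s \<in> I" for s
    using deriv0[OF that \<gamma>\<gamma> d(1) d(1)] by (simp add: sprod_commute)
  have \<gamma>U: "sprod (\<gamma> s) (U s) = 0" if "s \<in> I" for s
    using deriv0[OF that \<gamma>T d(1) d(2)] TT[OF that] by simp
  have TU: "sprod (T s) (U s) = 0" if "s \<in> I" for s
    using deriv0[OF that TT d(2) d(2)] by (simp add: sprod_commute)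
  note UU = UU0[OF _ TU]
  have TW: "sprod (T s) (W s) = 0" if "s \<in> I" for s
    using deriv0[OF that TU d(2) d(3)] UU[OF that that] by simp
  have UW: "sprod (U s) (W s) = 0" if "s \<in> I" for s
    using deriv0[OF that UU d(3) d(3)] that by (simp add: sprod_commute)
  have \<gamma>W: "sprod (\<gamma> s) (W s) = 0" if "s \<in> I" for s
    using deriv0[OF that \<gamma>U d(1) d(3)] TU[OF that] by simp
  have q0: "sprod (q0 s) (r0 s) = 0" "sprod (q0 s) (\<gamma> s) = 0" "sprod (q0 s) (T s) = -1"
    "sprod (q0 s) (U s) = - sprod (r0 s) (W s)" if "s \<in> I" for s
    using deriv0[OF that r0(1) d(4) d(4)] deriv0[OF that r0(2) d(4) d(1)] deriv0[OF that r0(3) d(4) d(2)]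
      deriv0[OF that r0(4) d(4) d(3)] r0[OF that] by (simp_all add: sprod_commute)

  obtain dA where dA: "\<And>t. t \<in> \<Lambda> \<Longrightarrow> positive_area_form (null_plane \<Gamma> t) dA"
    "\<And>t. t \<in> \<Lambda> \<Longrightarrow> dA (?P t) (?Q t) = 1"
    using ale by (auto simp: affine_line_element_def)
  have "bilinear dA" using dA(1) ne by (auto simp: positive_area_form_def)
  then interpret dA: bounded_bilinear dA by (simp add: bilinear_conv_bounded_bilinear)
  have alt: "dA V V = 0" if "s \<in> I" "V \<in> null_plane \<Gamma> (\<tau> s)" for s V
    using dA(1)[OF inI[OF that(1)]] that(2) by (auto simp: positive_area_form_def)
  have dTU: "dA (T s) (U s) = l ^ 3" if "s \<in> I" for s
    using dA(2)[OF inI[OF that]]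
    by (simp add: T_def U_def dA.scaleR_left dA.scaleR_right power2_eq_square power3_eq_cube)
  \<comment> \<open>The derivative of the constant dA(T, U) is dA(U, U) + dA(T, W), and dA is
    alternating on the null plane.\<close>
  have dTW: "dA (T s) (W s) = 0" if s: "s \<in> I" for s
  proof -
    have "((\<lambda>x. dA (T x) (U x)) has_vector_derivative 0) (at s)"
      by (rule has_vector_derivative_transform_within_open[OF has_vector_derivative_const[of "l ^ 3"] opI s])
        (simp add: dTU)
    then show ?thesis
      using dA.has_vector_derivative[OF d(2)[OF s] d(3)[OF s]] alt[OF s Uspan[OF s]] vector_derivative_unique_at
      by fastforce
  qed
  define a where "a = (\<lambda>s. - sprod (W s) (q0 s + (sprod (q0 s) (q0 s) / 2) *\<^sub>R T s + sprod (r0 s) (W s) *\<^sub>R r0 s))"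
  have W: "W s = a s *\<^sub>R T s" if s: "s \<in> I" for s
  proof -
    \<comment> \<open>A pointwise correction of q0: the T-term cancels its square, the r0-term its
      product with U. The result completes a null frame, in which W can be expanded;
      \<open>dTW\<close> then removes the U-component and leaves a T.\<close>
    define q1 where "q1 = q0 s + (sprod (q0 s) (q0 s) / 2) *\<^sub>R T s + sprod (r0 s) (W s) *\<^sub>R r0 s"
    have nf: "null_frame (\<gamma> s) (T s) (U s) (r0 s) q1"
      using \<gamma>\<gamma>[OF s] \<gamma>T[OF s] \<gamma>U[OF s] TT[OF s] TU[OF s] UU[OF s s] r0[OF s] q0[OF s]
      unfolding null_frame_def q1_def
      by (simp add: sprod_simps sprod_commute[of "\<gamma> s" "r0 s"] sprod_commute[of "\<gamma> s" "q0 s"]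
          sprod_commute[of "T s" "r0 s"] sprod_commute[of "T s" "q0 s"] sprod_commute[of "U s" "r0 s"]
          sprod_commute[of "U s" "q0 s"] sprod_commute[of "r0 s" "q0 s"] sprod_commute[of "U s" "T s"])
    have W: "W s = sprod (W s) (r0 s) *\<^sub>R U s - sprod (W s) q1 *\<^sub>R T s"
      using null_frame_expansion[OF nf, of "W s"] TW[OF s] UW[OF s] \<gamma>W[OF s]
      by (simp add: sprod_commute[of "W s" "\<gamma> s"] sprod_commute[of "W s" "T s"] sprod_commute[of "W s" "U s"])
    have "dA (T s) (W s) = sprod (W s) (r0 s) * l ^ 3"
      by (subst W) (simp add: dA.diff_right dA.scaleR_right dTU[OF s] alt[OF s Tspan[OF s]])
    then have "sprod (W s) (r0 s) = 0" using dTW[OF s] l by simp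
    then show ?thesis using W by (simp add: a_def q1_def)
  qed
  have q0U: "sprod (q0 s) (U s) = 0" if "s \<in> I" for s
    using q0(4)[OF that] W[OF that] r0(3)[OF that] by (simp add: sprod_simps)

  have sqq: "smooth_on I (\<lambda>s. sprod (q0 s) (q0 s) / 2)"
    by (intro smooth_on_divide smooth_on_bounded_bilinear[OF sprod.bounded_bilinear_axioms] smooth smooth_on_const opI) simp
  \<comment> \<open>With r = r0 + h T the square of r' is that of q0 minus 2 h', because q0 has
    product -1 with T and 0 with U. The choice of h' makes it zero.\<close>
  obtain h where h: "\<And>s. s \<in> I \<Longrightarrow> (h has_vector_derivative sprod (q0 s) (q0 s) / 2) (at s)"
    using antiderivative_exists[of I, OF _ smooth_on_imp_continuous_on[OF sqq]]
    by (auto simp: open_interval_def I_def is_interval_oo)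
  have sh: "smooth_on I h" by (rule smooth_on_antiderivative[OF opI h sqq])
  define r q where "r = (\<lambda>s. r0 s + h s *\<^sub>R T s)"
    and "q = (\<lambda>s. q0 s + (sprod (q0 s) (q0 s) / 2) *\<^sub>R T s + h s *\<^sub>R U s)"
  have sr: "smooth_on I r" and sq: "smooth_on I q"
    unfolding r_def q_def by (intro smooth_on_add smooth_on_scaleR smooth sh sqq opI)+
  have frame: "null_frame (\<gamma> s) (T s) (U s) (r s) (q s)" if s: "s \<in> I" for s
    using \<gamma>\<gamma>[OF s] \<gamma>T[OF s] \<gamma>U[OF s] TT[OF s] TU[OF s] UU[OF s s] r0[OF s] q0(1-3)[OF s] q0U[OF s]
    unfolding null_frame_def r_def q_def
    by (simp add: sprod_simps sprod_commute[of "\<gamma> s" "r0 s"] sprod_commute[of "\<gamma> s" "q0 s"]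
        sprod_commute[of "T s" "r0 s"] sprod_commute[of "T s" "q0 s"] sprod_commute[of "U s" "r0 s"]
        sprod_commute[of "U s" "q0 s"] sprod_commute[of "r0 s" "q0 s"] sprod_commute[of "U s" "T s"])
  have dr: "(r has_vector_derivative q s) (at s)" if s: "s \<in> I" for s
    unfolding r_def q_def
    by (rule has_vector_derivative_eq_rhs[OF has_vector_derivative_add[OF d(4)[OF s]
            bounded_bilinear.has_vector_derivative[OF bounded_bilinear_scaleR h[OF s] d(2)[OF s]]]]) simp
  have dq: "(q has_vector_derivative \<gamma> s + a s *\<^sub>R r s) (at s)" if s: "s \<in> I" for s
  proof -
    \<comment> \<open>The derivative of q is found from its products with the frame, each obtained
      by differentiating one constant entry of the Gram matrix.\<close>
    define q' where "q' = (\<lambda>s. vector_derivative q (at s))"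
    have q': "(q has_vector_derivative q' s) (at s)" if "s \<in> I" for s
      unfolding q'_def by (rule smooth_on_has_vector_derivative[OF sq that])
    note f = null_frameD[OF frame]
    have "sprod (q' s) (\<gamma> s) = 1" "sprod (q' s) (T s) = 0" "sprod (q' s) (U s) = a s"
      "sprod (q' s) (r s) = 0" "sprod (q' s) (q s) = 0"
      using deriv0[OF s f(19) q' d(1)] deriv0[OF s f(24) q' d(2)] deriv0[OF s f(22) q' d(3)]
        deriv0[OF s f(23) q' dr] deriv0[OF s f(5) q' q'] f[OF s] W[OF s]
      by (simp_all add: sprod_simps sprod_commute[of "q s" "q' s"])
    then have "q' s = \<gamma> s + a s *\<^sub>R r s"
      using null_frame_expansion[OF frame[OF s], of "q' s"] by simp
    then show ?thesis using q'[OF s] by simp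
  qed
  have pos: "biproj (T s) (U s) > 0" if s: "s \<in> I" for s
  proof -
    note f = null_frameD[OF frame[OF s]]
    have "biproj (T s) (U s) \<noteq> 0"
    proof (rule biproj_nonzero)
      fix x y assume "x *\<^sub>R T s + y *\<^sub>R U s = 0"
      then have "sprod (x *\<^sub>R T s + y *\<^sub>R U s) (q s) = 0" "sprod (x *\<^sub>R T s + y *\<^sub>R U s) (r s) = 0"
        by (simp_all add: sprod.zero_left)
      then show "x = 0 \<and> y = 0" by (simp add: sprod.add_left sprod.scaleR_left f)
    qed (simp_all add: f)
    \<comment> \<open>A negative value would make (U, T) a positive bivector and dA(U, T) positive,
      although dA alternates on the plane and dA(T, U) = l^3 is positive.\<close>
    moreover have "\<not> biproj (T s) (U s) < 0"
    proof
      assume "biproj (T s) (U s) < 0"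
      then have "biproj (U s) (T s) > 0" by (simp add: biproj_def mult.commute)
      then have "positive_bivector (U s) (T s)" by (simp add: positive_bivector_iff f)
      then have "dA (U s) (T s) > 0"
        using dA(1)[OF inI[OF s]] Tspan[OF s] Uspan[OF s] by (simp add: positive_area_form_def)
      moreover have "dA (T s + U s) (T s + U s) = 0"
        by (rule alt[OF s]) (use Tspan[OF s] Uspan[OF s] in \<open>simp add: null_plane_def span_add\<close>)
      ultimately show False
        using dTU[OF s] l alt[OF s Tspan[OF s]] alt[OF s Uspan[OF s]]
          zero_less_power[OF l, of 3] by (simp add: dA.add_left dA.add_right)
    qed
    ultimately show ?thesis by simp
  qed
  show thesis
  proof (rule that)
    fix \<epsilon> :: real assume \<epsilon>: "\<epsilon> \<in> {1, -1}"
    have "half_tube \<epsilon> \<Lambda> \<Gamma> \<zeta> R =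
      {(t, ray (\<epsilon> *\<^sub>R ((1 / l\<^sup>2) *\<^sub>R R t + (h (\<sigma> t) * l + u * l) *\<^sub>R ?P t))) | t u. t \<in> \<Lambda>}"
    proof (rule half_tube_eq[OF l \<epsilon>])
      fix t assume t: "t \<in> \<Lambda>"
      note \<sigma>I = \<sigma>in[OF t, folded I_def]
      show "sprod (R t) (R t) = 0 \<and> sprod (R t) (?P t) = 0 \<and> sprod (?P t) (?P t) = 0"
        using iso'[OF t] TT[OF \<sigma>I] l by (simp add: T_def \<tau>\<sigma>[OF t] sprod_simps)
      show "sprod (R t) (?Q t) = 1 \<and> sprod (?P t) (?Q t) = 0"
        using iso'[OF t] TU[OF \<sigma>I] l by (simp add: T_def U_def \<tau>\<sigma>[OF t] sprod_simps)
    qed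
    also have "\<dots> = {(t, ray (\<epsilon> *\<^sub>R (r (\<sigma> t) + u *\<^sub>R T (\<sigma> t)))) | t u. t \<in> \<Lambda>}"
    proof -
      have "(1 / l\<^sup>2) *\<^sub>R R t + (h (\<sigma> t) * l + u * l) *\<^sub>R ?P t = r (\<sigma> t) + u *\<^sub>R T (\<sigma> t)" if "t \<in> \<Lambda>" for t u
        by (simp add: r_def r0_def T_def \<tau>\<sigma>[OF that] scaleR_add_left)
      then show ?thesis by (auto simp del: scaleR_scaleR)
    qed
    finally have tube: "half_tube \<epsilon> \<Lambda> \<Gamma> \<zeta> R = {(t, ray (\<epsilon> *\<^sub>R (r (\<sigma> t) + u *\<^sub>R T (\<sigma> t)))) | t u. t \<in> \<Lambda>}" .
    have dU: "(U has_vector_derivative a s *\<^sub>R T s) (at s)" if "s \<in> I" for s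
      using d(3)[OF that] W[OF that] by simp
    note on_I = smooth(1-3) sr sq frame d(2) dU dr dq pos
    show "tube_chart \<epsilon> (half_tube \<epsilon> \<Lambda> \<Gamma> \<zeta> R) \<Lambda> \<sigma> \<tau> a \<gamma> T U r q"
      by (rule tube_chart.intro)
        (rule \<epsilon> op ne \<sigma>in \<tau>in \<tau>\<sigma> \<sigma>\<tau> s\<sigma> s\<tau> on_I[unfolded I_def] tube; assumption?)+
  next
    fix t assume t: "t \<in> \<Lambda>"
    have "det (frame_matrix (\<gamma> (\<sigma> t)) (T (\<sigma> t)) (U (\<sigma> t)) (r (\<sigma> t)) (q (\<sigma> t))) =
      l * l\<^sup>2 * (1 / l\<^sup>2) * (1 / l) * det (frame_matrix (\<Gamma> t) (?P t) (?Q t) (R t) (Prime \<zeta> R t))"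
      using det_frame_matrix_triangular[of "\<Gamma> t" l "?P t" "l\<^sup>2" "?Q t" "1 / l\<^sup>2" "R t" "h (\<sigma> t) * l" "1 / l"
          "Prime \<zeta> R t" "sprod (q0 (\<sigma> t)) (q0 (\<sigma> t)) / 2 * l" "h (\<sigma> t) * l\<^sup>2"]
      by (simp add: \<gamma>_def T_def U_def r_def q_def r0_def q0_def \<tau>\<sigma>[OF t])
    then show "det (frame_matrix (\<gamma> (\<sigma> t)) (T (\<sigma> t)) (U (\<sigma> t)) (r (\<sigma> t)) (q (\<sigma> t))) = frame_det \<Gamma> \<zeta> R t"
      using l by (simp add: frame_det_def frame_matrix_def)
  qed
qed

section \<open>Reversing the sign of a frame\<close>

text \<open>Negating \<epsilon> along with the frame leaves every vector \<epsilon> (r + u T), hence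
  M, unchanged. The structure equations are linear, and the Gram matrix and \<open>biproj\<close>
  are quadratic in the frame; the determinant, with its five rows, changes sign.\<close>

lemma (in tube_chart) tube_chart_uminus:
  "tube_chart (- \<epsilon>) M \<Lambda> \<sigma> \<tau> a (\<lambda>s. - \<gamma> s) (\<lambda>s. - T s) (\<lambda>s. - U s) (\<lambda>s. - r s) (\<lambda>s. - q s)"
proof
  show "- \<epsilon> \<in> {1, -1}" using eps by auto
  have "- \<epsilon> *\<^sub>R (- X + u *\<^sub>R - Y) = \<epsilon> *\<^sub>R (X + u *\<^sub>R Y)" for X Y :: "real^5" and u
    by (simp add: algebra_simps)
  then show "M = {(t, ray (- \<epsilon> *\<^sub>R (- r (\<sigma> t) + u *\<^sub>R - T (\<sigma> t)))) |t u. t \<in> \<Lambda>}"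
    unfolding M_eq by (simp only:)
  fix s :: real assume s: "s \<in> {0<..<1}"
  show "null_frame (- \<gamma> s) (- T s) (- U s) (- r s) (- q s)"
    using frame[OF s] by (simp add: null_frame_def sprod.minus_left sprod.minus_right)
  show "((\<lambda>s. - T s) has_vector_derivative - U s) (at s)" "((\<lambda>s. - U s) has_vector_derivative a s *\<^sub>R - T s) (at s)"
    "((\<lambda>s. - r s) has_vector_derivative - q s) (at s)"
    "((\<lambda>s. - q s) has_vector_derivative - \<gamma> s + a s *\<^sub>R - r s) (at s)"
    using has_vector_derivative_minus[OF deriv_T[OF s]] has_vector_derivative_minus[OF deriv_U[OF s]]
      has_vector_derivative_minus[OF deriv_r[OF s]] has_vector_derivative_minus[OF deriv_q[OF s]] by simp_all
  show "0 < biproj (- T s) (- U s)"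
    using biproj_pos[OF s] by (simp add: biproj_def sprod.minus_right)
qed (auto intro: open_\<Lambda> \<tau>_in smooth_\<sigma> smooth_\<tau> smooth_on_minus smooth_\<gamma> smooth_T smooth_U
      smooth_r smooth_q simp: \<Lambda>_nonempty \<tau>_\<sigma> \<sigma>_\<tau> dest: \<sigma>_in)

lemma (in tube_chart) sgn_det_constant:
  assumes "s \<in> {0<..<1}" "s' \<in> {0<..<1}"
  shows "sgn (det (frame_matrix (\<gamma> s) (T s) (U s) (r s) (q s))) = sgn (det (frame_matrix (\<gamma> s') (T s') (U s') (r s') (q s')))"
proof (rule sgn_constant_on_connected[OF _ _ _ assms])
  have det: "continuous_on UNIV (det :: real^5^5 \<Rightarrow> real)"
    unfolding det_def by (intro continuous_intros)
  have "continuous_on {0<..<1} (\<lambda>s. frame_matrix (\<gamma> s) (T s) (U s) (r s) (q s) $ i)" for i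
    using exhaust_5[of i]
    by (elim disjE) (simp_all add: frame_matrix_nth smooth_on_imp_continuous_on smooth_\<gamma> smooth_T smooth_U smooth_r smooth_q)
  then have "continuous_on {0<..<1} (\<lambda>s. frame_matrix (\<gamma> s) (T s) (U s) (r s) (q s))"
    by (intro continuous_on_vec_lambda[where f = "\<lambda>i s. frame_matrix (\<gamma> s) (T s) (U s) (r s) (q s) $ i", simplified])
  from continuous_on_compose2[OF det this]
  show "continuous_on {0<..<1} (\<lambda>s. det (frame_matrix (\<gamma> s) (T s) (U s) (r s) (q s)))" by simp
qed (use det_null_frame_nonzero[OF frame] in auto)

lemma det_frame_matrix_uminus:
  "det (frame_matrix (- \<gamma>) (- T) (- U) (- r) (- q)) = - det (frame_matrix \<gamma> T U r q)"
proof -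
  have "frame_matrix (- \<gamma>) (- T) (- U) (- r) (- q) $ i = (- mat 1 ** frame_matrix \<gamma> T U r q) $ i" for i
    using exhaust_5[of i]
    by (elim disjE; simp; simp add: vec_eq_iff matrix_matrix_mult_def sum_5 frame_matrix_nth mat_def)
  then have "frame_matrix (- \<gamma>) (- T) (- U) (- r) (- q) = - mat 1 ** frame_matrix \<gamma> T U r q"
    by (simp add: vec_eq_iff[of "frame_matrix _ _ _ _ _"])
  moreover have "det (- mat 1 :: real^5^5) = -1"
    by (subst det_diagonal) (auto simp: mat_def)
  ultimately show ?thesis by (simp add: det_mul)
qed

theorem proposition4p9:
  fixes \<Lambda> \<Lambda>' :: "real set" and \<Gamma> \<Gamma>' R R' :: "real \<Rightarrow> real^5"
    and \<zeta> \<zeta>' :: "real \<Rightarrow> real" and \<epsilon> \<epsilon>' :: real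
  assumes "open_interval \<Lambda>" and "open_interval \<Lambda>'"
    and "biisotropic \<Lambda> \<Gamma>" and "biisotropic \<Lambda>' \<Gamma>'"
    and "affine_line_element \<Lambda> \<Gamma> \<zeta>" and "affine_line_element \<Lambda>' \<Gamma>' \<zeta>'"
    and "\<zeta> absolutely_integrable_on \<Lambda>" and "\<zeta>' absolutely_integrable_on \<Lambda>'"
    and "isotropic_normal \<Lambda> \<Gamma> \<zeta> R" and "isotropic_normal \<Lambda>' \<Gamma>' \<zeta>' R'"
    and "\<epsilon> \<in> {1, -1}"
    and "\<epsilon>' = (if cooriented \<Lambda> \<Gamma> \<zeta> R \<Lambda>' \<Gamma>' \<zeta>' R' then \<epsilon> else - \<epsilon>)"
    and "\<not> congruent_maps (half_tube \<epsilon> \<Lambda> \<Gamma> \<zeta> R) tube_map (half_tube \<epsilon>' \<Lambda>' \<Gamma>' \<zeta>' R') tube_map"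
  shows "second_order_deformation (half_tube \<epsilon> \<Lambda> \<Gamma> \<zeta> R) tube_map (half_tube \<epsilon>' \<Lambda>' \<Gamma>' \<zeta>' R') tube_map"
proof -
  obtain \<sigma> \<tau> a \<gamma> T U r q
    where A0: "\<And>\<epsilon>. \<epsilon> \<in> {1, -1} \<Longrightarrow> tube_chart \<epsilon> (half_tube \<epsilon> \<Lambda> \<Gamma> \<zeta> R) \<Lambda> \<sigma> \<tau> a \<gamma> T U r q"
      and dA: "\<And>t. t \<in> \<Lambda> \<Longrightarrow> det (frame_matrix (\<gamma> (\<sigma> t)) (T (\<sigma> t)) (U (\<sigma> t)) (r (\<sigma> t)) (q (\<sigma> t))) = frame_det \<Gamma> \<zeta> R t"
    by (rule normal_form[OF assms(1,3,5,7,9)]) blast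
  obtain \<sigma>' \<tau>' a' \<gamma>' T' U' r' q'
    where B0: "\<And>\<epsilon>. \<epsilon> \<in> {1, -1} \<Longrightarrow> tube_chart \<epsilon> (half_tube \<epsilon> \<Lambda>' \<Gamma>' \<zeta>' R') \<Lambda>' \<sigma>' \<tau>' a' \<gamma>' T' U' r' q'"
      and dB: "\<And>t. t \<in> \<Lambda>' \<Longrightarrow> det (frame_matrix (\<gamma>' (\<sigma>' t)) (T' (\<sigma>' t)) (U' (\<sigma>' t)) (r' (\<sigma>' t)) (q' (\<sigma>' t))) = frame_det \<Gamma>' \<zeta>' R' t"
    by (rule normal_form[OF assms(2,4,6,8,10)]) blast
  have \<epsilon>': "\<epsilon>' \<in> {1, -1}" using assms(11,12) by auto
  interpret X: tube_chart \<epsilon> "half_tube \<epsilon> \<Lambda> \<Gamma> \<zeta> R" \<Lambda> \<sigma> \<tau> a \<gamma> T U r q by (rule A0[OF assms(11)])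
  interpret Y: tube_chart \<epsilon>' "half_tube \<epsilon>' \<Lambda>' \<Gamma>' \<zeta>' R'" \<Lambda>' \<sigma>' \<tau>' a' \<gamma>' T' U' r' q' by (rule B0[OF \<epsilon>'])
  define D where "D = (\<lambda>s. det (frame_matrix (\<gamma> s) (T s) (U s) (r s) (q s)))"
  define D' where "D' = (\<lambda>s. det (frame_matrix (\<gamma>' s) (T' s) (U' s) (r' s) (q' s)))"
  have D: "sgn (frame_det \<Gamma> \<zeta> R t) = sgn (D s)" if "t \<in> \<Lambda>" "s \<in> {0<..<1}" for s t
    using X.sgn_det_constant[OF X.\<sigma>_in[OF that(1)] that(2)] dA[OF that(1)] by (simp add: D_def)
  have D': "sgn (frame_det \<Gamma>' \<zeta>' R' t) = sgn (D' s)" if "t \<in> \<Lambda>'" "s \<in> {0<..<1}" for s t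
    using Y.sgn_det_constant[OF Y.\<sigma>_in[OF that(1)] that(2)] dB[OF that(1)] by (simp add: D'_def)
  have nz: "D s \<noteq> 0" "D' s \<noteq> 0" if "s \<in> {0<..<1}" for s
    unfolding D_def D'_def by (rule det_null_frame_nonzero, rule X.frame Y.frame, rule that)+
  show ?thesis
  proof (cases "cooriented \<Lambda> \<Gamma> \<zeta> R \<Lambda>' \<Gamma>' \<zeta>' R'")
    case True
    then have [simp]: "\<epsilon>' = \<epsilon>" using assms(12) by simp
    interpret tube_pair \<epsilon> "half_tube \<epsilon> \<Lambda> \<Gamma> \<zeta> R" \<Lambda> \<sigma> \<tau> a \<gamma> T U r q
      "half_tube \<epsilon>' \<Lambda>' \<Gamma>' \<zeta>' R'" \<Lambda>' \<sigma>' \<tau>' a' \<gamma>' T' U' r' q'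
    proof (intro tube_pair.intro tube_pair_axioms.intro)
      fix s :: real assume s: "s \<in> {0<..<1}"
      have "sgn (frame_det \<Gamma> \<zeta> R (\<tau> s)) = sgn (frame_det \<Gamma>' \<zeta>' R' (\<tau>' s))"
        using True X.\<tau>_in[OF s] Y.\<tau>_in[OF s] unfolding cooriented_def by blast
      then show "sgn (det (frame_matrix (\<gamma> s) (T s) (U s) (r s) (q s))) =
          sgn (det (frame_matrix (\<gamma>' s) (T' s) (U' s) (r' s) (q' s)))"
        using D[OF X.\<tau>_in[OF s] s] D'[OF Y.\<tau>_in[OF s] s] by (simp add: D_def D'_def)
    qed (use X.tube_chart_axioms Y.tube_chart_axioms in simp_all)
    show ?thesis using assms(13) by (rule deformation)
  next
    case False
    then have \<epsilon>'': "- \<epsilon>' = \<epsilon>" using assms(12) by simp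
    from False obtain t t' where t: "t \<in> \<Lambda>" "t' \<in> \<Lambda>'" "sgn (frame_det \<Gamma> \<zeta> R t) \<noteq> sgn (frame_det \<Gamma>' \<zeta>' R' t')"
      by (auto simp: cooriented_def)
    \<comment> \<open>The half with sign \<epsilon>' is described by the negated frame with sign -
      \<epsilon>' = \<epsilon>. Now both charts carry the same sign and their frame determinants
      agree in sign as well.\<close>
    interpret tube_pair \<epsilon> "half_tube \<epsilon> \<Lambda> \<Gamma> \<zeta> R" \<Lambda> \<sigma> \<tau> a \<gamma> T U r q
      "half_tube \<epsilon>' \<Lambda>' \<Gamma>' \<zeta>' R'" \<Lambda>' \<sigma>' \<tau>' a' "\<lambda>s. - \<gamma>' s" "\<lambda>s. - T' s" "\<lambda>s. - U' s" "\<lambda>s. - r' s" "\<lambda>s. - q' s"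
    proof (intro tube_pair.intro tube_pair_axioms.intro)
      fix s :: real assume s: "s \<in> {0<..<1}"
      have "sgn (D s) \<noteq> sgn (D' s)" using t(3) D[OF t(1) s] D'[OF t(2) s] by simp
      then have "sgn (D s) = sgn (- D' s)"
        using nz[OF s] by (auto simp: sgn_if split: if_splits)
      then show "sgn (det (frame_matrix (\<gamma> s) (T s) (U s) (r s) (q s))) =
          sgn (det (frame_matrix (- \<gamma>' s) (- T' s) (- U' s) (- r' s) (- q' s)))"
        by (simp add: D_def D'_def det_frame_matrix_uminus)
    qed (use X.tube_chart_axioms Y.tube_chart_uminus \<epsilon>'' in simp_all)
    show ?thesis using assms(13) by (rule deformation)
  qed
qed

end
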